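(* Let $(\mathcal{K},\otimes,1)$ be an idempotent complete strongly closed tensor triangulated category with suspension $T$, and suppose $\mathrm{Spc}(\mathcal{K})=U_1\cup U_2$ with $U_1,U_2$ quasi-compact open subsets. Then for each pair of objects $a,b\in\mathcal{K}$, the connecting homomorphism $\partial:\mathrm{Mor}_{U_1\cap U_2}(a,b)\to\mathrm{Mor}_{\mathcal{K}}(a,Tb)$ described in the context is a well-defined homomorphism (independent of all choices), and there is a long exact sequence of abelian groups $$\cdots\to\mathrm{Mor}_{U_1\cap U_2}(Ta,b)\xrightarrow{\ \partial\ }\mathrm{Mor}_{\mathcal{K}}(a,b)\to\mathrm{Mor}_{U_1}(a,b)\oplus\mathrm{Mor}_{U_2}(a,b)\to\mathrm{Mor}_{U_1\cap U_2}(a,b)\xrightarrow{\ \partial\ }\mathrm{Mor}_{\mathcal{K}}(a,Tb)\to\cdots$$ where the non-labelled homomorphisms are the restrictions $f\mapsto(\rho_{U_1}(f),\rho_{U_2}(f))$ and the differences of restrictions to $U_1\cap U_2$.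
   Context: A tensor triangulated category $(\mathcal{K},\otimes,1)$ is an essentially small triangulated category $\mathcal{K}$ (suspension $T$) with a symmetric monoidal structure $\otimes$ with unit $1$ such that $a\otimes-$ and $-\otimes b$ are exact for all $a,b$ and the two canonical composites $T(a)\otimes T(b)\cong T(T(a)\otimes b)\cong T^2(a\otimes b)$ and $T(a)\otimes T(b)\cong T(a\otimes T(b))\cong T^2(a\otimes b)$ differ by the sign $-1$. It is strongly closed if there is a bi-exact functor $\underline{\hom}:\mathcal{K}^{op}\times\mathcal{K}\to\mathcal{K}$ with natural isomorphisms $\mathrm{Mor}_{\mathcal{K}}(a\otimes b,c)\cong\mathrm{Mor}_{\mathcal{K}}(a,\underline{\hom}(b,c))$ and such that the natural morphism $D(a)\otimes b\to\underline{\hom}(a,b)$ is an isomorphism for all $a,b$, where $D(a)=\underline{\hom}(a,1)$. It is idempotent complete if every idempotent endomorphism of every object splits. A prime ideal is a proper full triangulated subcategory $\mathcal{P}\subsetneq\mathcal{K}$ which is thick ($a\oplus b\in\mathcal{P}\Rightarrow a,b\in\mathcal{P}$), a $\otimes$-ideal ($a\in\mathcal{P},\,b\in\mathcal{K}\Rightarrow a\otimes b\in\mathcal{P}$) and prime ($a\otimes b\in\mathcal{P}\Rightarrow a\in\mathcal{P}$ or $b\in\mathcal{P}$). The spectrum $\mathrm{Spc}(\mathcal{K})$ is the set of prime ideals; $\mathrm{supp}(a)=\{\mathcal{P}\mid a\notin\mathcal{P}\}$; the complements of the sets $\mathrm{supp}(a)$, $a\in\mathcal{K}$, form a basis of the topology.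 For $Y\subset\mathrm{Spc}(\mathcal{K})$, $\mathcal{K}_Y$ is the full subcategory of objects $a$ with $\mathrm{supp}(a)\subset Y$. For $U\subset\mathrm{Spc}(\mathcal{K})$ quasi-compact open with complement $Z$, $\mathcal{L}(U)=\mathcal{K}/\mathcal{K}_Z$ is the Verdier quotient, $\mathcal{K}(U)$ is its idempotent completion, $\rho_U:\mathcal{K}\to\mathcal{K}(U)$ is the canonical functor, and $\mathrm{Mor}_U(a,b):=\mathrm{Mor}_{\mathcal{L}(U)}(\rho_U(a),\rho_U(b))=\mathrm{Mor}_{\mathcal{K}(U)}(\rho_U(a),\rho_U(b))$ for $a,b\in\mathcal{K}$. Write $Z_i=\mathrm{Spc}(\mathcal{K})\smallsetminus U_i$. Definition of $\partial$: represent $g\in\mathrm{Mor}_{U_1\cap U_2}(a,b)$ by a fraction $a\xleftarrow{s}x\xrightarrow{f}b$ in $\mathcal{K}$ with $\mathrm{cone}(s)\in\mathcal{K}_{Z_1\cup Z_2}$. Since $\mathcal{K}_{Z_1\cup Z_2}=\mathcal{K}_{Z_1}\oplus\mathcal{K}_{Z_2}$ (known), choose a distinguished triangle $x\xrightarrow{s}a\xrightarrow{\binom{\alpha}{\beta}}c_1\oplus c_2\xrightarrow{(\gamma\ \delta)}Tx$ with $c_i\in\mathcal{K}_{Z_i}$. Set $\partial(g)=T(f)\circ\gamma\circ\alpha=-T(f)\circ\delta\circ\beta:a\to T(b)$. The map $\partial:\mathrm{Mor}_{U_1\cap U_2}(Ta,b)\to\mathrm{Mor}_{\mathcal{K}}(a,b)$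 is the previous one followed by $T^{-1}:\mathrm{Mor}_{\mathcal{K}}(Ta,Tb)\cong\mathrm{Mor}_{\mathcal{K}}(a,b)$. The long exact sequence continues in both directions by replacing $a$, respectively $b$, by their iterated suspensions. *)

theory Defs
  imports "HOL-Algebra.Coset" "HOL-Analysis.Abstract_Topology"
begin

section \<open>Additive categories\<close>

(* Objects and morphisms form sets, so the categories below are small. Up to equivalence these
   are exactly the essentially small categories. *)

record ('o, 'm) category =
  Ob :: "'o set"
  Mor :: "'m set"
  Dom :: "'m \<Rightarrow> 'o"
  Cod :: "'m \<Rightarrow> 'o"
  Id :: "'o \<Rightarrow> 'm"
  Comp :: "'m \<Rightarrow> 'm \<Rightarrow> 'm" (infixr "\<cdot>\<index>" 75)

definition Hom :: "('o, 'm, 'z) category_scheme \<Rightarrow> 'o \<Rightarrow> 'o \<Rightarrow> 'm set"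
  where "Hom K a b = {f \<in> Mor K. Dom K f = a \<and> Cod K f = b}"

locale category =
  fixes K :: "('o, 'm, 'z) category_scheme" (structure)
  assumes Dom_closed: "f \<in> Mor K \<Longrightarrow> Dom K f \<in> Ob K"
    and Cod_closed: "f \<in> Mor K \<Longrightarrow> Cod K f \<in> Ob K"
    and Id_closed: "a \<in> Ob K \<Longrightarrow> Id K a \<in> Hom K a a"
    and Comp_closed: "f \<in> Hom K a b \<Longrightarrow> g \<in> Hom K b c \<Longrightarrow> g \<cdot> f \<in> Hom K a c"
    and Comp_Id: "f \<in> Hom K a b \<Longrightarrow> f \<cdot> Id K a = f"
    and Id_Comp: "f \<in> Hom K a b \<Longrightarrow> Id K b \<cdot> f = f"
    and Comp_assoc: "f \<in> Hom K a b \<Longrightarrow> g \<in> Hom K b c \<Longrightarrow> h \<in> Hom K c d \<Longrightarrow>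
           (h \<cdot> g) \<cdot> f = h \<cdot> (g \<cdot> f)"

definition is_iso :: "('o, 'm, 'z) category_scheme \<Rightarrow> 'm \<Rightarrow> 'o \<Rightarrow> 'o \<Rightarrow> bool"
  where "is_iso K f a b \<longleftrightarrow> f \<in> Hom K a b \<and>
           (\<exists>g\<in>Hom K b a. g \<cdot>\<^bsub>K\<^esub> f = Id K a \<and> f \<cdot>\<^bsub>K\<^esub> g = Id K b)"

definition inv_mor :: "('o, 'm, 'z) category_scheme \<Rightarrow> 'm \<Rightarrow> 'm"
  where "inv_mor K f = (THE g. g \<in> Hom K (Cod K f) (Dom K f) \<and>
           g \<cdot>\<^bsub>K\<^esub> f = Id K (Dom K f) \<and> f \<cdot>\<^bsub>K\<^esub> g = Id K (Cod K f))"

definition idempotent_complete :: "('o, 'm, 'z) category_scheme \<Rightarrow> bool"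
  where "idempotent_complete K \<longleftrightarrow>
           (\<forall>a\<in>Ob K. \<forall>e\<in>Hom K a a. e \<cdot>\<^bsub>K\<^esub> e = e \<longrightarrow>
             (\<exists>b\<in>Ob K. \<exists>r\<in>Hom K a b. \<exists>i\<in>Hom K b a. i \<cdot>\<^bsub>K\<^esub> r = e \<and> r \<cdot>\<^bsub>K\<^esub> i = Id K b))"

definition is_functor ::
  "('o, 'm, 'z) category_scheme \<Rightarrow> ('p, 'n, 'y) category_scheme \<Rightarrow> ('o \<Rightarrow> 'p) \<Rightarrow> ('m \<Rightarrow> 'n) \<Rightarrow> bool"
  where "is_functor C D F0 F1 \<longleftrightarrow>
           (\<forall>a\<in>Ob C. F0 a \<in> Ob D) \<and>
           (\<forall>a\<in>Ob C. \<forall>b\<in>Ob C. \<forall>f\<in>Hom C a b. F1 f \<in> Hom D (F0 a) (F0 b)) \<and>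
           (\<forall>a\<in>Ob C. F1 (Id C a) = Id D (F0 a)) \<and>
           (\<forall>a\<in>Ob C. \<forall>b\<in>Ob C. \<forall>c\<in>Ob C. \<forall>f\<in>Hom C a b. \<forall>g\<in>Hom C b c.
              F1 (g \<cdot>\<^bsub>C\<^esub> f) = F1 g \<cdot>\<^bsub>D\<^esub> F1 f)"

record ('o, 'm) preadditive = "('o, 'm) category" +
  madd :: "'m \<Rightarrow> 'm \<Rightarrow> 'm"
  mzero :: "'o \<Rightarrow> 'o \<Rightarrow> 'm"

(* HOL-Algebra writes groups multiplicatively: mult is the addition of morphisms, one is the
   zero morphism and m_inv is the negative. *)
definition hom_group :: "('o, 'm, 'z) preadditive_scheme \<Rightarrow> 'o \<Rightarrow> 'o \<Rightarrow> 'm monoid"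
  where "hom_group K a b = \<lparr>carrier = Hom K a b, mult = madd K, one = mzero K a b\<rparr>"

definition mneg :: "('o, 'm, 'z) preadditive_scheme \<Rightarrow> 'm \<Rightarrow> 'm"
  where "mneg K f = m_inv (hom_group K (Dom K f) (Cod K f)) f"

locale preadditive_category = category K for K :: "('o, 'm, 'z) preadditive_scheme" (structure) +
  assumes hom_comm_group: "a \<in> Ob K \<Longrightarrow> b \<in> Ob K \<Longrightarrow> comm_group (hom_group K a b)"
    and Comp_madd_left: "f \<in> Hom K a b \<Longrightarrow> g \<in> Hom K b c \<Longrightarrow> h \<in> Hom K b c \<Longrightarrow>
           madd K g h \<cdot> f = madd K (g \<cdot> f) (h \<cdot> f)"
    and Comp_madd_right: "f \<in> Hom K a b \<Longrightarrow> g \<in> Hom K a b \<Longrightarrow> h \<in> Hom K b c \<Longrightarrow>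
           h \<cdot> madd K f g = madd K (h \<cdot> f) (h \<cdot> g)"

definition additive_on_homs ::
  "('o, 'm, 'z) preadditive_scheme \<Rightarrow> ('p, 'n, 'y) preadditive_scheme \<Rightarrow> ('m \<Rightarrow> 'n) \<Rightarrow> bool"
  where "additive_on_homs C D F1 \<longleftrightarrow>
           (\<forall>a\<in>Ob C. \<forall>b\<in>Ob C. \<forall>f\<in>Hom C a b. \<forall>g\<in>Hom C a b.
              F1 (madd C f g) = madd D (F1 f) (F1 g))"

definition is_zero_object :: "('o, 'm, 'z) category_scheme \<Rightarrow> 'o \<Rightarrow> bool"
  where "is_zero_object K z \<longleftrightarrow> z \<in> Ob K \<and>
           (\<forall>a\<in>Ob K. (\<exists>!f. f \<in> Hom K a z) \<and> (\<exists>!f. f \<in> Hom K z a))"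

(* c is a direct sum of a and b with the given injections and projections. *)
definition is_biproduct ::
  "('o, 'm, 'z) preadditive_scheme \<Rightarrow> 'o \<Rightarrow> 'o \<Rightarrow> 'o \<Rightarrow> 'm \<Rightarrow> 'm \<Rightarrow> 'm \<Rightarrow> 'm \<Rightarrow> bool"
  where "is_biproduct K a b c i1 i2 p1 p2 \<longleftrightarrow>
           a \<in> Ob K \<and> b \<in> Ob K \<and> c \<in> Ob K \<and>
           i1 \<in> Hom K a c \<and> i2 \<in> Hom K b c \<and> p1 \<in> Hom K c a \<and> p2 \<in> Hom K c b \<and>
           p1 \<cdot>\<^bsub>K\<^esub> i1 = Id K a \<and> p2 \<cdot>\<^bsub>K\<^esub> i2 = Id K b \<and>
           p1 \<cdot>\<^bsub>K\<^esub> i2 = mzero K b a \<and> p2 \<cdot>\<^bsub>K\<^esub> i1 = mzero K a b \<and>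
           madd K (i1 \<cdot>\<^bsub>K\<^esub> p1) (i2 \<cdot>\<^bsub>K\<^esub> p2) = Id K c"

locale additive_category = preadditive_category K
  for K :: "('o, 'm, 'z) preadditive_scheme" (structure) +
  assumes zero_object: "\<exists>z. is_zero_object K z"
    and biproduct: "a \<in> Ob K \<Longrightarrow> b \<in> Ob K \<Longrightarrow> \<exists>c i1 i2 p1 p2. is_biproduct K a b c i1 i2 p1 p2"


section \<open>Triangulated categories\<close>

(* A triple (u, v, w) in Tri is a distinguished triangle a --u--> b --v--> c --w--> T a. *)
record ('o, 'm) triangulated = "('o, 'm) preadditive" +
  TOb :: "'o \<Rightarrow> 'o"
  TMor :: "'m \<Rightarrow> 'm"
  Tri :: "('m \<times> 'm \<times> 'm) set"

(* The suspension is only required to be an additive auto-equivalence; automorphisms are a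
   special case. *)
locale triangulated_category = additive_category K
  for K :: "('o, 'm, 'z) triangulated_scheme" (structure) +
  assumes T_functor: "is_functor K K (TOb K) (TMor K)"
    and T_additive: "additive_on_homs K K (TMor K)"
    and T_fully_faithful: "a \<in> Ob K \<Longrightarrow> b \<in> Ob K \<Longrightarrow>
           bij_betw (TMor K) (Hom K a b) (Hom K (TOb K a) (TOb K b))"
    and T_essentially_surjective: "b \<in> Ob K \<Longrightarrow> \<exists>a\<in>Ob K. \<exists>f. is_iso K f (TOb K a) b"
    and Tri_shape: "(u, v, w) \<in> Tri K \<Longrightarrow>
           \<exists>a\<in>Ob K. \<exists>b\<in>Ob K. \<exists>c\<in>Ob K. u \<in> Hom K a b \<and> v \<in> Hom K b c \<and> w \<in> Hom K c (TOb K a)"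
    and Tri_iso: "(u, v, w) \<in> Tri K \<Longrightarrow>
           u \<in> Hom K a b \<Longrightarrow> v \<in> Hom K b c \<Longrightarrow> w \<in> Hom K c (TOb K a) \<Longrightarrow>
           u' \<in> Hom K a' b' \<Longrightarrow> v' \<in> Hom K b' c' \<Longrightarrow> w' \<in> Hom K c' (TOb K a') \<Longrightarrow>
           is_iso K x a a' \<Longrightarrow> is_iso K y b b' \<Longrightarrow> is_iso K z c c' \<Longrightarrow>
           u' \<cdot> x = y \<cdot> u \<Longrightarrow> v' \<cdot> y = z \<cdot> v \<Longrightarrow> w' \<cdot> z = TMor K x \<cdot> w \<Longrightarrow>
           (u', v', w') \<in> Tri K"
    and Tri_trivial: "a \<in> Ob K \<Longrightarrow> is_zero_object K o0 \<Longrightarrow>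
           (Id K a, mzero K a o0, mzero K o0 (TOb K a)) \<in> Tri K"
    and Tri_cone: "u \<in> Mor K \<Longrightarrow> \<exists>v w. (u, v, w) \<in> Tri K"
    and Tri_rotate: "u \<in> Hom K a b \<Longrightarrow> v \<in> Hom K b c \<Longrightarrow> w \<in> Hom K c (TOb K a) \<Longrightarrow>
           (u, v, w) \<in> Tri K \<longleftrightarrow> (v, w, mneg K (TMor K u)) \<in> Tri K"
    and Tri_morphism: "(u, v, w) \<in> Tri K \<Longrightarrow> (u', v', w') \<in> Tri K \<Longrightarrow>
           x \<in> Hom K (Dom K u) (Dom K u') \<Longrightarrow> y \<in> Hom K (Cod K u) (Cod K u') \<Longrightarrow>
           u' \<cdot> x = y \<cdot> u \<Longrightarrow>
           \<exists>z\<in>Hom K (Cod K v) (Cod K v'). v' \<cdot> y = z \<cdot> v \<and> w' \<cdot> z = TMor K x \<cdot> w"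
    and Tri_octahedron: "u \<in> Hom K a b \<Longrightarrow> v \<in> Hom K b c \<Longrightarrow>
           (u, j, k) \<in> Tri K \<Longrightarrow> (v, l, i) \<in> Tri K \<Longrightarrow> (v \<cdot> u, m, n) \<in> Tri K \<Longrightarrow>
           \<exists>f g. f \<in> Hom K (Cod K j) (Cod K m) \<and> g \<in> Hom K (Cod K m) (Cod K l) \<and>
             f \<cdot> j = m \<cdot> v \<and> n \<cdot> f = k \<and> g \<cdot> m = l \<and> i \<cdot> g = TMor K u \<cdot> n \<and>
             (f, g, TMor K j \<cdot> i) \<in> Tri K"

(* phi a : F (T a) -> T (F a) is the commutation with the suspension that makes F exact. *)
definition exact_functor ::
  "('o, 'm, 'z) triangulated_scheme \<Rightarrow> ('o \<Rightarrow> 'o) \<Rightarrow> ('m \<Rightarrow> 'm) \<Rightarrow> ('o \<Rightarrow> 'm) \<Rightarrow> bool"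
  where "exact_functor K F0 F1 \<phi> \<longleftrightarrow>
           is_functor K K F0 F1 \<and> additive_on_homs K K F1 \<and>
           (\<forall>a\<in>Ob K. is_iso K (\<phi> a) (F0 (TOb K a)) (TOb K (F0 a))) \<and>
           (\<forall>a\<in>Ob K. \<forall>b\<in>Ob K. \<forall>f\<in>Hom K a b.
              \<phi> b \<cdot>\<^bsub>K\<^esub> F1 (TMor K f) = TMor K (F1 f) \<cdot>\<^bsub>K\<^esub> \<phi> a) \<and>
           (\<forall>u v w. (u, v, w) \<in> Tri K \<longrightarrow>
              (F1 u, F1 v, \<phi> (Dom K u) \<cdot>\<^bsub>K\<^esub> F1 w) \<in> Tri K)"

(* Exact functors from the opposite category of K to K. The suspension of the opposite category
   is a quasi-inverse of T, so the commutation with suspensions amounts to natural isomorphisms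
   phi a : G a -> T (G (T a)). In the opposite category a triangle x -> y -> z -> T x becomes
   z -> y -> x -> T^(-1) z; whether or not a sign is put on its last map is immaterial, since it
   can be absorbed into phi. *)
definition exact_contravariant ::
  "('o, 'm, 'z) triangulated_scheme \<Rightarrow> ('o \<Rightarrow> 'o) \<Rightarrow> ('m \<Rightarrow> 'm) \<Rightarrow> ('o \<Rightarrow> 'm) \<Rightarrow> bool"
  where "exact_contravariant K G0 G1 \<phi> \<longleftrightarrow>
           (\<forall>a\<in>Ob K. G0 a \<in> Ob K) \<and>
           (\<forall>a\<in>Ob K. \<forall>b\<in>Ob K. \<forall>f\<in>Hom K a b. G1 f \<in> Hom K (G0 b) (G0 a)) \<and>
           (\<forall>a\<in>Ob K. G1 (Id K a) = Id K (G0 a)) \<and>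
           (\<forall>a\<in>Ob K. \<forall>b\<in>Ob K. \<forall>c\<in>Ob K. \<forall>f\<in>Hom K a b. \<forall>g\<in>Hom K b c.
              G1 (g \<cdot>\<^bsub>K\<^esub> f) = G1 f \<cdot>\<^bsub>K\<^esub> G1 g) \<and>
           additive_on_homs K K G1 \<and>
           (\<forall>a\<in>Ob K. is_iso K (\<phi> a) (G0 a) (TOb K (G0 (TOb K a)))) \<and>
           (\<forall>a\<in>Ob K. \<forall>b\<in>Ob K. \<forall>f\<in>Hom K a b.
              TMor K (G1 (TMor K f)) \<cdot>\<^bsub>K\<^esub> \<phi> b = \<phi> a \<cdot>\<^bsub>K\<^esub> G1 f) \<and>
           (\<forall>u v w. (u, v, w) \<in> Tri K \<longrightarrow>
              (G1 v, G1 u, TMor K (G1 w) \<cdot>\<^bsub>K\<^esub> \<phi> (Dom K u)) \<in> Tri K)"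

definition triangulated_subcategory :: "('o, 'm, 'z) triangulated_scheme \<Rightarrow> 'o set \<Rightarrow> bool"
  where "triangulated_subcategory K P \<longleftrightarrow>
           P \<subseteq> Ob K \<and>
           (\<forall>z. is_zero_object K z \<longrightarrow> z \<in> P) \<and>
           (\<forall>a\<in>Ob K. TOb K a \<in> P \<longleftrightarrow> a \<in> P) \<and>
           (\<forall>u v w. (u, v, w) \<in> Tri K \<longrightarrow>
              (Dom K u \<in> P \<and> Cod K u \<in> P \<longrightarrow> Cod K v \<in> P) \<and>
              (Cod K u \<in> P \<and> Cod K v \<in> P \<longrightarrow> Dom K u \<in> P) \<and>
              (Dom K u \<in> P \<and> Cod K v \<in> P \<longrightarrow> Cod K u \<in> P))"

definition thick :: "('o, 'm, 'z) preadditive_scheme \<Rightarrow> 'o set \<Rightarrow> bool"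
  where "thick K P \<longleftrightarrow>
           (\<forall>a b c i1 i2 p1 p2. is_biproduct K a b c i1 i2 p1 p2 \<longrightarrow> c \<in> P \<longrightarrow> a \<in> P \<and> b \<in> P)"


section \<open>Verdier quotients\<close>

definition cone_in :: "('o, 'm, 'z) triangulated_scheme \<Rightarrow> 'o set \<Rightarrow> 'm set"
  where "cone_in K J = {s \<in> Mor K. \<exists>v w. (s, v, w) \<in> Tri K \<and> Cod K v \<in> J}"

(* The pair (s, f) stands for the fraction a <--s-- x --f--> b, from a = Cod s to b = Cod f. *)
definition fractions :: "('o, 'm, 'z) triangulated_scheme \<Rightarrow> 'o set \<Rightarrow> ('m \<times> 'm) set"
  where "fractions K J = {(s, f). s \<in> cone_in K J \<and> f \<in> Mor K \<and> Dom K s = Dom K f}"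

(* Two parallel fractions are identified if they have a common amplification. *)
definition fraction_rel ::
  "('o, 'm, 'z) triangulated_scheme \<Rightarrow> 'o set \<Rightarrow> (('m \<times> 'm) \<times> ('m \<times> 'm)) set"
  where "fraction_rel K J =
           {((s, f), (t, g)). (s, f) \<in> fractions K J \<and> (t, g) \<in> fractions K J \<and>
              Cod K s = Cod K t \<and> Cod K f = Cod K g \<and>
              (\<exists>p\<in>Mor K. \<exists>q\<in>Mor K. Dom K p = Dom K q \<and> Cod K p = Dom K s \<and> Cod K q = Dom K t \<and>
                 s \<cdot>\<^bsub>K\<^esub> p = t \<cdot>\<^bsub>K\<^esub> q \<and> f \<cdot>\<^bsub>K\<^esub> p = g \<cdot>\<^bsub>K\<^esub> q \<and> s \<cdot>\<^bsub>K\<^esub> p \<in> cone_in K J)}"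

(* K/J by calculus of fractions. Composition completes f : x -> b and t : y -> b to a commutative
   square with f r = t h and r having cone in J; addition uses a common denominator u. *)
definition verdier_quotient ::
  "('o, 'm, 'z) triangulated_scheme \<Rightarrow> 'o set \<Rightarrow> ('o, ('m \<times> 'm) set) preadditive"
  where "verdier_quotient K J =
           \<lparr>Ob = Ob K,
            Mor = fractions K J // fraction_rel K J,
            Dom = (\<lambda>X. THE a. \<exists>(s, f)\<in>X. a = Cod K s),
            Cod = (\<lambda>X. THE b. \<exists>(s, f)\<in>X. b = Cod K f),
            Id = (\<lambda>a. fraction_rel K J `` {(Id K a, Id K a)}),
            Comp = (\<lambda>Y X. {q. \<exists>(s, f)\<in>X. \<exists>(t, g)\<in>Y. \<exists>r\<in>cone_in K J. \<exists>h\<in>Mor K.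
               Dom K r = Dom K h \<and> Cod K r = Dom K f \<and> Cod K h = Dom K t \<and>
               f \<cdot>\<^bsub>K\<^esub> r = t \<cdot>\<^bsub>K\<^esub> h \<and> ((s \<cdot>\<^bsub>K\<^esub> r, g \<cdot>\<^bsub>K\<^esub> h), q) \<in> fraction_rel K J}),
            madd = (\<lambda>X Y. {q. \<exists>u f g. (u, f) \<in> X \<and> (u, g) \<in> Y \<and>
               ((u, madd K f g), q) \<in> fraction_rel K J}),
            mzero = (\<lambda>a b. fraction_rel K J `` {(Id K a, mzero K a b)})\<rparr>"

definition quotient_functor ::
  "('o, 'm, 'z) triangulated_scheme \<Rightarrow> 'o set \<Rightarrow> 'm \<Rightarrow> ('m \<times> 'm) set"
  where "quotient_functor K J f = fraction_rel K J `` {(Id K (Dom K f), f)}"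


section \<open>Tensor triangulated categories\<close>

(* Assoc a b c : (a \<otimes> b) \<otimes> c -> a \<otimes> (b \<otimes> c), LUnit a : 1 \<otimes> a -> a, RUnit a : a \<otimes> 1 -> a,
   Braid a b : a \<otimes> b -> b \<otimes> a. *)
record ('o, 'm) tensor_triangulated = "('o, 'm) triangulated" +
  TensOb :: "'o \<Rightarrow> 'o \<Rightarrow> 'o" (infixr "\<otimes>\<^sub>o\<index>" 80)
  TensMor :: "'m \<Rightarrow> 'm \<Rightarrow> 'm" (infixr "\<otimes>\<^sub>m\<index>" 80)
  UnitOb :: "'o"
  Assoc :: "'o \<Rightarrow> 'o \<Rightarrow> 'o \<Rightarrow> 'm"
  LUnit :: "'o \<Rightarrow> 'm"
  RUnit :: "'o \<Rightarrow> 'm"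
  Braid :: "'o \<Rightarrow> 'o \<Rightarrow> 'm"

locale symmetric_monoidal_category = category K
  for K :: "('o, 'm, 'z) tensor_triangulated_scheme" (structure) +
  assumes UnitOb_closed: "UnitOb K \<in> Ob K"
    and TensOb_closed: "a \<in> Ob K \<Longrightarrow> b \<in> Ob K \<Longrightarrow> a \<otimes>\<^sub>o b \<in> Ob K"
    and TensMor_closed: "f \<in> Hom K a a' \<Longrightarrow> g \<in> Hom K b b' \<Longrightarrow>
           f \<otimes>\<^sub>m g \<in> Hom K (a \<otimes>\<^sub>o b) (a' \<otimes>\<^sub>o b')"
    and TensMor_Id: "a \<in> Ob K \<Longrightarrow> b \<in> Ob K \<Longrightarrow> Id K a \<otimes>\<^sub>m Id K b = Id K (a \<otimes>\<^sub>o b)"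
    and TensMor_Comp: "f \<in> Hom K a a' \<Longrightarrow> f' \<in> Hom K a' a'' \<Longrightarrow>
           g \<in> Hom K b b' \<Longrightarrow> g' \<in> Hom K b' b'' \<Longrightarrow>
           (f' \<cdot> f) \<otimes>\<^sub>m (g' \<cdot> g) = (f' \<otimes>\<^sub>m g') \<cdot> (f \<otimes>\<^sub>m g)"
    and Assoc_iso: "a \<in> Ob K \<Longrightarrow> b \<in> Ob K \<Longrightarrow> c \<in> Ob K \<Longrightarrow>
           is_iso K (Assoc K a b c) ((a \<otimes>\<^sub>o b) \<otimes>\<^sub>o c) (a \<otimes>\<^sub>o (b \<otimes>\<^sub>o c))"
    and Assoc_natural: "f \<in> Hom K a a' \<Longrightarrow> g \<in> Hom K b b' \<Longrightarrow> h \<in> Hom K c c' \<Longrightarrow>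
           Assoc K a' b' c' \<cdot> ((f \<otimes>\<^sub>m g) \<otimes>\<^sub>m h) = (f \<otimes>\<^sub>m (g \<otimes>\<^sub>m h)) \<cdot> Assoc K a b c"
    and LUnit_iso: "a \<in> Ob K \<Longrightarrow> is_iso K (LUnit K a) (UnitOb K \<otimes>\<^sub>o a) a"
    and LUnit_natural: "f \<in> Hom K a a' \<Longrightarrow>
           LUnit K a' \<cdot> (Id K (UnitOb K) \<otimes>\<^sub>m f) = f \<cdot> LUnit K a"
    and RUnit_iso: "a \<in> Ob K \<Longrightarrow> is_iso K (RUnit K a) (a \<otimes>\<^sub>o UnitOb K) a"
    and RUnit_natural: "f \<in> Hom K a a' \<Longrightarrow>
           RUnit K a' \<cdot> (f \<otimes>\<^sub>m Id K (UnitOb K)) = f \<cdot> RUnit K a"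
    and Braid_iso: "a \<in> Ob K \<Longrightarrow> b \<in> Ob K \<Longrightarrow>
           is_iso K (Braid K a b) (a \<otimes>\<^sub>o b) (b \<otimes>\<^sub>o a)"
    and Braid_natural: "f \<in> Hom K a a' \<Longrightarrow> g \<in> Hom K b b' \<Longrightarrow>
           Braid K a' b' \<cdot> (f \<otimes>\<^sub>m g) = (g \<otimes>\<^sub>m f) \<cdot> Braid K a b"
    and pentagon: "a \<in> Ob K \<Longrightarrow> b \<in> Ob K \<Longrightarrow> c \<in> Ob K \<Longrightarrow> d \<in> Ob K \<Longrightarrow>
           Assoc K a b (c \<otimes>\<^sub>o d) \<cdot> Assoc K (a \<otimes>\<^sub>o b) c d =
           (Id K a \<otimes>\<^sub>m Assoc K b c d) \<cdot> (Assoc K a (b \<otimes>\<^sub>o c) d \<cdot> (Assoc K a b c \<otimes>\<^sub>m Id K d))"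
    and unit_triangle: "a \<in> Ob K \<Longrightarrow> b \<in> Ob K \<Longrightarrow>
           (Id K a \<otimes>\<^sub>m LUnit K b) \<cdot> Assoc K a (UnitOb K) b = RUnit K a \<otimes>\<^sub>m Id K b"
    and hexagon: "a \<in> Ob K \<Longrightarrow> b \<in> Ob K \<Longrightarrow> c \<in> Ob K \<Longrightarrow>
           Assoc K b c a \<cdot> (Braid K a (b \<otimes>\<^sub>o c) \<cdot> Assoc K a b c) =
           (Id K b \<otimes>\<^sub>m Braid K a c) \<cdot> (Assoc K b a c \<cdot> (Braid K a b \<otimes>\<^sub>m Id K c))"
    and symmetry: "a \<in> Ob K \<Longrightarrow> b \<in> Ob K \<Longrightarrow> Braid K b a \<cdot> Braid K a b = Id K (a \<otimes>\<^sub>o b)"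

(* lam a b : T a \<otimes> b -> T (a \<otimes> b) and rho a b : a \<otimes> T b -> T (a \<otimes> b) are the commutations with
   the suspension of the exact functors - \<otimes> b and a \<otimes> -. *)
locale tensor_triangulated_category = triangulated_category K + symmetric_monoidal_category K
  for K :: "('o, 'm, 'z) tensor_triangulated_scheme" (structure) +
  assumes tensor_exact: "\<exists>lam rho.
     (\<forall>a\<in>Ob K. exact_functor K (\<lambda>b. a \<otimes>\<^sub>o b) (\<lambda>f. Id K a \<otimes>\<^sub>m f) (\<lambda>b. rho a b)) \<and>
     (\<forall>b\<in>Ob K. exact_functor K (\<lambda>a. a \<otimes>\<^sub>o b) (\<lambda>f. f \<otimes>\<^sub>m Id K b) (\<lambda>a. lam a b)) \<and>
     (\<forall>a\<in>Ob K. \<forall>b\<in>Ob K.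
        TMor K (lam a b) \<cdot> rho (TOb K a) b = mneg K (TMor K (rho a b) \<cdot> lam a (TOb K b)))"

(* H0, H1 : the internal hom; for y : b' -> b and z : c -> c', H1 y z : hom(b,c) -> hom(b',c'). *)
definition biexact_hom ::
  "('o, 'm, 'z) triangulated_scheme \<Rightarrow> ('o \<Rightarrow> 'o \<Rightarrow> 'o) \<Rightarrow> ('m \<Rightarrow> 'm \<Rightarrow> 'm) \<Rightarrow> bool"
  where "biexact_hom K H0 H1 \<longleftrightarrow>
           (\<forall>b\<in>Ob K. \<forall>c\<in>Ob K. H0 b c \<in> Ob K \<and> H1 (Id K b) (Id K c) = Id K (H0 b c)) \<and>
           (\<forall>b b' c c' y z. y \<in> Hom K b' b \<longrightarrow> z \<in> Hom K c c' \<longrightarrow>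
              H1 y z \<in> Hom K (H0 b c) (H0 b' c')) \<and>
           (\<forall>b b' b'' c c' c'' y y' z z'.
              y \<in> Hom K b' b \<longrightarrow> y' \<in> Hom K b'' b' \<longrightarrow> z \<in> Hom K c c' \<longrightarrow> z' \<in> Hom K c' c'' \<longrightarrow>
              H1 (y \<cdot>\<^bsub>K\<^esub> y') (z' \<cdot>\<^bsub>K\<^esub> z) = H1 y' z' \<cdot>\<^bsub>K\<^esub> H1 y z) \<and>
           (\<forall>b\<in>Ob K. \<exists>\<phi>. exact_functor K (\<lambda>c. H0 b c) (\<lambda>z. H1 (Id K b) z) \<phi>) \<and>
           (\<forall>c\<in>Ob K. \<exists>\<phi>. exact_contravariant K (\<lambda>b. H0 b c) (\<lambda>y. H1 y (Id K c)) \<phi>)"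

definition closed_adjunction ::
  "('o, 'm, 'z) tensor_triangulated_scheme \<Rightarrow> ('o \<Rightarrow> 'o \<Rightarrow> 'o) \<Rightarrow> ('m \<Rightarrow> 'm \<Rightarrow> 'm) \<Rightarrow>
     ('o \<Rightarrow> 'o \<Rightarrow> 'o \<Rightarrow> 'm \<Rightarrow> 'm) \<Rightarrow> bool"
  where "closed_adjunction K H0 H1 \<theta> \<longleftrightarrow>
           (\<forall>a\<in>Ob K. \<forall>b\<in>Ob K. \<forall>c\<in>Ob K.
              bij_betw (\<theta> a b c) (Hom K (a \<otimes>\<^sub>o\<^bsub>K\<^esub> b) c) (Hom K a (H0 b c))) \<and>
           (\<forall>a a' b b' c c' x y z f.
              x \<in> Hom K a' a \<longrightarrow> y \<in> Hom K b' b \<longrightarrow> z \<in> Hom K c c' \<longrightarrow>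
              f \<in> Hom K (a \<otimes>\<^sub>o\<^bsub>K\<^esub> b) c \<longrightarrow>
              \<theta> a' b' c' (z \<cdot>\<^bsub>K\<^esub> (f \<cdot>\<^bsub>K\<^esub> (x \<otimes>\<^sub>m\<^bsub>K\<^esub> y))) =
              H1 y z \<cdot>\<^bsub>K\<^esub> (\<theta> a b c f \<cdot>\<^bsub>K\<^esub> x))"

(* The evaluation D(a) \<otimes> a -> 1, adjoint to the identity of D(a) = hom(a,1). *)
definition eval_mor ::
  "('o, 'm, 'z) tensor_triangulated_scheme \<Rightarrow> ('o \<Rightarrow> 'o \<Rightarrow> 'o) \<Rightarrow>
     ('o \<Rightarrow> 'o \<Rightarrow> 'o \<Rightarrow> 'm \<Rightarrow> 'm) \<Rightarrow> 'o \<Rightarrow> 'm"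
  where "eval_mor K H0 \<theta> a =
           inv_into (Hom K (H0 a (UnitOb K) \<otimes>\<^sub>o\<^bsub>K\<^esub> a) (UnitOb K))
             (\<theta> (H0 a (UnitOb K)) a (UnitOb K)) (Id K (H0 a (UnitOb K)))"

(* The natural morphism D(a) \<otimes> b -> hom(a,b), adjoint to
   (D(a) \<otimes> b) \<otimes> a -> D(a) \<otimes> (b \<otimes> a) -> D(a) \<otimes> (a \<otimes> b) -> (D(a) \<otimes> a) \<otimes> b -> 1 \<otimes> b -> b. *)
definition dual_tensor_to_hom ::
  "('o, 'm, 'z) tensor_triangulated_scheme \<Rightarrow> ('o \<Rightarrow> 'o \<Rightarrow> 'o) \<Rightarrow>
     ('o \<Rightarrow> 'o \<Rightarrow> 'o \<Rightarrow> 'm \<Rightarrow> 'm) \<Rightarrow> 'o \<Rightarrow> 'o \<Rightarrow> 'm"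
  where "dual_tensor_to_hom K H0 \<theta> a b =
           (let D = H0 a (UnitOb K) in
            \<theta> (D \<otimes>\<^sub>o\<^bsub>K\<^esub> b) a b
              (LUnit K b \<cdot>\<^bsub>K\<^esub> (eval_mor K H0 \<theta> a \<otimes>\<^sub>m\<^bsub>K\<^esub> Id K b) \<cdot>\<^bsub>K\<^esub> inv_mor K (Assoc K D a b) \<cdot>\<^bsub>K\<^esub>
               (Id K D \<otimes>\<^sub>m\<^bsub>K\<^esub> Braid K b a) \<cdot>\<^bsub>K\<^esub> Assoc K D b a))"

definition strongly_closed :: "('o, 'm, 'z) tensor_triangulated_scheme \<Rightarrow> bool"
  where "strongly_closed K \<longleftrightarrow>
           (\<exists>H0 H1 \<theta>. biexact_hom K H0 H1 \<and> closed_adjunction K H0 H1 \<theta> \<and>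
              (\<forall>a\<in>Ob K. \<forall>b\<in>Ob K.
                 is_iso K (dual_tensor_to_hom K H0 \<theta> a b)
                   (H0 a (UnitOb K) \<otimes>\<^sub>o\<^bsub>K\<^esub> b) (H0 a b)))"


section \<open>The spectrum\<close>

definition prime_tt_ideal :: "('o, 'm, 'z) tensor_triangulated_scheme \<Rightarrow> 'o set \<Rightarrow> bool"
  where "prime_tt_ideal K P \<longleftrightarrow>
           triangulated_subcategory K P \<and> P \<noteq> Ob K \<and> thick K P \<and>
           (\<forall>a\<in>P. \<forall>b\<in>Ob K. a \<otimes>\<^sub>o\<^bsub>K\<^esub> b \<in> P) \<and>
           (\<forall>a\<in>Ob K. \<forall>b\<in>Ob K. a \<otimes>\<^sub>o\<^bsub>K\<^esub> b \<in> P \<longrightarrow> a \<in> P \<or> b \<in> P)"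

definition Spc :: "('o, 'm, 'z) tensor_triangulated_scheme \<Rightarrow> 'o set set"
  where "Spc K = {P. prime_tt_ideal K P}"

definition supp :: "('o, 'm, 'z) tensor_triangulated_scheme \<Rightarrow> 'o \<Rightarrow> 'o set set"
  where "supp K a = {P \<in> Spc K. a \<notin> P}"

definition Spc_topology :: "('o, 'm, 'z) tensor_triangulated_scheme \<Rightarrow> 'o set topology"
  where "Spc_topology K = topology (arbitrary union_of (\<lambda>V. \<exists>a\<in>Ob K. V = Spc K - supp K a))"

definition supported_on :: "('o, 'm, 'z) tensor_triangulated_scheme \<Rightarrow> 'o set set \<Rightarrow> 'o set"
  where "supported_on K Y = {a \<in> Ob K. supp K a \<subseteq> Y}"

definition outside :: "('o, 'm, 'z) tensor_triangulated_scheme \<Rightarrow> 'o set set \<Rightarrow> 'o set"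
  where "outside K U = supported_on K (Spc K - U)"

definition quasi_compact_open :: "('o, 'm, 'z) tensor_triangulated_scheme \<Rightarrow> 'o set set \<Rightarrow> bool"
  where "quasi_compact_open K U \<longleftrightarrow> openin (Spc_topology K) U \<and> compactin (Spc_topology K) U"


section \<open>Restriction to open subsets and the Mayer--Vietoris maps\<close>

definition LU ::
  "('o, 'm, 'z) tensor_triangulated_scheme \<Rightarrow> 'o set set \<Rightarrow> ('o, ('m \<times> 'm) set) preadditive"
  where "LU K U = verdier_quotient K (outside K U)"

(* LU K U has the same objects as K and embeds fully faithfully into its idempotent completion,
   so the groups Mor_U(a,b) can be computed in LU K U. *)
definition Mor_on ::
  "('o, 'm, 'z) tensor_triangulated_scheme \<Rightarrow> 'o set set \<Rightarrow> 'o \<Rightarrow> 'o \<Rightarrow> ('m \<times> 'm) set monoid"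
  where "Mor_on K U a b = hom_group (LU K U) a b"

definition rho_on ::
  "('o, 'm, 'z) tensor_triangulated_scheme \<Rightarrow> 'o set set \<Rightarrow> 'm \<Rightarrow> ('m \<times> 'm) set"
  where "rho_on K U f = quotient_functor K (outside K U) f"

(* The canonical functor LU K U -> LU K V for V contained in U: a fraction whose denominator has
   cone supported outside U also has denominator with cone supported outside V. *)
definition restrict_to ::
  "('o, 'm, 'z) tensor_triangulated_scheme \<Rightarrow> 'o set set \<Rightarrow> ('m \<times> 'm) set \<Rightarrow> ('m \<times> 'm) set"
  where "restrict_to K V X = fraction_rel K (outside K V) `` X"

definition Mor_pair ::
  "('o, 'm, 'z) tensor_triangulated_scheme \<Rightarrow> 'o set set \<Rightarrow> 'o set set \<Rightarrow> 'o \<Rightarrow> 'o \<Rightarrow>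
     (('m \<times> 'm) set \<times> ('m \<times> 'm) set) monoid"
  where "Mor_pair K U1 U2 a b = Mor_on K U1 a b \<times>\<times> Mor_on K U2 a b"

definition res_pair ::
  "('o, 'm, 'z) tensor_triangulated_scheme \<Rightarrow> 'o set set \<Rightarrow> 'o set set \<Rightarrow> 'm \<Rightarrow>
     ('m \<times> 'm) set \<times> ('m \<times> 'm) set"
  where "res_pair K U1 U2 f = (rho_on K U1 f, rho_on K U2 f)"

definition res_diff ::
  "('o, 'm, 'z) tensor_triangulated_scheme \<Rightarrow> 'o set set \<Rightarrow> 'o set set \<Rightarrow> 'o \<Rightarrow> 'o \<Rightarrow>
     ('m \<times> 'm) set \<times> ('m \<times> 'm) set \<Rightarrow> ('m \<times> 'm) set"
  where "res_diff K U1 U2 a b = (\<lambda>(X, Y).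
           mult (Mor_on K (U1 \<inter> U2) a b) (restrict_to K (U1 \<inter> U2) X)
             (m_inv (Mor_on K (U1 \<inter> U2) a b) (restrict_to K (U1 \<inter> U2) Y)))"

(* The choices entering the connecting homomorphism: a distinguished triangle
   x --s--> a --> c1 \<oplus> c2 --> T x with ci supported on the complement of Ui, where
   (\<alpha>, \<beta>) and (\<gamma>, \<delta>) are the components of the second and third map. *)
definition connecting_choice ::
  "('o, 'm, 'z) tensor_triangulated_scheme \<Rightarrow> 'o set set \<Rightarrow> 'o set set \<Rightarrow>
     'm \<Rightarrow> 'm \<Rightarrow> 'm \<Rightarrow> 'm \<Rightarrow> 'm \<Rightarrow> bool"
  where "connecting_choice K U1 U2 s \<alpha> \<beta> \<gamma> \<delta> \<longleftrightarrow>
           (\<exists>c1\<in>outside K U1. \<exists>c2\<in>outside K U2. \<exists>c i1 i2 p1 p2 v w.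
              is_biproduct K c1 c2 c i1 i2 p1 p2 \<and> (s, v, w) \<in> Tri K \<and> Cod K v = c \<and>
              \<alpha> = p1 \<cdot>\<^bsub>K\<^esub> v \<and> \<beta> = p2 \<cdot>\<^bsub>K\<^esub> v \<and> \<gamma> = w \<cdot>\<^bsub>K\<^esub> i1 \<and> \<delta> = w \<cdot>\<^bsub>K\<^esub> i2)"

(* Mor_{U1 \<inter> U2}(a,b) -> Mor_K(a, T b) *)
definition connecting ::
  "('o, 'm, 'z) tensor_triangulated_scheme \<Rightarrow> 'o set set \<Rightarrow> 'o set set \<Rightarrow> ('m \<times> 'm) set \<Rightarrow> 'm"
  where "connecting K U1 U2 g =
           (THE h. \<exists>(s, f)\<in>g. \<exists>\<alpha> \<beta> \<gamma> \<delta>. connecting_choice K U1 U2 s \<alpha> \<beta> \<gamma> \<delta> \<and>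
              h = TMor K f \<cdot>\<^bsub>K\<^esub> \<gamma> \<cdot>\<^bsub>K\<^esub> \<alpha>)"

(* Mor_{U1 \<inter> U2}(T a, b) -> Mor_K(T a, T b) = Mor_K(a, b) *)
definition connecting_desusp ::
  "('o, 'm, 'z) tensor_triangulated_scheme \<Rightarrow> 'o set set \<Rightarrow> 'o set set \<Rightarrow> 'o \<Rightarrow> 'o \<Rightarrow>
     ('m \<times> 'm) set \<Rightarrow> 'm"
  where "connecting_desusp K U1 U2 a b g = inv_into (Hom K a b) (TMor K) (connecting K U1 U2 g)"

definition exact_at ::
  "('x, 'p) monoid_scheme \<Rightarrow> ('x \<Rightarrow> 'y) \<Rightarrow> ('y, 'q) monoid_scheme \<Rightarrow> ('y \<Rightarrow> 'z) \<Rightarrow>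
     ('z, 'r) monoid_scheme \<Rightarrow> bool"
  where "exact_at A f B g C \<longleftrightarrow>
           comm_group A \<and> comm_group B \<and> comm_group C \<and> group_hom A B f \<and> group_hom B C g \<and>
           kernel B C g = f ` carrier A"

end

(* Strong closedness makes every object a retract of a tensor product involving it twice, so that
   thick tensor ideals are radical and each of them is an intersection of primes. Hence a \<otimes> b = 0,
   and then Hom(a,b) = 0, for a and b supported on the disjoint complements of U1 and U2. By
   idempotent completeness, the sums of such objects again form a thick tensor ideal, which therefore
   contains every object supported on the union of the two complements. The rest takes place in a
   triangulated category with two orthogonal subcategories J1 and J2: maps between sums c1 \<oplus> c2 are
   diagonal, which makes the connecting map independent of all choices, and a denominator with cone
   c1 \<oplus> c2 factors through denominators with cones c1 and c2. *)

theory Submission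
  imports Defs
begin

section \<open>Additive categories\<close>

text \<open>Every question about the quotients is reduced to \<open>K\<close> itself through one
  predicate: a morphism dies in \<open>K/J\<close> exactly when it factors through an object of
  \<open>J\<close>. The kernel of the restrictions thus consists of the morphisms that factor
  through \<open>J1\<close> and also through \<open>J2\<close>. Two such factorisations begin with
  maps a \<rightarrow> c1 and a \<rightarrow> c2, and the triangle on the combined map a
  \<rightarrow> c1 \<oplus> c2 supplies a fraction that the connecting map sends back to the given
  morphism. Quasi-compactness provides objects whose supports are exactly the complements of U1 and
  U2. A prime containing all sums c1 \<oplus> c2 contains both of these objects and so lies in U1
  \<inter> U2; hence an object supported on the two complements cannot escape the ideal of sums. The
  obstacle throughout is that cones are not functorial: comparison maps between them compose to the
  identity only up to a square-zero endomorphism and have to be corrected. Moreover T is only an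
  equivalence, so fibres and desuspensions are available up to isomorphism.\<close>

context category
begin

text \<open>Typing is left to the simplifier: membership in a hom-set dissolves into equations on
  \<open>Dom\<close> and \<open>Cod\<close>, the form in which composability conditions
  arise.\<close>

lemma in_Hom_iff [simp]: "f \<in> Hom K a b \<longleftrightarrow> f \<in> Mor K \<and> Dom K f = a \<and> Cod K f = b"
  by (simp add: Hom_def)

declare Dom_closed [simp] Cod_closed [simp]

lemma Id_simps [simp]:
  assumes "a \<in> Ob K"
  shows "Id K a \<in> Mor K" "Dom K (Id K a) = a" "Cod K (Id K a) = a"
  using Id_closed [OF assms] by auto

lemma Comp_simps [simp]:
  assumes "f \<in> Mor K" "g \<in> Mor K" "Cod K f = Dom K g"
  shows "g \<cdot> f \<in> Mor K" "Dom K (g \<cdot> f) = Dom K f" "Cod K (g \<cdot> f) = Cod K g"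
  using Comp_closed [of f "Dom K f" "Dom K g" g "Cod K g"] assms by auto

lemma Comp_Id_right [simp]: "f \<in> Mor K \<Longrightarrow> Dom K f = a \<Longrightarrow> f \<cdot> Id K a = f"
  using Comp_Id [of f a "Cod K f"] by auto

lemma Comp_Id_left [simp]: "f \<in> Mor K \<Longrightarrow> Cod K f = a \<Longrightarrow> Id K a \<cdot> f = f"
  using Id_Comp [of f "Dom K f" a] by auto

lemma Comp_assoc_simp [simp]:
  "f \<in> Mor K \<Longrightarrow> g \<in> Mor K \<Longrightarrow> h \<in> Mor K \<Longrightarrow> Cod K f = Dom K g \<Longrightarrow> Cod K g = Dom K h \<Longrightarrow>
    (h \<cdot> g) \<cdot> f = h \<cdot> g \<cdot> f"
  using Comp_assoc [of f "Dom K f" "Dom K g" g "Dom K h" h "Cod K h"] by auto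

text \<open>Composites are normalised to right-nested form, where a product
  \<open>g \<cdot> f\<close> followed on the right by \<open>x\<close> is no longer a subterm. An
  equation between composites is therefore restated with a trailing factor;
  \<open>Comp_reduce\<close> does the same for a single right-hand side.\<close>

lemma Comp_square:
  assumes "g \<cdot> f = h \<cdot> k" "f \<in> Mor K" "g \<in> Mor K" "h \<in> Mor K" "k \<in> Mor K"
    "Cod K f = Dom K g" "Cod K k = Dom K h" "x \<in> Mor K" "Cod K x = Dom K f"
  shows "g \<cdot> f \<cdot> x = h \<cdot> k \<cdot> x"
proof -
  have "Dom K f = Dom K k"
    using assms Comp_simps(2) by metis
  then have "(g \<cdot> f) \<cdot> x = g \<cdot> f \<cdot> x" "(h \<cdot> k) \<cdot> x = h \<cdot> k \<cdot> x"
    using assms(2-) by auto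
  then show ?thesis
    using assms(1) by simp
qed

lemma Comp_reduce:
  assumes "g \<cdot> f = h" "f \<in> Mor K" "g \<in> Mor K" "Cod K f = Dom K g" "x \<in> Mor K" "Cod K x = Dom K f"
  shows "g \<cdot> f \<cdot> x = h \<cdot> x"
  using assms by (metis Comp_assoc_simp)

lemma is_iso_Id: "a \<in> Ob K \<Longrightarrow> is_iso K (Id K a) a a"
  unfolding is_iso_def by (auto intro!: bexI [of _ "Id K a"])

lemma is_isoI:
  "f \<in> Mor K \<Longrightarrow> g \<in> Mor K \<Longrightarrow> Dom K f = a \<Longrightarrow> Cod K f = b \<Longrightarrow> Dom K g = b \<Longrightarrow> Cod K g = a \<Longrightarrow>
    g \<cdot> f = Id K a \<Longrightarrow> f \<cdot> g = Id K b \<Longrightarrow> is_iso K f a b"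
  unfolding is_iso_def by auto

lemma is_isoE:
  assumes "is_iso K f a b"
  obtains g where "f \<in> Mor K" "g \<in> Mor K" "Dom K f = a" "Cod K f = b" "Dom K g = b" "Cod K g = a"
    "g \<cdot> f = Id K a" "f \<cdot> g = Id K b"
  using assms unfolding is_iso_def by auto

lemma is_iso_sym:
  assumes "is_iso K f a b"
  obtains g where "is_iso K g b a"
  using assms by (elim is_isoE) (metis is_isoI)

end

section \<open>Arithmetic of morphisms in preadditive categories\<close>

context preadditive_category
begin

lemma mzero_simps [simp]:
  assumes "a \<in> Ob K" "b \<in> Ob K"
  shows "mzero K a b \<in> Mor K" "Dom K (mzero K a b) = a" "Cod K (mzero K a b) = b"
  using comm_group.axioms(2) [OF hom_comm_group [OF assms]] monoid.one_closed [of "hom_group K a b"]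
  by (auto simp: hom_group_def group.is_monoid)

lemma madd_simps [simp]:
  assumes "f \<in> Mor K" "g \<in> Mor K" "Dom K f = Dom K g" "Cod K f = Cod K g"
  shows "madd K f g \<in> Mor K" "Dom K (madd K f g) = Dom K g" "Cod K (madd K f g) = Cod K g"
  using comm_group.axioms(2) [OF hom_comm_group [of "Dom K f" "Cod K f"]] assms
    monoid.m_closed [of "hom_group K (Dom K f) (Cod K f)" f g]
  by (auto simp: hom_group_def group.is_monoid)

lemma mneg_simps [simp]:
  assumes "f \<in> Mor K"
  shows "mneg K f \<in> Mor K" "Dom K (mneg K f) = Dom K f" "Cod K (mneg K f) = Cod K f"
  using comm_group.axioms(2) [OF hom_comm_group [of "Dom K f" "Cod K f"]] assms
    group.inv_closed [of "hom_group K (Dom K f) (Cod K f)" f]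
  by (auto simp: hom_group_def mneg_def)

lemma madd_assoc:
  assumes "f \<in> Mor K" "g \<in> Mor K" "h \<in> Mor K"
    "Dom K f = Dom K g" "Cod K f = Cod K g" "Dom K g = Dom K h" "Cod K g = Cod K h"
  shows "madd K (madd K f g) h = madd K f (madd K g h)"
  using comm_group.axioms(2) [OF hom_comm_group [of "Dom K f" "Cod K f"]] assms
    monoid.m_assoc [of "hom_group K (Dom K f) (Cod K f)" f g h]
  by (auto simp: hom_group_def group.is_monoid)

lemma madd_comm:
  assumes "f \<in> Mor K" "g \<in> Mor K" "Dom K f = Dom K g" "Cod K f = Cod K g"
  shows "madd K f g = madd K g f"
  using comm_group.axioms(1) [OF hom_comm_group [of "Dom K f" "Cod K f"]] assms
    comm_monoid.m_comm [of "hom_group K (Dom K f) (Cod K f)" f g]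
  by (auto simp: hom_group_def)

lemma madd_left_comm:
  assumes "f \<in> Mor K" "g \<in> Mor K" "h \<in> Mor K"
    "Dom K f = Dom K g" "Cod K f = Cod K g" "Dom K g = Dom K h" "Cod K g = Cod K h"
  shows "madd K f (madd K g h) = madd K g (madd K f h)"
  by (metis assms madd_assoc madd_comm)

lemmas madd_ac = madd_assoc madd_comm madd_left_comm

lemma madd_zero [simp]:
  assumes "f \<in> Mor K" "Dom K f = a" "Cod K f = b"
  shows "madd K f (mzero K a b) = f" "madd K (mzero K a b) f = f"
  using comm_group.axioms(2) [OF hom_comm_group [of "Dom K f" "Cod K f"]] assms
    monoid.r_one [of "hom_group K (Dom K f) (Cod K f)" f]
    monoid.l_one [of "hom_group K (Dom K f) (Cod K f)" f]
  by (auto simp: hom_group_def group.is_monoid)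

lemma madd_mneg [simp]:
  assumes "f \<in> Mor K"
  shows "madd K f (mneg K f) = mzero K (Dom K f) (Cod K f)"
    "madd K (mneg K f) f = mzero K (Dom K f) (Cod K f)"
  using comm_group.axioms(2) [OF hom_comm_group [of "Dom K f" "Cod K f"]] assms
    group.r_inv [of "hom_group K (Dom K f) (Cod K f)" f]
    group.l_inv [of "hom_group K (Dom K f) (Cod K f)" f]
  by (auto simp: hom_group_def mneg_def)

lemma madd_mneg_cancel [simp]:
  assumes "f \<in> Mor K" "g \<in> Mor K" "Dom K f = Dom K g" "Cod K f = Cod K g"
  shows "madd K f (madd K (mneg K f) g) = g" "madd K (mneg K f) (madd K f g) = g"
proof -
  have "madd K (madd K f (mneg K f)) g = g" "madd K (madd K (mneg K f) f) g = g"
    using assms by (simp_all del: madd_assoc)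
  then show "madd K f (madd K (mneg K f) g) = g" "madd K (mneg K f) (madd K f g) = g"
    using assms by (simp_all add: madd_assoc del: madd_mneg)
qed

lemma mneg_unique:
  assumes "f \<in> Mor K" "g \<in> Mor K" "Dom K f = Dom K g" "Cod K f = Cod K g"
    "madd K f g = mzero K (Dom K f) (Cod K f)"
  shows "mneg K f = g"
proof -
  have "madd K (mneg K f) (madd K f g) = mneg K f"
    unfolding assms(5) using assms(1) by simp
  then show ?thesis
    using madd_mneg_cancel(2) [OF assms(1-4)] by simp
qed

lemma mneg_mneg [simp]: "f \<in> Mor K \<Longrightarrow> mneg K (mneg K f) = f"
  by (rule mneg_unique) auto

lemma mneg_zero [simp]: "a \<in> Ob K \<Longrightarrow> b \<in> Ob K \<Longrightarrow> mneg K (mzero K a b) = mzero K a b"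
  by (rule mneg_unique) auto

lemma mneg_madd [simp]:
  assumes "f \<in> Mor K" "g \<in> Mor K" "Dom K f = Dom K g" "Cod K f = Cod K g"
  shows "mneg K (madd K f g) = madd K (mneg K f) (mneg K g)"
proof (rule mneg_unique)
  have "madd K (madd K f g) (madd K (mneg K f) (mneg K g)) =
    madd K (madd K f (madd K (mneg K f) (madd K g (mneg K g)))) (mzero K (Dom K f) (Cod K f))"
    using assms by (simp add: madd_ac del: madd_mneg)
  then show "madd K (madd K f g) (madd K (mneg K f) (mneg K g)) =
    mzero K (Dom K (madd K f g)) (Cod K (madd K f g))"
    using assms by simp
qed (use assms in auto)

lemma madd_eq_zero_iff:
  assumes "f \<in> Mor K" "g \<in> Mor K" "Dom K f = Dom K g" "Cod K f = Cod K g"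
  shows "madd K f (mneg K g) = mzero K (Dom K g) (Cod K g) \<longleftrightarrow> f = g"
proof
  assume "madd K f (mneg K g) = mzero K (Dom K g) (Cod K g)"
  then have "mneg K f = mneg K g"
    using assms by (intro mneg_unique) auto
  then show "f = g"
    using assms by (metis mneg_mneg)
qed (use assms in auto)

lemma Comp_distrib_right [simp]:
  "f \<in> Mor K \<Longrightarrow> g \<in> Mor K \<Longrightarrow> h \<in> Mor K \<Longrightarrow> Cod K f = Dom K g \<Longrightarrow> Dom K g = Dom K h \<Longrightarrow>
    Cod K g = Cod K h \<Longrightarrow> madd K g h \<cdot> f = madd K (g \<cdot> f) (h \<cdot> f)"
  using Comp_madd_left [of f "Dom K f" "Dom K h" g "Cod K h" h] by simp

lemma Comp_distrib_left [simp]: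
  "f \<in> Mor K \<Longrightarrow> g \<in> Mor K \<Longrightarrow> h \<in> Mor K \<Longrightarrow> Dom K f = Dom K g \<Longrightarrow> Cod K f = Cod K g \<Longrightarrow>
    Cod K g = Dom K h \<Longrightarrow> h \<cdot> madd K f g = madd K (h \<cdot> f) (h \<cdot> g)"
  using Comp_madd_right [of f "Dom K g" "Dom K h" g h "Cod K h"] by simp

text \<open>Composition and additive functors send the equation 0 + 0 = 0 to one of this shape, so
  this is how they are seen to preserve zero morphisms.\<close>

lemma idem_zero:
  assumes "f \<in> Mor K" "madd K f f = f"
  shows "f = mzero K (Dom K f) (Cod K f)"
  using madd_mneg_cancel(2) [of f f] assms(1) unfolding assms(2) by simp

lemma mzero_Comp [simp]:
  assumes "f \<in> Mor K" "Cod K f = a" "b \<in> Ob K"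
  shows "mzero K a b \<cdot> f = mzero K (Dom K f) b"
proof -
  have "a \<in> Ob K"
    using assms by auto
  have "madd K (mzero K a b) (mzero K a b) \<cdot> f = mzero K a b \<cdot> f"
    using assms \<open>a \<in> Ob K\<close> by (simp del: Comp_distrib_right)
  then have "madd K (mzero K a b \<cdot> f) (mzero K a b \<cdot> f) = mzero K a b \<cdot> f"
    using assms \<open>a \<in> Ob K\<close> by (simp del: madd_zero)
  then show ?thesis
    using idem_zero [of "mzero K a b \<cdot> f"] assms \<open>a \<in> Ob K\<close> by simp
qed

lemma Comp_mzero [simp]:
  assumes "f \<in> Mor K" "Dom K f = b" "a \<in> Ob K"
  shows "f \<cdot> mzero K a b = mzero K a (Cod K f)"
proof -
  have "b \<in> Ob K"
    using assms by auto
  have "f \<cdot> madd K (mzero K a b) (mzero K a b) = f \<cdot> mzero K a b"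
    using assms \<open>b \<in> Ob K\<close> by (simp del: Comp_distrib_left)
  then have "madd K (f \<cdot> mzero K a b) (f \<cdot> mzero K a b) = f \<cdot> mzero K a b"
    using assms \<open>b \<in> Ob K\<close> by (simp del: madd_zero)
  then show ?thesis
    using idem_zero [of "f \<cdot> mzero K a b"] assms \<open>b \<in> Ob K\<close> by simp
qed

lemma mneg_Comp [simp]:
  assumes "f \<in> Mor K" "g \<in> Mor K" "Cod K f = Dom K g"
  shows "mneg K g \<cdot> f = mneg K (g \<cdot> f)" "g \<cdot> mneg K f = mneg K (g \<cdot> f)"
proof -
  have "madd K (g \<cdot> f) (mneg K g \<cdot> f) = madd K g (mneg K g) \<cdot> f"
    using assms by (intro Comp_distrib_right [symmetric]) simp_all
  also have "\<dots> = mzero K (Dom K (g \<cdot> f)) (Cod K (g \<cdot> f))"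
    using assms by (simp del: Comp_distrib_right)
  finally show "mneg K g \<cdot> f = mneg K (g \<cdot> f)"
    using assms by (intro mneg_unique [symmetric]) simp_all
  have "madd K (g \<cdot> f) (g \<cdot> mneg K f) = g \<cdot> madd K f (mneg K f)"
    using assms by (intro Comp_distrib_left [symmetric]) simp_all
  also have "\<dots> = mzero K (Dom K (g \<cdot> f)) (Cod K (g \<cdot> f))"
    using assms by (simp del: Comp_distrib_left)
  finally show "g \<cdot> mneg K f = mneg K (g \<cdot> f)"
    using assms by (intro mneg_unique [symmetric]) simp_all
qed

lemma mneg_Id_iso:
  assumes "a \<in> Ob K"
  shows "is_iso K (mneg K (Id K a)) a a"
  using assms by (intro is_isoI [of _ "mneg K (Id K a)"]) auto

text \<open>The equational form of the universal property is inherited by images under additive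
  functors without further work.\<close>

lemma zero_object_iff:
  "is_zero_object K z \<longleftrightarrow> z \<in> Ob K \<and> Id K z = mzero K z z"
proof
  assume z: "is_zero_object K z"
  then have "z \<in> Ob K" "\<exists>!f. f \<in> Hom K z z"
    by (auto simp: is_zero_object_def)
  moreover have "Id K z \<in> Hom K z z" "mzero K z z \<in> Hom K z z"
    using \<open>z \<in> Ob K\<close> by auto
  ultimately show "z \<in> Ob K \<and> Id K z = mzero K z z"
    by blast
next
  assume z: "z \<in> Ob K \<and> Id K z = mzero K z z"
  have 1: "f = mzero K a z" if "f \<in> Mor K" "Dom K f = a" "Cod K f = z" for f a
    using that z Comp_Id_left [of f z] mzero_Comp [of f z z] by auto
  have 2: "f = mzero K z a" if "f \<in> Mor K" "Dom K f = z" "Cod K f = a" for f a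
    using that z Comp_Id_right [of f z] Comp_mzero [of f z z] by auto
  have "\<exists>!f. f \<in> Hom K a z" if "a \<in> Ob K" for a
    by (rule ex1I [of _ "mzero K a z"]) (use that z 1 in auto)
  moreover have "\<exists>!f. f \<in> Hom K z a" if "a \<in> Ob K" for a
    by (rule ex1I [of _ "mzero K z a"]) (use that z 2 in auto)
  ultimately show "is_zero_object K z"
    using z unfolding is_zero_object_def by blast
qed

lemma zero_object_Mor:
  assumes "is_zero_object K z" "f \<in> Mor K"
  shows "Cod K f = z \<Longrightarrow> f = mzero K (Dom K f) z" "Dom K f = z \<Longrightarrow> f = mzero K z (Cod K f)"
  using assms zero_object_iff Comp_Id_left [of f z] mzero_Comp [of f z z]
    Comp_Id_right [of f z] Comp_mzero [of f z z] by auto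

section \<open>Biproducts and their matrix calculus\<close>

lemma biproductD:
  assumes "is_biproduct K a b c i1 i2 p1 p2"
  shows "a \<in> Ob K" "b \<in> Ob K" "c \<in> Ob K"
    "i1 \<in> Mor K" "Dom K i1 = a" "Cod K i1 = c" "i2 \<in> Mor K" "Dom K i2 = b" "Cod K i2 = c"
    "p1 \<in> Mor K" "Dom K p1 = c" "Cod K p1 = a" "p2 \<in> Mor K" "Dom K p2 = c" "Cod K p2 = b"
    "p1 \<cdot> i1 = Id K a" "p2 \<cdot> i2 = Id K b" "p1 \<cdot> i2 = mzero K b a" "p2 \<cdot> i1 = mzero K a b"
    "madd K (i1 \<cdot> p1) (i2 \<cdot> p2) = Id K c"
  using assms by (auto simp: is_biproduct_def)

lemma biproduct_swap:
  assumes "is_biproduct K a b c i1 i2 p1 p2"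
  shows "is_biproduct K b a c i2 i1 p2 p1"
proof -
  note b = biproductD [OF assms]
  have "madd K (i2 \<cdot> p2) (i1 \<cdot> p1) = Id K c"
    using b madd_comm [of "i1 \<cdot> p1" "i2 \<cdot> p2"] by auto
  then show ?thesis
    using b by (auto simp: is_biproduct_def)
qed

lemma biproduct_into:
  assumes "is_biproduct K a b c i1 i2 p1 p2" "x \<in> Mor K" "Cod K x = c"
  shows "madd K (i1 \<cdot> p1 \<cdot> x) (i2 \<cdot> p2 \<cdot> x) = x"
proof -
  note b = biproductD [OF assms(1)]
  have "madd K (i1 \<cdot> p1) (i2 \<cdot> p2) \<cdot> x = x"
    using b assms(2,3) by (simp del: Comp_distrib_right)
  then show ?thesis
    using b(1-19) assms(2,3) by simp
qed

lemma biproduct_out: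
  assumes "is_biproduct K a b c i1 i2 p1 p2" "x \<in> Mor K" "Dom K x = c"
  shows "madd K (x \<cdot> i1 \<cdot> p1) (x \<cdot> i2 \<cdot> p2) = x"
proof -
  note b = biproductD [OF assms(1)]
  have "x \<cdot> madd K (i1 \<cdot> p1) (i2 \<cdot> p2) = x"
    using b assms(2,3) by (simp del: Comp_distrib_left)
  then show ?thesis
    using b(1-19) assms(2,3) by simp
qed

lemma biproduct_pair:
  assumes bi: "is_biproduct K a b c i1 i2 p1 p2"
    and x: "x \<in> Mor K" "Dom K x = d" "Cod K x = a" and y: "y \<in> Mor K" "Dom K y = d" "Cod K y = b"
  obtains v where "v \<in> Mor K" "Dom K v = d" "Cod K v = c" "p1 \<cdot> v = x" "p2 \<cdot> v = y"
proof -
  note b = biproductD [OF bi]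
  show ?thesis
    by (rule that [of "madd K (i1 \<cdot> x) (i2 \<cdot> y)"])
      (use b(1-15) x y Comp_reduce [OF b(16), of x] Comp_reduce [OF b(17), of y]
        Comp_reduce [OF b(18), of y] Comp_reduce [OF b(19), of x] in simp_all)
qed

lemma biproduct_zero_right:
  assumes "a \<in> Ob K" "is_zero_object K z"
  shows "is_biproduct K a z a (Id K a) (mzero K z a) (Id K a) (mzero K a z)"
  using assms by (auto simp: is_biproduct_def zero_object_iff)

section \<open>Additive functors\<close>

lemma functor_simps:
  assumes "is_functor K K F0 F1" "f \<in> Mor K"
  shows "F1 f \<in> Mor K" "Dom K (F1 f) = F0 (Dom K f)" "Cod K (F1 f) = F0 (Cod K f)"
proof -
  have "f \<in> Hom K (Dom K f) (Cod K f)" "Dom K f \<in> Ob K" "Cod K f \<in> Ob K"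
    using assms(2) by auto
  then have "F1 f \<in> Hom K (F0 (Dom K f)) (F0 (Cod K f))"
    using assms(1) unfolding is_functor_def by blast
  then show "F1 f \<in> Mor K" "Dom K (F1 f) = F0 (Dom K f)" "Cod K (F1 f) = F0 (Cod K f)"
    by simp_all
qed

lemma functor_Ob: "is_functor K K F0 F1 \<Longrightarrow> a \<in> Ob K \<Longrightarrow> F0 a \<in> Ob K"
  unfolding is_functor_def by auto

lemma functor_Id: "is_functor K K F0 F1 \<Longrightarrow> a \<in> Ob K \<Longrightarrow> F1 (Id K a) = Id K (F0 a)"
  unfolding is_functor_def by auto

lemma functor_Comp:
  assumes "is_functor K K F0 F1" "f \<in> Mor K" "g \<in> Mor K" "Cod K f = Dom K g"
  shows "F1 (g \<cdot> f) = F1 g \<cdot> F1 f"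
proof -
  have "f \<in> Hom K (Dom K f) (Dom K g)" "g \<in> Hom K (Dom K g) (Cod K g)"
    "Dom K f \<in> Ob K" "Dom K g \<in> Ob K" "Cod K g \<in> Ob K"
    using assms by auto
  then show ?thesis
    using assms(1) unfolding is_functor_def by blast
qed

lemma functor_madd:
  assumes "additive_on_homs K K F1" "f \<in> Mor K" "g \<in> Mor K" "Dom K f = Dom K g" "Cod K f = Cod K g"
  shows "F1 (madd K f g) = madd K (F1 f) (F1 g)"
proof -
  have "f \<in> Hom K (Dom K f) (Cod K f)" "g \<in> Hom K (Dom K f) (Cod K f)"
    "Dom K f \<in> Ob K" "Cod K f \<in> Ob K"
    using assms by auto
  then show ?thesis
    using assms(1) unfolding additive_on_homs_def by blast
qed

lemma functor_mzero:
  assumes "is_functor K K F0 F1" "additive_on_homs K K F1" "a \<in> Ob K" "b \<in> Ob K"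
  shows "F1 (mzero K a b) = mzero K (F0 a) (F0 b)"
proof -
  have "F1 (madd K (mzero K a b) (mzero K a b)) = madd K (F1 (mzero K a b)) (F1 (mzero K a b))"
    using assms by (intro functor_madd) auto
  then have "madd K (F1 (mzero K a b)) (F1 (mzero K a b)) = F1 (mzero K a b)"
    using assms(3,4) by simp
  then show ?thesis
    using idem_zero [of "F1 (mzero K a b)"] functor_simps [OF assms(1), of "mzero K a b"] assms(3,4)
    by simp
qed

lemma functor_iso:
  assumes "is_functor K K F0 F1" "is_iso K f a b"
  shows "is_iso K (F1 f) (F0 a) (F0 b)"
proof -
  obtain g where g: "f \<in> Mor K" "g \<in> Mor K" "Dom K f = a" "Cod K f = b" "Dom K g = b" "Cod K g = a"
    "g \<cdot> f = Id K a" "f \<cdot> g = Id K b"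
    using assms(2) by (rule is_isoE)
  then have "a \<in> Ob K" "b \<in> Ob K"
    by auto
  then have "F1 g \<cdot> F1 f = Id K (F0 a)" "F1 f \<cdot> F1 g = Id K (F0 b)"
    using functor_Comp [OF assms(1), of f g] functor_Comp [OF assms(1), of g f] g
      functor_Id [OF assms(1)] by auto
  then show ?thesis
    using g functor_simps [OF assms(1)] by (intro is_isoI [of _ "F1 g"]) auto
qed

lemma functor_zero_object:
  assumes "is_functor K K F0 F1" "additive_on_homs K K F1" "is_zero_object K z"
  shows "is_zero_object K (F0 z)"
  using assms functor_mzero [OF assms(1,2), of z z] functor_Id [OF assms(1), of z]
    functor_Ob [OF assms(1), of z]
  by (auto simp: zero_object_iff)

lemma functor_biproduct:
  assumes "is_functor K K F0 F1" "additive_on_homs K K F1" "is_biproduct K a b c i1 i2 p1 p2"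
  shows "is_biproduct K (F0 a) (F0 b) (F0 c) (F1 i1) (F1 i2) (F1 p1) (F1 p2)"
proof -
  note b = biproductD [OF assms(3)]
  note C = functor_Comp [OF assms(1), symmetric]
  have "madd K (F1 (i1 \<cdot> p1)) (F1 (i2 \<cdot> p2)) = Id K (F0 c)"
    using functor_madd [OF assms(2), of "i1 \<cdot> p1" "i2 \<cdot> p2"] b functor_Id [OF assms(1)] by auto
  then have "madd K (F1 i1 \<cdot> F1 p1) (F1 i2 \<cdot> F1 p2) = Id K (F0 c)"
    using b(1-15) C by simp
  then show ?thesis
    unfolding is_biproduct_def
    using b(1-19) C functor_simps [OF assms(1)] functor_Id [OF assms(1)] functor_Ob [OF assms(1)]
      functor_mzero [OF assms(1,2)]
    by auto
qed

lemma mneg_cancel_iff [simp]: "f \<in> Mor K \<Longrightarrow> g \<in> Mor K \<Longrightarrow> mneg K f = mneg K g \<longleftrightarrow> f = g"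
  by (metis mneg_mneg)

lemma is_iso_left_right:
  assumes "f \<in> Mor K" "g \<in> Mor K" "h \<in> Mor K" "Dom K f = a" "Cod K f = b"
    "Dom K g = b" "Cod K g = a" "Dom K h = b" "Cod K h = a" "g \<cdot> f = Id K a" "f \<cdot> h = Id K b"
  shows "is_iso K f a b"
proof -
  have "g = g \<cdot> f \<cdot> h"
    using assms by auto
  also have "\<dots> = h"
    using assms Comp_reduce [OF assms(10), of h] by auto
  finally show ?thesis
    using assms by (intro is_isoI [of f g]) auto
qed

lemma madd_mneg_cancel_comm [simp]:
  assumes "f \<in> Mor K" "g \<in> Mor K" "Dom K f = Dom K g" "Cod K f = Cod K g"
  shows "madd K f (madd K g (mneg K f)) = g" "madd K (mneg K f) (madd K g f) = g"
proof -
  show "madd K f (madd K g (mneg K f)) = g"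
    using assms madd_comm [of g "mneg K f"] by simp
  show "madd K (mneg K f) (madd K g f) = g"
    using assms madd_comm [of g f] by simp
qed

text \<open>This is the bookkeeping of gluing: when a difference \<open>A\<close> - \<open>B\<close>
  splits as \<open>C\<close> + \<open>D\<close>, correcting \<open>A\<close> by \<open>C\<close> and
  \<open>B\<close> by \<open>D\<close> makes the two agree.\<close>

lemma madd_exchange:
  assumes "A \<in> Mor K" "B \<in> Mor K" "C \<in> Mor K" "D \<in> Mor K" "Dom K A = x" "Dom K B = x" "Dom K C = x"
    "Dom K D = x" "Cod K A = y" "Cod K B = y" "Cod K C = y" "Cod K D = y"
    "madd K A (mneg K B) = madd K C D"
  shows "madd K A (mneg K C) = madd K B D"
proof -
  have "A = madd K B (madd K A (mneg K B))"
    using assms(1-12) by simp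
  then have "A = madd K B (madd K C D)"
    using assms(13) by simp
  then have "madd K A (mneg K C) = madd K (madd K B (madd K C D)) (mneg K C)"
    by simp
  also have "\<dots> = madd K B D"
    using assms(1-12) by (simp add: madd_assoc)
  finally show ?thesis .
qed

lemma madd_left_cancel:
  assumes "madd K f g = madd K f h" "f \<in> Mor K" "g \<in> Mor K" "h \<in> Mor K"
    "Dom K f = Dom K g" "Cod K f = Cod K g" "Dom K h = Dom K g" "Cod K h = Cod K g"
  shows "g = h"
proof -
  have "madd K (mneg K f) (madd K f g) = g" "madd K (mneg K f) (madd K f h) = h"
    using assms(2-8) by simp_all
  then show ?thesis
    using assms(1) by metis
qed

text \<open>Splitting \<open>Id - e\<close> gives a complement of the image of \<open>e\<close>.\<close>

lemma idempotent_biproduct: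
  assumes ic: "idempotent_complete K" and e: "e \<in> Mor K" "Dom K e = c" "Cod K e = c" "e \<cdot> e = e"
  obtains a b i1 i2 p1 p2 where "is_biproduct K a b c i1 i2 p1 p2" "i1 \<cdot> p1 = e"
proof -
  have c: "c \<in> Ob K"
    using e by auto
  have split: "\<exists>b\<in>Ob K. \<exists>r\<in>Hom K c b. \<exists>i\<in>Hom K b c. i \<cdot> r = e \<and> r \<cdot> i = Id K b"
    if "e \<in> Mor K" "Dom K e = c" "Cod K e = c" "e \<cdot> e = e" for e
    using ic c that unfolding idempotent_complete_def by auto
  obtain a p1 i1 where 1: "a \<in> Ob K" "p1 \<in> Mor K" "Dom K p1 = c" "Cod K p1 = a"
    "i1 \<in> Mor K" "Dom K i1 = a" "Cod K i1 = c" "i1 \<cdot> p1 = e" "p1 \<cdot> i1 = Id K a"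
  proof -
    obtain a r i where "a \<in> Ob K" "r \<in> Hom K c a" "i \<in> Hom K a c" "i \<cdot> r = e" "r \<cdot> i = Id K a"
      using split [OF e] by blast
    then show ?thesis
      by (intro that [of a r i]) simp_all
  qed
  define e' where "e' = madd K (Id K c) (mneg K e)"
  have e': "e' \<in> Mor K" "Dom K e' = c" "Cod K e' = c" "e' \<cdot> e' = e'" "e' \<cdot> e = mzero K c c" "e \<cdot> e' = mzero K c c"
    "madd K e e' = Id K c"
    using e c by (simp_all add: e'_def madd_ac)
  obtain b p2 i2 where 2: "b \<in> Ob K" "p2 \<in> Mor K" "Dom K p2 = c" "Cod K p2 = b"
    "i2 \<in> Mor K" "Dom K i2 = b" "Cod K i2 = c" "i2 \<cdot> p2 = e'" "p2 \<cdot> i2 = Id K b"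
  proof -
    obtain b r i where "b \<in> Ob K" "r \<in> Hom K c b" "i \<in> Hom K b c" "i \<cdot> r = e'" "r \<cdot> i = Id K b"
      using split [OF e'(1-4)] by blast
    then show ?thesis
      by (intro that [of b r i]) simp_all
  qed
  \<comment> \<open>Inserting the identities \<open>p1 \<cdot> i1\<close> and
    \<open>p2 \<cdot> i2\<close> makes the product \<open>e \<cdot> e'\<close> of the complementary
    idempotents appear, which vanishes.\<close>
  have "p1 \<cdot> i2 = (p1 \<cdot> i1) \<cdot> p1 \<cdot> i2 \<cdot> (p2 \<cdot> i2)"
    unfolding 1(9) 2(9) using 1(1-7) 2(1-7) by simp
  also have "\<dots> = p1 \<cdot> ((i1 \<cdot> p1) \<cdot> (i2 \<cdot> p2)) \<cdot> i2"
    using 1(1-7) 2(1-7) by simp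
  also have "\<dots> = mzero K b a"
    unfolding 1(8) 2(8) e'(6) using 1(1-7) 2(1-7) c by simp
  finally have 12: "p1 \<cdot> i2 = mzero K b a" .
  have "p2 \<cdot> i1 = (p2 \<cdot> i2) \<cdot> p2 \<cdot> i1 \<cdot> (p1 \<cdot> i1)"
    unfolding 1(9) 2(9) using 1(1-7) 2(1-7) by simp
  also have "\<dots> = p2 \<cdot> ((i2 \<cdot> p2) \<cdot> (i1 \<cdot> p1)) \<cdot> i1"
    using 1(1-7) 2(1-7) by simp
  also have "\<dots> = mzero K a b"
    unfolding 1(8) 2(8) e'(5) using 1(1-7) 2(1-7) c by simp
  finally have "is_biproduct K a b c i1 i2 p1 p2"
    using 1 2 12 c e'(7) by (simp add: is_biproduct_def)
  then show ?thesis
    using that 1(8) by blast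
qed

end

section \<open>Triangulated categories\<close>

context triangulated_category
begin

section \<open>The suspension as an additive equivalence\<close>

lemma TOb_Ob [simp]: "a \<in> Ob K \<Longrightarrow> TOb K a \<in> Ob K"
  using functor_Ob [OF T_functor] .

lemma TMor_simps [simp]:
  assumes "f \<in> Mor K"
  shows "TMor K f \<in> Mor K" "Dom K (TMor K f) = TOb K (Dom K f)" "Cod K (TMor K f) = TOb K (Cod K f)"
  using functor_simps [OF T_functor assms] by auto

lemma TMor_Id [simp]: "a \<in> Ob K \<Longrightarrow> TMor K (Id K a) = Id K (TOb K a)"
  using functor_Id [OF T_functor] .

lemma TMor_Comp [simp]:
  "f \<in> Mor K \<Longrightarrow> g \<in> Mor K \<Longrightarrow> Cod K f = Dom K g \<Longrightarrow> TMor K (g \<cdot> f) = TMor K g \<cdot> TMor K f"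
  using functor_Comp [OF T_functor] .

lemma TMor_madd [simp]:
  "f \<in> Mor K \<Longrightarrow> g \<in> Mor K \<Longrightarrow> Dom K f = Dom K g \<Longrightarrow> Cod K f = Cod K g \<Longrightarrow>
    TMor K (madd K f g) = madd K (TMor K f) (TMor K g)"
  using functor_madd [OF T_additive] .

lemma TMor_mzero [simp]:
  "a \<in> Ob K \<Longrightarrow> b \<in> Ob K \<Longrightarrow> TMor K (mzero K a b) = mzero K (TOb K a) (TOb K b)"
  using functor_mzero [OF T_functor T_additive] .

lemma TMor_mneg [simp]:
  assumes "f \<in> Mor K"
  shows "TMor K (mneg K f) = mneg K (TMor K f)"
proof (rule mneg_unique [symmetric])
  have "madd K (TMor K f) (TMor K (mneg K f)) = TMor K (madd K f (mneg K f))"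
    using assms by (intro TMor_madd [symmetric]) auto
  then show "madd K (TMor K f) (TMor K (mneg K f)) = mzero K (Dom K (TMor K f)) (Cod K (TMor K f))"
    using assms by simp
qed (use assms in auto)

lemma TMor_inj:
  assumes "f \<in> Mor K" "g \<in> Mor K" "Dom K f = Dom K g" "Cod K f = Cod K g" "TMor K f = TMor K g"
  shows "f = g"
  using T_fully_faithful [of "Dom K f" "Cod K f"] assms
  unfolding bij_betw_def inj_on_def by auto

lemma TMor_surj:
  assumes "h \<in> Mor K" "Dom K h = TOb K a" "Cod K h = TOb K b" "a \<in> Ob K" "b \<in> Ob K"
  obtains f where "f \<in> Mor K" "Dom K f = a" "Cod K f = b" "TMor K f = h"
proof -
  have "h \<in> TMor K ` Hom K a b"
    using T_fully_faithful [of a b] assms unfolding bij_betw_def by auto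
  then show ?thesis
    using that by auto
qed

lemma T_zero_object: "is_zero_object K z \<Longrightarrow> is_zero_object K (TOb K z)"
  using functor_zero_object [OF T_functor T_additive] .

section \<open>Distinguished triangles: factorisations, cones and fibres\<close>

lemma triD:
  assumes "(u, v, w) \<in> Tri K"
  shows "u \<in> Mor K" "v \<in> Mor K" "w \<in> Mor K" "Cod K u = Dom K v" "Dom K w = Cod K v"
    "Cod K w = TOb K (Dom K u)"
  using Tri_shape [OF assms] by auto

lemma tri_rotate: "(u, v, w) \<in> Tri K \<Longrightarrow> (v, w, mneg K (TMor K u)) \<in> Tri K"
  using Tri_rotate [of u "Dom K u" "Dom K v" v "Cod K v" w] triD by auto

lemma tri_unrotate:
  "(v, w, mneg K (TMor K u)) \<in> Tri K \<Longrightarrow> u \<in> Mor K \<Longrightarrow> Cod K u = Dom K v \<Longrightarrow>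
    Cod K w = TOb K (Dom K u) \<Longrightarrow> (u, v, w) \<in> Tri K"
  using Tri_rotate [of u "Dom K u" "Dom K v" v "Cod K v" w] triD [of v w] by auto

lemma tri_zero_left:
  assumes "d \<in> Ob K" "is_zero_object K z"
  shows "(mzero K z d, Id K d, mzero K d (TOb K z)) \<in> Tri K"
proof -
  have "z \<in> Ob K"
    using assms(2) by (simp add: zero_object_iff)
  then show ?thesis
    using Tri_trivial [OF assms(1) T_zero_object [OF assms(2)]] assms(1)
    by - (rule tri_unrotate; simp)
qed

text \<open>The pair (identity, \<open>u\<close>) maps the trivial triangle on
  \<open>Dom K u\<close> to the given one; its third component starts at a zero object, and
  \<open>v \<cdot> u\<close> factors through it.\<close>

lemma tri_comp_vu:
  assumes "(u, v, w) \<in> Tri K"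
  shows "v \<cdot> u = mzero K (Dom K u) (Cod K v)"
proof -
  note t = triD [OF assms]
  obtain o0 where o: "is_zero_object K o0"
    using zero_object by blast
  then have "o0 \<in> Ob K"
    by (simp add: zero_object_iff)
  have "\<exists>z\<in>Hom K (Cod K (mzero K (Dom K u) o0)) (Cod K v). v \<cdot> u = z \<cdot> mzero K (Dom K u) o0 \<and>
      w \<cdot> z = TMor K (Id K (Dom K u)) \<cdot> mzero K o0 (TOb K (Dom K u))"
    by (rule Tri_morphism [OF Tri_trivial [OF _ o] assms])
      (use t \<open>o0 \<in> Ob K\<close> in simp_all)
  then show ?thesis
    using t \<open>o0 \<in> Ob K\<close> by auto
qed

lemma tri_comp_wv:
  assumes "(u, v, w) \<in> Tri K"
  shows "w \<cdot> v = mzero K (Cod K u) (TOb K (Dom K u))"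
  using tri_comp_vu [OF tri_rotate [OF assms]] triD [OF assms] by simp

lemma tri_comp_Tuw:
  assumes "(u, v, w) \<in> Tri K"
  shows "TMor K u \<cdot> w = mzero K (Cod K v) (TOb K (Cod K u))"
proof -
  have "mneg K (TMor K u \<cdot> w) = mzero K (Cod K v) (TOb K (Cod K u))"
    using tri_comp_wv [OF tri_rotate [OF assms]] triD [OF assms] by simp
  then have "mneg K (mneg K (TMor K u \<cdot> w)) = mneg K (mzero K (Cod K v) (TOb K (Cod K u)))"
    by simp
  then show ?thesis
    using triD [OF assms] by simp
qed

text \<open>A map \<open>f\<close> killing \<open>u\<close> defines a morphism to the triangle 0
  \<rightarrow> d \<rightarrow> d, and the third component of that morphism is the
  factorisation.\<close>

lemma tri_factor_v:
  assumes "(u, v, w) \<in> Tri K" "f \<in> Mor K" "Dom K f = Cod K u" "f \<cdot> u = mzero K (Dom K u) (Cod K f)"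
  obtains g where "g \<in> Mor K" "Dom K g = Cod K v" "Cod K g = Cod K f" "g \<cdot> v = f"
proof -
  note t = triD [OF assms(1)]
  obtain o0 where o: "is_zero_object K o0"
    using zero_object by blast
  then have "o0 \<in> Ob K"
    by (simp add: zero_object_iff)
  have "\<exists>z\<in>Hom K (Cod K v) (Cod K (Id K (Cod K f))). Id K (Cod K f) \<cdot> f = z \<cdot> v \<and>
      mzero K (Cod K f) (TOb K o0) \<cdot> z = TMor K (mzero K (Dom K u) o0) \<cdot> w"
    by (rule Tri_morphism [OF assms(1) tri_zero_left [OF _ o]])
      (use t \<open>o0 \<in> Ob K\<close> assms(2-4) in simp_all)
  then obtain z where z: "z \<in> Hom K (Cod K v) (Cod K (Id K (Cod K f)))" "Id K (Cod K f) \<cdot> f = z \<cdot> v"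
    by blast
  have "z \<cdot> v = f"
    using z(2) assms(2) by simp
  then show ?thesis
    using z(1) assms(2) by (intro that [of z]) simp_all
qed

lemma tri_factor_w:
  assumes "(u, v, w) \<in> Tri K" "f \<in> Mor K" "Dom K f = Cod K v" "f \<cdot> v = mzero K (Cod K u) (Cod K f)"
  obtains g where "g \<in> Mor K" "Dom K g = TOb K (Dom K u)" "Cod K g = Cod K f" "g \<cdot> w = f"
  using tri_factor_v [OF tri_rotate [OF assms(1)], of f] assms triD [OF assms(1)] by auto

text \<open>One rotation turns the hypothesis into a factorisation of \<open>TMor K f\<close>
  through the negative of \<open>TMor K u\<close>; full faithfulness of T then removes the
  suspension, the sign being absorbed into the extension.\<close>

lemma tri_extend:
  assumes "(u, v, w) \<in> Tri K" "f \<in> Mor K" "Dom K f = Dom K u"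
    "TMor K f \<cdot> w = mzero K (Cod K v) (TOb K (Cod K f))"
  obtains g where "g \<in> Mor K" "Dom K g = Cod K u" "Cod K g = Cod K f" "g \<cdot> u = f"
proof -
  note t = triD [OF assms(1)]
  obtain g where g: "g \<in> Mor K" "Dom K g = TOb K (Dom K v)" "Cod K g = TOb K (Cod K f)"
    "g \<cdot> mneg K (TMor K u) = TMor K f"
    using tri_factor_w [OF tri_rotate [OF assms(1)], of "TMor K f"] assms t by auto
  obtain h where h: "h \<in> Mor K" "Dom K h = Dom K v" "Cod K h = Cod K f" "TMor K h = mneg K g"
    using TMor_surj [of "mneg K g" "Dom K v" "Cod K f"] g t assms by auto
  have "TMor K (h \<cdot> u) = TMor K f"
    using g h t by simp
  then have "h \<cdot> u = f"
    using h(1-3) t assms(2,3) by - (rule TMor_inj; simp)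
  then show ?thesis
    using h(1-3) t by (intro that [of h]) simp_all
qed

text \<open>Dual to \<open>tri_factor_v\<close>. The trivial triangle on \<open>Dom K f\<close>,
  rotated once, is mapped to the rotated given triangle; the third component is the suspension of
  the lift, and the two signs cancel.\<close>

lemma tri_lift_u:
  assumes "(u, v, w) \<in> Tri K" "f \<in> Mor K" "Cod K f = Cod K u" "v \<cdot> f = mzero K (Dom K f) (Cod K v)"
  obtains g where "g \<in> Mor K" "Dom K g = Dom K f" "Cod K g = Dom K u" "u \<cdot> g = f"
proof -
  note t = triD [OF assms(1)]
  define d where "d = Dom K f"
  obtain o0 where o: "is_zero_object K o0"
    using zero_object by blast
  then have o': "o0 \<in> Ob K"
    by (simp add: zero_object_iff)
  have d: "d \<in> Ob K"
    using assms d_def by auto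
  have "\<exists>z\<in>Hom K (Cod K (mzero K o0 (TOb K d))) (Cod K w). w \<cdot> mzero K o0 (Cod K v) = z \<cdot> mzero K o0 (TOb K d) \<and>
      mneg K (TMor K u) \<cdot> z = TMor K f \<cdot> mneg K (TMor K (Id K d))"
    by (rule Tri_morphism [OF tri_rotate [OF Tri_trivial [OF d o]] tri_rotate [OF assms(1)]])
      (use t d o' assms(2-4) d_def in simp_all)
  then obtain z where z: "z \<in> Mor K" "Dom K z = TOb K d" "Cod K z = TOb K (Dom K u)"
    "mneg K (TMor K u \<cdot> z) = mneg K (TMor K f)"
    using t d o' d_def assms(2) by auto
  then have z': "TMor K u \<cdot> z = TMor K f"
    using t assms(2) by simp
  obtain g where g: "g \<in> Mor K" "Dom K g = d" "Cod K g = Dom K u" "TMor K g = z"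
    using TMor_surj [of z d "Dom K u"] z t d by auto
  have "TMor K (u \<cdot> g) = TMor K f"
    using g t z' by simp
  then have "u \<cdot> g = f"
    using g(1-3) t assms(2,3) d_def by - (rule TMor_inj; simp)
  then show ?thesis
    using g(1-3) d_def by (intro that [of g]) simp_all
qed

lemma tri_cone_iso:
  assumes "(u, v, w) \<in> Tri K" "is_iso K z (Cod K v) e" "z' \<in> Mor K" "Dom K z' = e" "Cod K z' = Cod K v"
    "z' \<cdot> z = Id K (Cod K v)" 
  shows "(u, z \<cdot> v, w \<cdot> z') \<in> Tri K"
proof -
  note t = triD [OF assms(1)]
  have z: "z \<in> Mor K" "Dom K z = Cod K v" "Cod K z = e"
    using assms(2) by (auto elim: is_isoE)
  show ?thesis
    by (rule Tri_iso [OF assms(1), of "Dom K u" "Dom K v" "Cod K v" _ "Dom K u" "Dom K v" _ e _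
          "Id K (Dom K u)" "Id K (Dom K v)" z])
      (use t z assms is_iso_Id in auto)
qed

text \<open>Rotating the cone triangle backwards requires its third object to be a suspension. Since
  T is only essentially surjective, the cone is first replaced by an isomorphic
  \<open>TOb K y\<close>, and \<open>y\<close> becomes the fibre.\<close>

lemma tri_fiber:
  assumes "f \<in> Mor K"
  obtains m n where "(m, f, n) \<in> Tri K"
proof -
  obtain v w where vw: "(f, v, w) \<in> Tri K"
    using Tri_cone [OF assms] by auto
  note t = triD [OF vw]
  obtain y h where y: "y \<in> Ob K" "is_iso K h (TOb K y) (Cod K v)"
    using T_essentially_surjective [of "Cod K v"] t by auto
  then obtain g where g: "h \<in> Mor K" "g \<in> Mor K" "Dom K h = TOb K y" "Cod K h = Cod K v"
    "Dom K g = Cod K v" "Cod K g = TOb K y" "g \<cdot> h = Id K (TOb K y)" "h \<cdot> g = Id K (Cod K v)"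
    by (auto elim: is_isoE)
  have 1: "(f, g \<cdot> v, w \<cdot> h) \<in> Tri K"
    using tri_cone_iso [OF vw, of g "TOb K y" h] g is_isoI [of g h] by auto
  obtain m where m: "m \<in> Mor K" "Dom K m = y" "Cod K m = Dom K f" "TMor K m = w \<cdot> h"
    using TMor_surj [of "w \<cdot> h" y "Dom K f"] t g y by auto
  have "(mneg K m, f, g \<cdot> v) \<in> Tri K"
    using 1 m assms g(1-6) t by - (rule tri_unrotate; simp)
  then show ?thesis
    using that by blast
qed

lemma tri_mor_extend:
  assumes "(u, v, w) \<in> Tri K" "(u', v', w') \<in> Tri K" "x \<in> Mor K" "y \<in> Mor K"
    "Dom K x = Dom K u" "Cod K x = Dom K u'" "Dom K y = Cod K u" "Cod K y = Cod K u'" "u' \<cdot> x = y \<cdot> u"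
  obtains z where "z \<in> Mor K" "Dom K z = Cod K v" "Cod K z = Cod K v'" "z \<cdot> v = v' \<cdot> y"
    "w' \<cdot> z = TMor K x \<cdot> w"
proof -
  have "\<exists>z\<in>Hom K (Cod K v) (Cod K v'). v' \<cdot> y = z \<cdot> v \<and> w' \<cdot> z = TMor K x \<cdot> w"
    using assms(3-9) by (intro Tri_morphism [OF assms(1,2)]) auto
  then show ?thesis
    using that by auto
qed

text \<open>Put n = \<open>e\<close> - identity. From n v = 0 comes a factorisation n = g w, and w n
  = 0 then gives n n = g w n = 0. So identity - n inverts \<open>e\<close>. This takes the place of
  the five lemma in what follows.\<close>

lemma tri_endo_inverse:
  assumes "(u, v, w) \<in> Tri K" "e \<in> Mor K" "Dom K e = Cod K v" "Cod K e = Cod K v"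
    "e \<cdot> v = v" "w \<cdot> e = w"
  obtains e' where "e' \<in> Mor K" "Dom K e' = Cod K v" "Cod K e' = Cod K v"
    "e' \<cdot> e = Id K (Cod K v)" "e \<cdot> e' = Id K (Cod K v)" "e' \<cdot> v = v" "w \<cdot> e' = w"
proof -
  note t = triD [OF assms(1)]
  let ?c = "Cod K v"
  define n where "n = madd K e (mneg K (Id K ?c))"
  have n: "n \<in> Mor K" "Dom K n = ?c" "Cod K n = ?c" "madd K (Id K ?c) n = e"
    using assms t unfolding n_def by (auto simp: madd_ac)
  have nv: "n \<cdot> v = mzero K (Cod K u) ?c" and wn: "w \<cdot> n = mzero K ?c (TOb K (Dom K u))"
    using assms t unfolding n_def by auto
  obtain g where g: "g \<in> Mor K" "Dom K g = TOb K (Dom K u)" "Cod K g = ?c" "g \<cdot> w = n"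
    using tri_factor_w [OF assms(1), of n] n nv by auto
  have "n \<cdot> n = g \<cdot> w \<cdot> n"
    using g(4) Comp_reduce [OF g(4), of n] g n t by auto
  then have nn: "n \<cdot> n = mzero K ?c ?c"
    using wn g t by simp
  let ?e = "madd K (Id K ?c) (mneg K n)"
  have "?e \<cdot> e = Id K ?c" "e \<cdot> ?e = Id K ?c"
    unfolding n(4) [symmetric] using n(1-3) nn t by (simp_all add: madd_ac)
  moreover have "?e \<cdot> v = v" "w \<cdot> ?e = w"
    using n(1-3) nv wn t by simp_all
  ultimately show ?thesis
    using that [of ?e] n(1-3) t by simp
qed

text \<open>The comparison maps in the two directions compose to endomorphisms fixing the outer maps
  of the triangles. Both composites are invertible by \<open>tri_endo_inverse\<close>, which gives a
  left and a right inverse of \<open>z\<close>.\<close>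

lemma tri_cone_unique:
  assumes "(u, v, w) \<in> Tri K" "(u, v', w') \<in> Tri K"
  obtains z where "is_iso K z (Cod K v) (Cod K v')" "z \<cdot> v = v'" "w' \<cdot> z = w"
proof -
  note t = triD [OF assms(1)] and t' = triD [OF assms(2)]
  obtain z where z: "z \<in> Mor K" "Dom K z = Cod K v" "Cod K z = Cod K v'" "z \<cdot> v = v'" "w' \<cdot> z = w"
    using tri_mor_extend [OF assms, of "Id K (Dom K u)" "Id K (Cod K u)"] t t' by auto
  obtain y where y: "y \<in> Mor K" "Dom K y = Cod K v'" "Cod K y = Cod K v" "y \<cdot> v' = v" "w \<cdot> y = w'"
    using tri_mor_extend [OF assms(2,1), of "Id K (Dom K u)" "Id K (Cod K u)"] t t' by auto
  have 1: "w \<cdot> y \<cdot> z = w" "w' \<cdot> z \<cdot> y = w'"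
    using Comp_reduce [OF y(5), of z] Comp_reduce [OF z(5), of y] t t' y z by auto
  have 2: "y \<cdot> z \<cdot> v = v" "z \<cdot> y \<cdot> v' = v'"
    using y(4) z(4) by simp_all
  obtain e where e: "e \<in> Mor K" "Dom K e = Cod K v" "Cod K e = Cod K v" "e \<cdot> y \<cdot> z = Id K (Cod K v)"
    using tri_endo_inverse [OF assms(1), of "y \<cdot> z"] t(2,3,5) y(1-3) z(1-3) 1 2 by auto
  obtain e' where e': "e' \<in> Mor K" "Dom K e' = Cod K v'" "Cod K e' = Cod K v'"
    "z \<cdot> y \<cdot> e' = Id K (Cod K v')"
    using tri_endo_inverse [OF assms(2), of "z \<cdot> y"] t'(2,3,5) y(1-3) z(1-3) 1 2 by auto
  have "is_iso K z (Cod K v) (Cod K v')"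
    using y(1-3) z(1-3) e e' by (intro is_iso_left_right [of z "e \<cdot> y" "y \<cdot> e'"]) auto
  then show ?thesis
    using that z by blast
qed

text \<open>Three rotations put a sign on all three suspended maps. The isomorphism of triangles
  that is minus the identity on the middle object removes the first two signs and keeps the
  third.\<close>

lemma tri_T_iff:
  assumes "u \<in> Mor K" "v \<in> Mor K" "w \<in> Mor K" "Cod K u = Dom K v" "Dom K w = Cod K v"
    "Cod K w = TOb K (Dom K u)"
  shows "(TMor K u, TMor K v, mneg K (TMor K w)) \<in> Tri K \<longleftrightarrow> (u, v, w) \<in> Tri K"
proof -
  let ?a = "Dom K u" and ?b = "Dom K v" and ?c = "Cod K v"
  let ?n = "\<lambda>f. mneg K (TMor K f)"
  have iso: "is_iso K (mneg K (Id K (TOb K ?b))) (TOb K ?b) (TOb K ?b)"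
    using assms by (intro mneg_Id_iso) auto
  have "(?n u, ?n v, ?n w) \<in> Tri K \<longleftrightarrow> (u, v, w) \<in> Tri K"
    using assms
    by (metis tri_rotate tri_unrotate mneg_simps TMor_simps)
  moreover have "(TMor K u, TMor K v, ?n w) \<in> Tri K" if "(?n u, ?n v, ?n w) \<in> Tri K"
    by (rule Tri_iso [OF that, of "TOb K ?a" "TOb K ?b" "TOb K ?c" _ "TOb K ?a" "TOb K ?b" _ "TOb K ?c" _
          "Id K (TOb K ?a)" "mneg K (Id K (TOb K ?b))" "Id K (TOb K ?c)"])
      (use assms is_iso_Id iso in auto)
  moreover have "(?n u, ?n v, ?n w) \<in> Tri K" if "(TMor K u, TMor K v, ?n w) \<in> Tri K"
    by (rule Tri_iso [OF that, of "TOb K ?a" "TOb K ?b" "TOb K ?c" _ "TOb K ?a" "TOb K ?b" _ "TOb K ?c" _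
          "Id K (TOb K ?a)" "mneg K (Id K (TOb K ?b))" "Id K (TOb K ?c)"])
      (use assms is_iso_Id iso in auto)
  ultimately show ?thesis
    by blast
qed

text \<open>Because \<open>p1\<close> retracts \<open>i1\<close>, the connecting map
  \<open>r\<close> of a cone of \<open>i1\<close> equals T(p1) T(i1) r = 0. The cone is then
  identified with \<open>b\<close> by the map induced by \<open>p2\<close>, with inverse
  \<open>q \<cdot> i2\<close>.\<close>

lemma tri_biproduct:
  assumes "is_biproduct K a b c i1 i2 p1 p2"
  shows "(i1, p2, mzero K b (TOb K a)) \<in> Tri K"
proof -
  note b = biproductD [OF assms]
  obtain q r where qr: "(i1, q, r) \<in> Tri K"
    using Tri_cone b by blast
  note t = triD [OF qr]
  have "TMor K p1 \<cdot> TMor K i1 \<cdot> r = r"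
    using Comp_reduce [of "TMor K p1" "TMor K i1" "Id K (TOb K a)" r] t b
      TMor_Comp [of i1 p1] by simp
  then have r: "r = mzero K (Cod K q) (TOb K a)"
    using tri_comp_Tuw [OF qr] t b by simp
  obtain h where h: "h \<in> Mor K" "Dom K h = Cod K q" "Cod K h = b" "h \<cdot> q = p2"
    using tri_factor_v [OF qr, of p2] b by auto
  define k where "k = q \<cdot> i2"
  have k: "k \<in> Mor K" "Dom K k = b" "Cod K k = Cod K q"
    using b t k_def by auto
  have hk: "h \<cdot> k = Id K b"
    unfolding k_def using Comp_reduce [OF h(4), of i2] h b t by simp
  have "madd K (q \<cdot> i1 \<cdot> p1) (q \<cdot> i2 \<cdot> p2) = q"
    using biproduct_out [OF assms, of q] t b by simp
  moreover have "q \<cdot> i1 \<cdot> p1 = mzero K c (Cod K q)"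
    using Comp_reduce [OF tri_comp_vu [OF qr], of p1] b t by simp
  ultimately have kp: "q \<cdot> i2 \<cdot> p2 = q"
    using b t by simp
  \<comment> \<open>The difference of the two sides kills \<open>q\<close>, so it factors through
    \<open>r\<close>, which is zero.\<close>
  have "k \<cdot> h = Id K (Cod K q)"
  proof -
    let ?n = "madd K (k \<cdot> h) (mneg K (Id K (Cod K q)))"
    have "?n \<cdot> q = mzero K c (Cod K q)"
      using h k t b kp k_def by simp
    then obtain g where "g \<in> Mor K" "Dom K g = TOb K a" "Cod K g = Cod K q" "g \<cdot> r = ?n"
      using tri_factor_w [OF qr, of ?n] h k t b by auto
    then have "?n = mzero K (Cod K q) (Cod K q)"
      using r t b by simp
    then show ?thesis
      using h k t madd_eq_zero_iff [of "k \<cdot> h" "Id K (Cod K q)"] by simp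
  qed
  then have iso: "is_iso K h (Cod K q) b"
    using h k hk t by (intro is_isoI [of h k]) auto
  show ?thesis
    using tri_cone_iso [OF qr iso, of k] k h r t b \<open>k \<cdot> h = Id K (Cod K q)\<close> by simp
qed

lemma tri_iso_cone:
  assumes "is_iso K f a b" "is_zero_object K z"
  shows "(f, mzero K b z, mzero K z (TOb K a)) \<in> Tri K"
proof -
  have f: "f \<in> Mor K" "Dom K f = a" "Cod K f = b"
    using assms(1) by (auto elim: is_isoE)
  then have "a \<in> Ob K" "b \<in> Ob K" "z \<in> Ob K"
    using assms(2) by (auto simp: zero_object_iff)
  then show ?thesis
    by (intro Tri_iso [OF Tri_trivial [OF \<open>a \<in> Ob K\<close> assms(2)], of a a z _ a b _ z _ "Id K a" f "Id K z"])
      (use f assms is_iso_Id in auto)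
qed

text \<open>The octahedron on \<open>v\<close> and the projection \<open>p1\<close>: a fibre of \<open>v\<close> maps to a fibre of its
  first component with cone \<open>c2\<close>.\<close>

lemma tri_component_fiber:
  assumes tri: "(t, v, w) \<in> Tri K" and bi: "is_biproduct K c1 c2 (Cod K v) i1 i2 p1 p2"
    and fib: "(m, p1 \<cdot> v, n) \<in> Tri K"
  obtains k j where "k \<in> Mor K" "Dom K k = Dom K t" "Cod K k = Dom K m" "m \<cdot> k = t"
    "(k, j, w \<cdot> i2) \<in> Tri K" "n \<cdot> p1 = TMor K k \<cdot> w"
proof -
  note t = triD [OF tri] and b = biproductD [OF bi] and t' = triD [OF fib]
  have "\<exists>f g. f \<in> Hom K (Cod K w) (Cod K n) \<and> g \<in> Hom K (Cod K n) (Cod K (mzero K c1 (TOb K c2))) \<and>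
      f \<cdot> w = n \<cdot> p1 \<and> mneg K (TMor K m) \<cdot> f = mneg K (TMor K t) \<and>
      g \<cdot> n = mzero K c1 (TOb K c2) \<and> mneg K (TMor K i2) \<cdot> g = TMor K v \<cdot> mneg K (TMor K m) \<and>
      (f, g, TMor K w \<cdot> mneg K (TMor K i2)) \<in> Tri K"
    by (rule Tri_octahedron [OF _ _ tri_rotate [OF tri]
          tri_rotate [OF tri_biproduct [OF biproduct_swap [OF bi]]] tri_rotate [OF fib],
          of "Dom K v" "Cod K v" c1])
      (use t b in auto)
  then obtain f g where fg: "f \<in> Mor K" "Dom K f = Cod K w" "Cod K f = Cod K n"
    "g \<in> Mor K" "Dom K g = Cod K n" "Cod K g = TOb K c2"
    "f \<cdot> w = n \<cdot> p1" "mneg K (TMor K m) \<cdot> f = mneg K (TMor K t)"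
    "(f, g, TMor K w \<cdot> mneg K (TMor K i2)) \<in> Tri K"
    using b by auto
  \<comment> \<open>The octahedron was applied to rotated triangles, so its maps live one suspension
    up; full faithfulness brings them back.\<close>
  obtain k where k: "k \<in> Mor K" "Dom K k = Dom K t" "Cod K k = Dom K m" "TMor K k = f"
    using TMor_surj [of f "Dom K t" "Dom K m"] fg t t' by auto
  obtain j where j: "j \<in> Mor K" "Dom K j = Dom K m" "Cod K j = c2" "TMor K j = g"
    using TMor_surj [of g "Dom K m" c2] fg t t' b by auto
  have "TMor K (m \<cdot> k) = TMor K t"
    using fg(1-3,8) k t(1,3,6) t'(1,3,6) by simp
  then have "m \<cdot> k = t"
    using k t t' b by - (rule TMor_inj; simp)
  moreover have "(k, j, w \<cdot> i2) \<in> Tri K"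
    using tri_T_iff [of k j "w \<cdot> i2"] k j fg t t' b by simp
  ultimately show ?thesis
    using that k fg(7) by metis
qed

text \<open>Rotation moves the other two vertices of a triangle into the position of the cone, at
  the price of suspensions to which membership is insensitive.\<close>

lemma triangulated_subcategoryI:
  assumes "P \<subseteq> Ob K" "\<And>z. is_zero_object K z \<Longrightarrow> z \<in> P" "\<And>a. a \<in> Ob K \<Longrightarrow> TOb K a \<in> P \<longleftrightarrow> a \<in> P"
    and cone: "\<And>u v w. (u, v, w) \<in> Tri K \<Longrightarrow> Dom K u \<in> P \<Longrightarrow> Cod K u \<in> P \<Longrightarrow> Cod K v \<in> P"
  shows "triangulated_subcategory K P"
proof -
  have "Dom K u \<in> P" if t: "(u, v, w) \<in> Tri K" and P: "Cod K u \<in> P" "Cod K v \<in> P" for u v w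
    using cone [OF tri_rotate [OF t]] triD [OF t] P assms(3) [of "Dom K u"] by simp
  moreover have "Cod K u \<in> P" if t: "(u, v, w) \<in> Tri K" and P: "Dom K u \<in> P" "Cod K v \<in> P" for u v w
    using cone [OF tri_rotate [OF tri_rotate [OF t]]] triD [OF t] P assms(3) [of "Dom K u"]
      assms(3) [of "Cod K u"] by simp
  ultimately show ?thesis
    unfolding triangulated_subcategory_def using assms by blast
qed

text \<open>If \<open>u1\<close> is a retract of \<open>u\<close> in the category of arrows, its
  cone is a retract of the cone of \<open>u\<close>. The induced maps compose to an endomorphism
  that fixes \<open>v1\<close> and \<open>w1\<close> but need not be the identity; multiplying the
  retraction by the inverse of that endomorphism repairs this.\<close>

lemma tri_retract:
  assumes tri: "(u, v, w) \<in> Tri K" and tri1: "(u1, v1, w1) \<in> Tri K"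
    and i: "i \<in> Mor K" "Dom K i = Dom K u1" "Cod K i = Dom K u"
    and p: "p \<in> Mor K" "Dom K p = Dom K u" "Cod K p = Dom K u1"
    and j: "j \<in> Mor K" "Dom K j = Dom K v1" "Cod K j = Dom K v"
    and q: "q \<in> Mor K" "Dom K q = Dom K v" "Cod K q = Dom K v1"
    and id: "p \<cdot> i = Id K (Dom K u1)" "q \<cdot> j = Id K (Dom K v1)"
    and comm: "u \<cdot> i = j \<cdot> u1" "u1 \<cdot> p = q \<cdot> u"
  obtains z y where "z \<in> Mor K" "Dom K z = Cod K v1" "Cod K z = Cod K v"
    "y \<in> Mor K" "Dom K y = Cod K v" "Cod K y = Cod K v1"
    "y \<cdot> z = Id K (Cod K v1)" "z \<cdot> v1 = v \<cdot> j" "w \<cdot> z = TMor K i \<cdot> w1" "y \<cdot> v = v1 \<cdot> q" "w1 \<cdot> y = TMor K p \<cdot> w"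
proof -
  note t = triD [OF tri] and t1 = triD [OF tri1]
  obtain z where z: "z \<in> Mor K" "Dom K z = Cod K v1" "Cod K z = Cod K v" "z \<cdot> v1 = v \<cdot> j"
    "w \<cdot> z = TMor K i \<cdot> w1"
    using tri_mor_extend [OF tri1 tri i(1) j(1) i(2,3) _ _ comm(1)] j t t1 by metis
  obtain y where y: "y \<in> Mor K" "Dom K y = Cod K v" "Cod K y = Cod K v1" "y \<cdot> v = v1 \<cdot> q"
    "w1 \<cdot> y = TMor K p \<cdot> w"
    using tri_mor_extend [OF tri tri1 p(1) q(1) p(2,3) _ _ comm(2)] q t t1 by metis
  have "(y \<cdot> z) \<cdot> v1 = y \<cdot> v \<cdot> j"
    using y(1-3) z t1 by simp
  also have "\<dots> = v1"
    using Comp_square [OF y(4), of j] y(1-3) t t1 j q id(2) by simp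
  finally have 1: "(y \<cdot> z) \<cdot> v1 = v1" .
  have "w1 \<cdot> y \<cdot> z = TMor K p \<cdot> w \<cdot> z"
    using Comp_square [OF y(5), of z] y(1-3) z(1-3) t t1 p by simp
  also have "\<dots> = TMor K (p \<cdot> i) \<cdot> w1"
    unfolding z(5) using t1 p i by simp
  also have "\<dots> = w1"
    unfolding id using t1 by simp
  finally have 2: "w1 \<cdot> y \<cdot> z = w1" .
  obtain e where e: "e \<in> Mor K" "Dom K e = Cod K v1" "Cod K e = Cod K v1"
    "e \<cdot> y \<cdot> z = Id K (Cod K v1)" "e \<cdot> v1 = v1" "w1 \<cdot> e = w1"
    using tri_endo_inverse [OF tri1 _ _ _ 1 2] y(1-3) z(1-3) by auto
  have "(e \<cdot> y) \<cdot> v = v1 \<cdot> q"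
    using e y(1-4) t t1 q Comp_reduce [OF e(5), of q] by simp
  moreover have "w1 \<cdot> e \<cdot> y = TMor K p \<cdot> w"
    using y(5) Comp_reduce [OF e(6), of y] e(1-3) y(1-3) t1 by simp
  ultimately show ?thesis
    using that [OF z(1-3), of "e \<cdot> y"] e(1-4) y(1-3) z by simp
qed

end

section \<open>Verdier quotients\<close>

lemma comm_group_homI:
  "h \<in> hom G H \<Longrightarrow> comm_group G \<Longrightarrow> comm_group H \<Longrightarrow> group_hom G H h"
  by (simp add: group_hom_def group_hom_axioms_def comm_group.axioms(2))

locale verdier = triangulated_category K
  for K :: "('o, 'm, 'z) triangulated_scheme" (structure) +
  fixes J :: "'o set"
  assumes J_sub: "triangulated_subcategory K J"
begin

lemma J_Ob: "a \<in> J \<Longrightarrow> a \<in> Ob K"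
  and J_zero: "is_zero_object K z \<Longrightarrow> z \<in> J"
  and J_T: "a \<in> Ob K \<Longrightarrow> TOb K a \<in> J \<longleftrightarrow> a \<in> J"
  using J_sub unfolding triangulated_subcategory_def by blast+

lemma J_tri:
  assumes "(u, v, w) \<in> Tri K"
  shows "Dom K u \<in> J \<Longrightarrow> Cod K u \<in> J \<Longrightarrow> Cod K v \<in> J"
    "Cod K u \<in> J \<Longrightarrow> Cod K v \<in> J \<Longrightarrow> Dom K u \<in> J"
    "Dom K u \<in> J \<Longrightarrow> Cod K v \<in> J \<Longrightarrow> Cod K u \<in> J"
  using J_sub assms unfolding triangulated_subcategory_def by blast+

lemma J_iso:
  assumes "is_iso K f a b" "a \<in> J"
  shows "b \<in> J"
proof -
  obtain z where z: "is_zero_object K z"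
    using zero_object by blast
  have "f \<in> Mor K" "Dom K f = a" "Cod K f = b"
    using assms(1) by (auto elim: is_isoE)
  moreover have "z \<in> Ob K"
    using z by (simp add: zero_object_iff)
  ultimately show ?thesis
    using J_tri(3) [OF tri_iso_cone [OF assms(1) z]] J_zero [OF z] assms(2) by auto
qed

text \<open>Only the isomorphism class of an object of \<open>J\<close> is a suspension, hence the
  explicit mutually inverse maps \<open>e\<close> and \<open>e'\<close>.\<close>

lemma J_desuspend:
  assumes "c \<in> J"
  obtains y e e' where "y \<in> J" "e \<in> Mor K" "e' \<in> Mor K" "Dom K e = TOb K y" "Cod K e = c"
    "Dom K e' = c" "Cod K e' = TOb K y" "e' \<cdot> e = Id K (TOb K y)" "e \<cdot> e' = Id K c"
proof -
  obtain y e where y: "y \<in> Ob K" "is_iso K e (TOb K y) c"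
    using T_essentially_surjective J_Ob [OF assms] by blast
  then obtain e' where e: "e \<in> Mor K" "e' \<in> Mor K" "Dom K e = TOb K y" "Cod K e = c"
    "Dom K e' = c" "Cod K e' = TOb K y" "e' \<cdot> e = Id K (TOb K y)" "e \<cdot> e' = Id K c"
    by (auto elim: is_isoE)
  have "y \<in> J"
    using J_iso [OF is_isoI [OF e(2,1,5,6,3,4,8,7)] assms] J_T [OF y(1)] by simp
  then show ?thesis
    using that e by blast
qed

lemma J_biproduct:
  assumes "is_biproduct K a b c i1 i2 p1 p2" "a \<in> J" "b \<in> J"
  shows "c \<in> J"
  using J_tri(3) [OF tri_biproduct [OF assms(1)]] biproductD [OF assms(1)] assms by auto

section \<open>Denominators, and the morphisms that they annihilate\<close>

abbreviation W :: "'m set"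
  where "W \<equiv> cone_in K J"

lemma W_Mor [simp]: "s \<in> W \<Longrightarrow> s \<in> Mor K"
  by (simp add: cone_in_def)

lemma W_I: "(s, v, w) \<in> Tri K \<Longrightarrow> Cod K v \<in> J \<Longrightarrow> s \<in> W"
  using triD unfolding cone_in_def by blast

text \<open>\<open>cone_in\<close> asks for some cone in \<open>J\<close>; uniqueness of cones up to
  isomorphism upgrades this to every cone.\<close>

lemma W_tri:
  assumes "s \<in> W" "(s, v, w) \<in> Tri K"
  shows "Cod K v \<in> J"
proof -
  obtain v' w' where vw: "(s, v', w') \<in> Tri K" "Cod K v' \<in> J"
    using assms(1) unfolding cone_in_def by auto
  then obtain z where "is_iso K z (Cod K v') (Cod K v)"
    using tri_cone_unique [OF vw(1) assms(2)] by metis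
  then show ?thesis
    using J_iso vw(2) by blast
qed

lemma W_fiber:
  assumes "(d, s, n) \<in> Tri K"
  shows "s \<in> W \<longleftrightarrow> Dom K d \<in> J"
proof -
  have "s \<in> W \<longleftrightarrow> Cod K n \<in> J"
    using W_I [OF tri_rotate [OF assms]] W_tri [OF _ tri_rotate [OF assms]] by blast
  then show ?thesis
    using triD [OF assms] J_T [of "Dom K d"] by auto
qed

lemma W_iso: "is_iso K f a b \<Longrightarrow> f \<in> W"
proof -
  assume f: "is_iso K f a b"
  obtain z where z: "is_zero_object K z"
    using zero_object by blast
  have "b \<in> Ob K" "z \<in> Ob K"
    using f z by (auto elim!: is_isoE simp: zero_object_iff)
  then show ?thesis
    using W_I [OF tri_iso_cone [OF f z]] J_zero [OF z] by simp
qed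

lemma W_Id [simp]: "a \<in> Ob K \<Longrightarrow> Id K a \<in> W"
  using W_iso is_iso_Id by blast

text \<open>By the octahedron the cones of \<open>p\<close>, \<open>t \<cdot> p\<close> and
  \<open>t\<close> form a triangle, and the last one lies in \<open>J\<close>.\<close>

lemma W_Comp_iff:
  assumes "t \<in> W" "p \<in> Mor K" "Cod K p = Dom K t"
  shows "t \<cdot> p \<in> W \<longleftrightarrow> p \<in> W"
proof -
  have "p \<in> Mor K" "t \<in> Mor K" "t \<cdot> p \<in> Mor K"
    using assms by auto
  then obtain j k l i m n where
    tri: "(p, j, k) \<in> Tri K" "(t, l, i) \<in> Tri K" "(t \<cdot> p, m, n) \<in> Tri K"
    using Tri_cone by meson
  obtain f g where fg: "(f, g, TMor K j \<cdot> i) \<in> Tri K" "f \<in> Hom K (Cod K j) (Cod K m)"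
    "g \<in> Hom K (Cod K m) (Cod K l)"
    using Tri_octahedron [OF _ _ tri, of "Dom K p" "Dom K t" "Cod K t"] assms by auto
  have "Cod K l \<in> J"
    using W_tri [OF assms(1) tri(2)] .
  then have "Cod K m \<in> J \<longleftrightarrow> Cod K j \<in> J"
    using J_tri(2,3) [OF fg(1)] fg(2,3) by auto
  then show ?thesis
    using W_I W_tri tri by blast
qed

lemma W_Comp: "t \<in> W \<Longrightarrow> p \<in> W \<Longrightarrow> Cod K p = Dom K t \<Longrightarrow> t \<cdot> p \<in> W"
  using W_Comp_iff by simp

text \<open>A homotopy pullback: \<open>t\<close> is a fibre of the composite of \<open>f\<close>
  with the map to the cone of \<open>s\<close>. Its own cone is thus the cone of \<open>s\<close>,
  and \<open>f \<cdot> t\<close> lifts along \<open>s\<close> because it dies in that cone.\<close>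

lemma W_ore:
  assumes "s \<in> W" "f \<in> Mor K" "Cod K f = Cod K s"
  obtains t g where "t \<in> W" "g \<in> Mor K" "Cod K t = Dom K f" "Dom K t = Dom K g" "Cod K g = Dom K s"
    "s \<cdot> g = f \<cdot> t"
proof -
  obtain v w where vw: "(s, v, w) \<in> Tri K"
    using assms(1) Tri_cone by (metis W_Mor)
  note t = triD [OF vw]
  have vf: "v \<cdot> f \<in> Mor K"
    using t assms by simp
  then obtain m n where mn: "(m, v \<cdot> f, n) \<in> Tri K"
    by (rule tri_fiber)
  note t' = triD [OF mn]
  have "Cod K (v \<cdot> f) \<in> J"
    using W_tri [OF assms(1) vw] t assms by simp
  then have "m \<in> W"
    using W_I mn by blast
  have "v \<cdot> f \<cdot> m = mzero K (Dom K (f \<cdot> m)) (Cod K v)"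
    using tri_comp_vu [OF mn] t t' assms by simp
  then obtain g where "g \<in> Mor K" "Dom K g = Dom K (f \<cdot> m)" "Cod K g = Dom K s" "s \<cdot> g = f \<cdot> m"
    using tri_lift_u [OF vw, of "f \<cdot> m"] t t' assms by auto
  then show ?thesis
    using that \<open>m \<in> W\<close> t t' assms by simp
qed

text \<open>These are the morphisms that become zero in the quotient. The factorisation is the form
  produced by triangles, while annihilation by a denominator, as in \<open>null_iff\<close>, is the
  form that fractions use.\<close>

definition null :: "'m \<Rightarrow> bool"
  where "null f \<longleftrightarrow> (\<exists>g\<in>Mor K. \<exists>h\<in>Mor K. Cod K g = Dom K h \<and> Cod K g \<in> J \<and> f = h \<cdot> g)"

text \<open>If \<open>f\<close> factors through \<open>g\<close> with target in \<open>J\<close>, a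
  fibre of \<open>g\<close> is an annihilating denominator; conversely \<open>f\<close> factors
  through the cone of any denominator that it kills.\<close>

lemma null_iff:
  assumes "f \<in> Mor K"
  shows "null f \<longleftrightarrow> (\<exists>l\<in>W. Cod K l = Dom K f \<and> f \<cdot> l = mzero K (Dom K l) (Cod K f))"
proof
  assume "null f"
  then obtain g h where gh: "g \<in> Mor K" "h \<in> Mor K" "Cod K g = Dom K h" "Cod K g \<in> J" "f = h \<cdot> g"
    by (auto simp: null_def)
  obtain l n where l: "(l, g, n) \<in> Tri K"
    using tri_fiber [OF gh(1)] .
  note t = triD [OF l]
  have "f \<cdot> l = mzero K (Dom K l) (Cod K f)"
    using gh t tri_comp_vu [OF l] by simp
  moreover have "l \<in> W"
    using W_I [OF l] gh by simp
  ultimately show "\<exists>l\<in>W. Cod K l = Dom K f \<and> f \<cdot> l = mzero K (Dom K l) (Cod K f)"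
    using t gh by auto
next
  assume "\<exists>l\<in>W. Cod K l = Dom K f \<and> f \<cdot> l = mzero K (Dom K l) (Cod K f)"
  then obtain l where l: "l \<in> W" "Cod K l = Dom K f" "f \<cdot> l = mzero K (Dom K l) (Cod K f)"
    by blast
  obtain v w where vw: "(l, v, w) \<in> Tri K"
    using l Tri_cone by (metis W_Mor)
  obtain h where "h \<in> Mor K" "Dom K h = Cod K v" "Cod K h = Cod K f" "h \<cdot> v = f"
    using tri_factor_v [OF vw assms] l by auto
  then show "null f"
    unfolding null_def using W_tri [OF l(1) vw] triD [OF vw] by metis
qed

lemma null_Comp_left: "null f \<Longrightarrow> f \<in> Mor K \<Longrightarrow> g \<in> Mor K \<Longrightarrow> Cod K f = Dom K g \<Longrightarrow> null (g \<cdot> f)"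
  unfolding null_def by (metis Comp_assoc_simp Comp_simps)

lemma null_Comp_right: "null f \<Longrightarrow> f \<in> Mor K \<Longrightarrow> g \<in> Mor K \<Longrightarrow> Cod K g = Dom K f \<Longrightarrow> null (f \<cdot> g)"
  unfolding null_def by (metis Comp_assoc_simp Comp_simps)

lemma null_through: "a \<in> J \<Longrightarrow> f \<in> Mor K \<Longrightarrow> g \<in> Mor K \<Longrightarrow> Cod K f = a \<Longrightarrow> Dom K g = a \<Longrightarrow> null (g \<cdot> f)"
  unfolding null_def by (intro bexI [of _ f] bexI [of _ g]) auto

lemma null_madd:
  assumes "null f" "null g" "f \<in> Mor K" "g \<in> Mor K" "Dom K f = Dom K g" "Cod K f = Cod K g"
  shows "null (madd K f g)"
proof -
  obtain l where l: "l \<in> W" "Cod K l = Dom K f" "f \<cdot> l = mzero K (Dom K l) (Cod K f)"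
    using assms null_iff by blast
  obtain m where m: "m \<in> W" "Cod K m = Dom K g" "g \<cdot> m = mzero K (Dom K m) (Cod K g)"
    using assms null_iff by blast
  obtain n p where np: "n \<in> W" "p \<in> Mor K" "Cod K n = Dom K m" "Dom K n = Dom K p" "Cod K p = Dom K l"
    "l \<cdot> p = m \<cdot> n"
    using W_ore [OF l(1), of m] l m assms by auto
  have "f \<cdot> m \<cdot> n = mzero K (Dom K n) (Cod K g)"
    unfolding np(6) [symmetric] using Comp_reduce [OF l(3), of p] l(1,2) np(1-5) m(2) assms(3-6) by simp
  moreover have "g \<cdot> m \<cdot> n = mzero K (Dom K n) (Cod K g)"
    using Comp_reduce [OF m(3), of n] m np assms by simp
  ultimately have "madd K f g \<cdot> m \<cdot> n = mzero K (Dom K n) (Cod K g)"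
    using m np assms by simp
  moreover have "m \<cdot> n \<in> W"
    using W_Comp m np by simp
  ultimately show ?thesis
    using m np assms by (subst null_iff) (auto intro!: bexI [of _ "m \<cdot> n"])
qed

lemma null_mneg: "null f \<Longrightarrow> f \<in> Mor K \<Longrightarrow> null (mneg K f)"
  unfolding null_def by (metis mneg_Comp(1) mneg_simps(1,2))

lemma null_Comp_W_iff:
  assumes "m \<in> W" "f \<in> Mor K" "Cod K m = Dom K f"
  shows "null (f \<cdot> m) \<longleftrightarrow> null f"
proof
  assume "null (f \<cdot> m)"
  then obtain l where l: "l \<in> W" "Cod K l = Dom K m" "(f \<cdot> m) \<cdot> l = mzero K (Dom K l) (Cod K f)"
    using null_iff [of "f \<cdot> m"] assms by auto
  have "m \<cdot> l \<in> W"
    using W_Comp assms l by simp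
  then show "null f"
    using l assms by (subst null_iff) (auto intro!: bexI [of _ "m \<cdot> l"])
qed (use null_Comp_right assms in auto)

text \<open>Denominators are left cancellable up to null morphisms: \<open>f\<close> lifts to the
  fibre of \<open>t\<close>, which belongs to \<open>J\<close>.\<close>

lemma W_Comp_zero_null:
  assumes "t \<in> W" "f \<in> Mor K" "Cod K f = Dom K t" "t \<cdot> f = mzero K (Dom K f) (Cod K t)"
  shows "null f"
proof -
  obtain d n where d: "(d, t, n) \<in> Tri K"
    using tri_fiber assms(1) W_Mor by blast
  note t = triD [OF d]
  obtain g where g: "g \<in> Mor K" "Dom K g = Dom K f" "Cod K g = Dom K d" "d \<cdot> g = f"
    using tri_lift_u [OF d assms(2)] assms t by auto
  have "Dom K d \<in> J"
    using W_fiber [OF d] assms(1) by simp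
  then have "null (d \<cdot> g)"
    using g t by (intro null_through) auto
  then show ?thesis
    using g by simp
qed

section \<open>Equality of fractions\<close>

definition frac :: "'o \<Rightarrow> 'o \<Rightarrow> 'm \<Rightarrow> 'm \<Rightarrow> bool"
  where "frac a b s f \<longleftrightarrow> s \<in> W \<and> f \<in> Mor K \<and> Dom K s = Dom K f \<and> Cod K s = a \<and> Cod K f = b"

lemma fracD:
  assumes "frac a b s f"
  shows "s \<in> W" "s \<in> Mor K" "f \<in> Mor K" "Dom K s = Dom K f" "Cod K s = a" "Cod K f = b" "a \<in> Ob K" "b \<in> Ob K"
  using assms by (auto simp: frac_def)

abbreviation R :: "(('m \<times> 'm) \<times> ('m \<times> 'm)) set"
  where "R \<equiv> fraction_rel K J"

lemma R_iff:
  "((s, f), (t, g)) \<in> R \<longleftrightarrow> (\<exists>a b. frac a b s f \<and> frac a b t g \<and>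
    (\<exists>p q. p \<in> Mor K \<and> q \<in> Mor K \<and> Dom K p = Dom K q \<and> Cod K p = Dom K s \<and> Cod K q = Dom K t \<and>
      s \<cdot> p = t \<cdot> q \<and> f \<cdot> p = g \<cdot> q \<and> s \<cdot> p \<in> W))"
  by (auto simp: fraction_rel_def fractions_def frac_def)

lemma common_multiple:
  assumes "s \<in> W" "t \<in> W" "Cod K s = Cod K t"
  obtains p q where "p \<in> Mor K" "q \<in> Mor K" "Dom K p = Dom K q" "Cod K p = Dom K s" "Cod K q = Dom K t"
    "s \<cdot> p = t \<cdot> q" "s \<cdot> p \<in> W" "q \<in> W"
proof -
  obtain q p where qp: "q \<in> W" "p \<in> Mor K" "Cod K q = Dom K t" "Dom K q = Dom K p" "Cod K p = Dom K s"
    "s \<cdot> p = t \<cdot> q"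
    using W_ore [OF assms(1), of t] assms by auto
  moreover have "t \<cdot> q \<in> W"
    using W_Comp [OF assms(2) qp(1)] qp by simp
  ultimately show ?thesis
    by (intro that [of p q]) simp_all
qed

text \<open>The relation asks for some amplification on which the numerators coincide. Here it is
  tested on any prescribed common denominator, where coincidence is weakened to a null difference;
  transitivity and addition of fractions rest on this.\<close>

lemma R_null_iff:
  assumes s: "frac a b s f" and t: "frac a b t g"
    and p: "p \<in> Mor K" "q \<in> Mor K" "Dom K p = Dom K q" "Cod K p = Dom K s" "Cod K q = Dom K t"
      "s \<cdot> p = t \<cdot> q" "s \<cdot> p \<in> W"
  shows "((s, f), (t, g)) \<in> R \<longleftrightarrow> null (madd K (f \<cdot> p) (mneg K (g \<cdot> q)))"
proof
  note s' = fracD [OF s] and t' = fracD [OF t]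
  assume "((s, f), (t, g)) \<in> R"
  then obtain p' q' where p': "p' \<in> Mor K" "q' \<in> Mor K" "Dom K p' = Dom K q'" "Cod K p' = Dom K s"
    "Cod K q' = Dom K t" "s \<cdot> p' = t \<cdot> q'" "f \<cdot> p' = g \<cdot> q'" "s \<cdot> p' \<in> W"
    by (auto simp: R_iff)
  have "Cod K (s \<cdot> p') = Cod K (s \<cdot> p)"
    using s'(2) p'(1,4) p(1,4) by simp
  then obtain n m where nm: "n \<in> Mor K" "m \<in> Mor K" "Dom K n = Dom K m" "Cod K n = Dom K p'"
    "Cod K m = Dom K p" "(s \<cdot> p') \<cdot> n = (s \<cdot> p) \<cdot> m" "m \<in> W"
    using common_multiple [OF p'(8) p(7)] s' p' p Comp_simps(2) by (metis (no_types, lifting))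
  \<comment> \<open>The two amplifications are compared over a third one. The differences
    \<open>?x\<close> and \<open>?y\<close> are killed by the denominators \<open>s\<close> and
    \<open>t\<close>, so they are null, and they remain null after composition with the
    numerators.\<close>
  let ?x = "madd K (p \<cdot> m) (mneg K (p' \<cdot> n))" and ?y = "madd K (q \<cdot> m) (mneg K (q' \<cdot> n))"
  have "s \<cdot> p' \<cdot> n = s \<cdot> p \<cdot> m"
    using nm s'(2) p(1-4) p'(1-4) by simp
  moreover have "t \<cdot> q' \<cdot> n = s \<cdot> p' \<cdot> n" "t \<cdot> q \<cdot> m = s \<cdot> p \<cdot> m"
    using Comp_square [OF p(6), of m] Comp_square [OF p'(6), of n] s' t' p p' nm by simp_all
  ultimately have "s \<cdot> ?x = mzero K (Dom K n) a" "t \<cdot> ?y = mzero K (Dom K n) a"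
    using s' t' p(1-5) p'(1-5) nm(1-5) by simp_all
  then have "null ?x" "null ?y"
    using W_Comp_zero_null [OF s'(1), of ?x] W_Comp_zero_null [OF t'(1), of ?y]
      s' t' p(1-5) p'(1-5) nm(1-5) by (simp_all del: Comp_distrib_left)
  then have "null (f \<cdot> ?x)" "null (g \<cdot> ?y)"
    using null_Comp_left [of ?x f] null_Comp_left [of ?y g] s' t' p(1-5) p'(1-5) nm(1-5)
    by (simp_all del: Comp_distrib_left)
  then have "null (madd K (f \<cdot> ?x) (mneg K (g \<cdot> ?y)))"
    using s' t' p(1-5) p'(1-5) nm(1-5) null_mneg [of "g \<cdot> ?y"]
    by (intro null_madd) (simp_all del: Comp_distrib_left)
  moreover have "f \<cdot> p' \<cdot> n = g \<cdot> q' \<cdot> n"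
    using Comp_square [OF p'(7), of n] s' t' p'(1-5) nm(1-5) by simp
  then have "madd K (f \<cdot> ?x) (mneg K (g \<cdot> ?y)) = madd K (f \<cdot> p) (mneg K (g \<cdot> q)) \<cdot> m"
    using s' t' p(1-5) p'(1-5) nm(1-5) by (simp add: madd_ac)
  ultimately have "null (madd K (f \<cdot> p) (mneg K (g \<cdot> q)) \<cdot> m)"
    by simp
  then show "null (madd K (f \<cdot> p) (mneg K (g \<cdot> q)))"
    using s' t' p(1-5) nm(1-5,7) by (subst (asm) null_Comp_W_iff) simp_all
next
  note s' = fracD [OF s] and t' = fracD [OF t]
  assume "null (madd K (f \<cdot> p) (mneg K (g \<cdot> q)))"
  then obtain l where l: "l \<in> W" "Cod K l = Dom K q"
    "madd K (f \<cdot> p) (mneg K (g \<cdot> q)) \<cdot> l = mzero K (Dom K l) b"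
    using null_iff [of "madd K (f \<cdot> p) (mneg K (g \<cdot> q))"] s' t' p by auto
  then have "f \<cdot> p \<cdot> l = g \<cdot> q \<cdot> l"
    using madd_eq_zero_iff [of "f \<cdot> p \<cdot> l" "g \<cdot> q \<cdot> l"] s' t' p(1-5) by simp
  moreover have "s \<cdot> p \<cdot> l = t \<cdot> q \<cdot> l"
    using Comp_square [OF p(6), of l] s' t' p(1-5) l by simp
  moreover have "s \<cdot> p \<cdot> l \<in> W"
    using W_Comp [OF p(7) l(1)] s' p(1-5) l by simp
  ultimately show "((s, f), (t, g)) \<in> R"
    unfolding R_iff using s t s' t' p(1-5) l(1,2)
    by (intro exI [of _ a] exI [of _ b] conjI exI [of _ "p \<cdot> l"] exI [of _ "q \<cdot> l"]) auto
qed

lemma R_same_denominator: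
  assumes "frac a b s f" "frac a b s g"
  shows "((s, f), (s, g)) \<in> R \<longleftrightarrow> null (madd K f (mneg K g))"
  using R_null_iff [OF assms, of "Id K (Dom K s)" "Id K (Dom K s)"] fracD [OF assms(1)]
    fracD [OF assms(2)] by simp

lemma R_amplify:
  assumes "frac a b s f" "p \<in> Mor K" "Cod K p = Dom K s" "s \<cdot> p \<in> W"
  shows "((s \<cdot> p, f \<cdot> p), (s, f)) \<in> R" "frac a b (s \<cdot> p) (f \<cdot> p)"
proof -
  note s' = fracD [OF assms(1)]
  show fr: "frac a b (s \<cdot> p) (f \<cdot> p)"
    using s' assms by (simp add: frac_def)
  show "((s \<cdot> p, f \<cdot> p), (s, f)) \<in> R"
    unfolding R_iff using s' assms fr
    by (intro exI [of _ a] exI [of _ b] conjI exI [of _ "Id K (Dom K p)"] exI [of _ p]) auto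
qed

lemma R_refl: "frac a b s f \<Longrightarrow> ((s, f), (s, f)) \<in> R"
  using R_amplify(1) [of a b s f "Id K (Dom K s)"] fracD [of a b s f] by simp

lemma R_sym: "(x, y) \<in> R \<Longrightarrow> (y, x) \<in> R"
proof -
  assume *: "(x, y) \<in> R"
  obtain s f t g where xy: "x = (s, f)" "y = (t, g)"
    by (cases x, cases y)
  show ?thesis
    using * unfolding xy R_iff by metis
qed

text \<open>Over a common denominator of all three fractions, transitivity is the closure of null
  morphisms under addition.\<close>

lemma R_trans:
  assumes "(x, y) \<in> R" "(y, z) \<in> R"
  shows "(x, z) \<in> R"
proof -
  obtain s f t g u h where xyz: "x = (s, f)" "y = (t, g)" "z = (u, h)"
    by (cases x, cases y, cases z)
  have 1: "((s, f), (t, g)) \<in> R" and 2: "((t, g), (u, h)) \<in> R"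
    using assms xyz by auto
  obtain a b where fr: "frac a b s f" "frac a b t g"
    using 1 unfolding R_iff by blast
  have fr': "frac a b u h"
    using 2 fr(2) unfolding R_iff frac_def by auto
  note s' = fracD [OF fr(1)] and t' = fracD [OF fr(2)] and u' = fracD [OF fr']
  obtain p q where p: "p \<in> Mor K" "q \<in> Mor K" "Dom K p = Dom K q" "Cod K p = Dom K s" "Cod K q = Dom K t"
    "s \<cdot> p = t \<cdot> q" "s \<cdot> p \<in> W"
    using common_multiple [OF s'(1) t'(1)] s'(5) t'(5) by metis
  obtain m n where m: "m \<in> Mor K" "n \<in> Mor K" "Dom K m = Dom K n" "Cod K m = Dom K (s \<cdot> p)"
    "Cod K n = Dom K u" "(s \<cdot> p) \<cdot> m = u \<cdot> n" "(s \<cdot> p) \<cdot> m \<in> W"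
    using common_multiple [OF p(7) u'(1)] s'(2,5) u'(5) p(1,4) Comp_simps(3) by metis
  have spm: "s \<cdot> p \<cdot> m = u \<cdot> n" "s \<cdot> p \<cdot> m \<in> W" and m': "Cod K m = Dom K q"
    using m p(1-5) s' by simp_all
  have tqm: "t \<cdot> q \<cdot> m = u \<cdot> n"
    using Comp_square [OF p(6), of m] p(1-5) s'(2) t'(2) m(1) m' spm(1) by simp
  have "null (madd K (f \<cdot> p \<cdot> m) (mneg K (g \<cdot> q \<cdot> m)))"
    using R_null_iff [OF fr, of "p \<cdot> m" "q \<cdot> m"] 1 p(1-5) m(1-3) m' s' t' spm tqm by simp
  moreover have "null (madd K (g \<cdot> q \<cdot> m) (mneg K (h \<cdot> n)))"
    using R_null_iff [OF fr(2) fr', of "q \<cdot> m" n] 2 p(1-5) m(1-3,5) m' t' u' spm tqm by simp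
  ultimately have "null (madd K (madd K (f \<cdot> p \<cdot> m) (mneg K (g \<cdot> q \<cdot> m)))
      (madd K (g \<cdot> q \<cdot> m) (mneg K (h \<cdot> n))))"
    using p(1-5) m(1-3,5) m' s' t' u' by - (rule null_madd; simp)
  then have "null (madd K (f \<cdot> p \<cdot> m) (mneg K (h \<cdot> n)))"
    using p(1-5) m(1-3,5) m' s' t' u' by (simp add: madd_assoc)
  then have "((s, f), (u, h)) \<in> R"
    using R_null_iff [OF fr(1) fr', of "p \<cdot> m" n] p(1-5) m(1-3,5) m' s' u' spm by simp
  then show ?thesis
    using xyz by simp
qed

definition cls :: "'m \<Rightarrow> 'm \<Rightarrow> ('m \<times> 'm) set"
  where "cls s f = R `` {(s, f)}"

lemma cls_eq_iff:
  assumes "frac a b s f"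
  shows "cls s f = cls t g \<longleftrightarrow> ((s, f), (t, g)) \<in> R"
proof
  assume "cls s f = cls t g"
  then have "(s, f) \<in> cls t g"
    using R_refl [OF assms] unfolding cls_def by blast
  then show "((s, f), (t, g)) \<in> R"
    using R_sym unfolding cls_def by blast
next
  assume *: "((s, f), (t, g)) \<in> R"
  show "cls s f = cls t g"
    unfolding cls_def using R_trans [OF *] R_trans [OF R_sym [OF *]] by blast
qed

lemma cls_same_denominator:
  "frac a b s f \<Longrightarrow> frac a b s g \<Longrightarrow> cls s f = cls s g \<longleftrightarrow> null (madd K f (mneg K g))"
  using cls_eq_iff R_same_denominator by blast

lemma cls_amplify:
  "frac a b s f \<Longrightarrow> p \<in> Mor K \<Longrightarrow> Cod K p = Dom K s \<Longrightarrow> s \<cdot> p \<in> W \<Longrightarrow> cls (s \<cdot> p) (f \<cdot> p) = cls s f"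
  using cls_eq_iff R_amplify by blast

lemma cls_self: "frac a b s f \<Longrightarrow> (s, f) \<in> cls s f"
  unfolding cls_def using R_refl by blast

lemma mem_cls_iff: "frac a b s f \<Longrightarrow> (t, g) \<in> cls s f \<longleftrightarrow> frac a b t g \<and> cls t g = cls s f"
proof
  assume f: "frac a b s f" and m: "(t, g) \<in> cls s f"
  then obtain a' b' where "frac a' b' s f" "frac a' b' t g"
    unfolding cls_def by (auto simp: R_iff)
  then have "frac a b t g"
    using f unfolding frac_def by auto
  then show "frac a b t g \<and> cls t g = cls s f"
    using cls_eq_iff [OF f, of t g] m unfolding cls_def by blast
qed (use cls_self in blast)

section \<open>Morphism groups of the quotient\<close>

abbreviation Q :: "('o, ('m \<times> 'm) set) preadditive"
  where "Q \<equiv> verdier_quotient K J"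

lemma Dom_cls: "frac a b s f \<Longrightarrow> Dom Q (cls s f) = a"
  and Cod_cls: "frac a b s f \<Longrightarrow> Cod Q (cls s f) = b"
proof -
  assume f: "frac a b s f"
  have *: "Cod K t = a \<and> Cod K g = b" if "(t, g) \<in> cls s f" for t g
    using that mem_cls_iff [OF f, of t g] fracD(5,6) [of a b t g] by blast
  have "(THE a'. \<exists>(t, g)\<in>cls s f. a' = Cod K t) = a"
    by (rule the_equality) (use * cls_self [OF f] in force)+
  then show "Dom Q (cls s f) = a"
    by (simp add: verdier_quotient_def)
next
  assume f: "frac a b s f"
  have *: "Cod K t = a \<and> Cod K g = b" if "(t, g) \<in> cls s f" for t g
    using that mem_cls_iff [OF f, of t g] fracD(5,6) [of a b t g] by blast
  have "(THE b'. \<exists>(t, g)\<in>cls s f. b' = Cod K g) = b"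
    by (rule the_equality) (use * cls_self [OF f] in force)+
  then show "Cod Q (cls s f) = b"
    by (simp add: verdier_quotient_def)
qed

lemma Hom_Q: "Hom Q a b = {cls s f | s f. frac a b s f}"
proof (intro equalityI subsetI)
  fix X assume "X \<in> Hom Q a b"
  then have X: "X \<in> fractions K J // R" "Dom Q X = a" "Cod Q X = b"
    by (auto simp: Hom_def verdier_quotient_def)
  then obtain s f where "(s, f) \<in> fractions K J" "X = cls s f"
    unfolding quotient_def cls_def by auto
  moreover from this have f: "frac (Cod K s) (Cod K f) s f"
    by (auto simp: fractions_def frac_def)
  ultimately have "Cod K s = a" "Cod K f = b"
    using X(2,3) Dom_cls [OF f] Cod_cls [OF f] by simp_all
  then show "X \<in> {cls s f | s f. frac a b s f}"
    using f \<open>X = cls s f\<close> by auto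
next
  fix X assume "X \<in> {cls s f | s f. frac a b s f}"
  then obtain s f where X: "X = cls s f" "frac a b s f"
    by auto
  then have "X \<in> fractions K J // R"
    unfolding quotient_def cls_def by (auto simp: fractions_def frac_def)
  then show "X \<in> Hom Q a b"
    using X Dom_cls Cod_cls by (auto simp: Hom_def verdier_quotient_def)
qed

lemma common_denominator:
  assumes "frac a b s f" "frac a c t g"
  obtains u f' g' where "frac a b u f'" "frac a c u g'" "cls u f' = cls s f" "cls u g' = cls t g"
proof -
  note s' = fracD [OF assms(1)] and t' = fracD [OF assms(2)]
  obtain p q where p: "p \<in> Mor K" "q \<in> Mor K" "Dom K p = Dom K q" "Cod K p = Dom K s" "Cod K q = Dom K t"
    "s \<cdot> p = t \<cdot> q" "s \<cdot> p \<in> W"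
    using common_multiple [OF s'(1) t'(1)] s'(5) t'(5) by metis
  show ?thesis
    using that [of "s \<cdot> p" "f \<cdot> p" "g \<cdot> q"] R_amplify(2) [OF assms(1), of p] R_amplify(2) [OF assms(2), of q]
      cls_amplify [OF assms(1), of p] cls_amplify [OF assms(2), of q] p by simp
qed

lemma frac_pairE:
  assumes "X \<in> {cls s f | s f. frac a b s f}" "Y \<in> {cls s f | s f. frac a b s f}"
  obtains s f g where "frac a b s f" "frac a b s g" "X = cls s f" "Y = cls s g"
  using assms common_denominator by (smt (verit) mem_Collect_eq)

lemma frac_madd:
  assumes "frac a b s f" "frac a b s g"
  shows "frac a b s (madd K f g)"
  using fracD [OF assms(1)] fracD [OF assms(2)] by (simp add: frac_def)

lemma frac_mneg:
  assumes "frac a b s f"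
  shows "frac a b s (mneg K f)"
  using fracD [OF assms(1)] by (simp add: frac_def)

lemma cls_madd_cong:
  assumes "frac a b s f" "frac a b s g" "frac a b t f'" "frac a b t g'"
    "cls s f = cls t f'" "cls s g = cls t g'"
  shows "cls s (madd K f g) = cls t (madd K f' g')"
proof -
  note s' = fracD [OF assms(1)] fracD [OF assms(2)] and t' = fracD [OF assms(3)] fracD [OF assms(4)]
  obtain p q where p: "p \<in> Mor K" "q \<in> Mor K" "Dom K p = Dom K q" "Cod K p = Dom K s" "Cod K q = Dom K t"
    "s \<cdot> p = t \<cdot> q" "s \<cdot> p \<in> W"
    using common_multiple [OF s'(1) t'(1)] s'(5) t'(5) by metis
  have "null (madd K (f \<cdot> p) (mneg K (f' \<cdot> q)))"
    using R_null_iff [OF assms(1,3) p] cls_eq_iff [OF assms(1)] assms(5) by blast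
  moreover have "null (madd K (g \<cdot> p) (mneg K (g' \<cdot> q)))"
    using R_null_iff [OF assms(2,4) p] cls_eq_iff [OF assms(2)] assms(6) by blast
  ultimately have "null (madd K (madd K (f \<cdot> p) (mneg K (f' \<cdot> q))) (madd K (g \<cdot> p) (mneg K (g' \<cdot> q))))"
    using s' t' p(1-5) by - (rule null_madd; simp)
  also have "madd K (madd K (f \<cdot> p) (mneg K (f' \<cdot> q))) (madd K (g \<cdot> p) (mneg K (g' \<cdot> q))) =
      madd K (madd K f g \<cdot> p) (mneg K (madd K f' g' \<cdot> q))"
    using s' t' p(1-5) by (simp add: madd_ac)
  finally show ?thesis
    using R_null_iff [OF frac_madd [OF assms(1,2)] frac_madd [OF assms(3,4)] p]
      cls_eq_iff [OF frac_madd [OF assms(1,2)]] by blast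
qed

lemma madd_cls:
  assumes "frac a b s f" "frac a b s g"
  shows "madd Q (cls s f) (cls s g) = cls s (madd K f g)"
proof -
  have "madd Q (cls s f) (cls s g) =
      {q. \<exists>u f' g'. (u, f') \<in> cls s f \<and> (u, g') \<in> cls s g \<and> q \<in> cls u (madd K f' g')}"
    by (auto simp: verdier_quotient_def cls_def)
  also have "\<dots> = cls s (madd K f g)"
  proof (intro equalityI subsetI)
    fix q assume "q \<in> {q. \<exists>u f' g'. (u, f') \<in> cls s f \<and> (u, g') \<in> cls s g \<and> q \<in> cls u (madd K f' g')}"
    then obtain u f' g' where u: "(u, f') \<in> cls s f" "(u, g') \<in> cls s g" "q \<in> cls u (madd K f' g')"
      by blast
    then have "cls u (madd K f' g') = cls s (madd K f g)"
      using cls_madd_cong assms mem_cls_iff by metis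
    then show "q \<in> cls s (madd K f g)"
      using u by simp
  qed (use cls_self assms in blast)
  finally show ?thesis .
qed

lemma frac_mzero: "s \<in> W \<Longrightarrow> b \<in> Ob K \<Longrightarrow> frac (Cod K s) b s (mzero K (Dom K s) b)"
  by (simp add: frac_def)

lemma mzero_Q:
  assumes "s \<in> W" "b \<in> Ob K"
  shows "mzero Q (Cod K s) b = cls s (mzero K (Dom K s) b)"
proof -
  have "cls (Id K (Cod K s)) (mzero K (Cod K s) b) = cls s (mzero K (Dom K s) b)"
    using cls_amplify [OF frac_mzero [of "Id K (Cod K s)" b], of s] assms by simp
  then show ?thesis
    by (simp add: verdier_quotient_def cls_def)
qed

abbreviation G :: "'o \<Rightarrow> 'o \<Rightarrow> ('m \<times> 'm) set monoid"
  where "G a b \<equiv> hom_group Q a b"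

lemma G_carrier: "carrier (G a b) = {cls s f | s f. frac a b s f}"
  by (simp add: hom_group_def Hom_Q)

lemma G_mult: "frac a b s f \<Longrightarrow> frac a b s g \<Longrightarrow> cls s f \<otimes>\<^bsub>G a b\<^esub> cls s g = cls s (madd K f g)"
  by (simp add: hom_group_def madd_cls)

lemma G_one: "frac a b s f \<Longrightarrow> \<one>\<^bsub>G a b\<^esub> = cls s (mzero K (Dom K s) b)"
  using mzero_Q [of s b] fracD [of a b s f] by (simp add: hom_group_def)

lemma G_comm_group:
  assumes "a \<in> Ob K" "b \<in> Ob K"
  shows "comm_group (G a b)"
proof (rule comm_groupI)
  fix X Y assume "X \<in> carrier (G a b)" "Y \<in> carrier (G a b)"
  then obtain s f g where X: "frac a b s f" "frac a b s g" "X = cls s f" "Y = cls s g"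
    unfolding G_carrier by (rule frac_pairE)
  show "X \<otimes>\<^bsub>G a b\<^esub> Y \<in> carrier (G a b)"
    using X G_mult frac_madd unfolding G_carrier by blast
  show "X \<otimes>\<^bsub>G a b\<^esub> Y = Y \<otimes>\<^bsub>G a b\<^esub> X"
    using X G_mult fracD [OF X(1)] fracD [OF X(2)] madd_comm [of f g] by simp
next
  have "frac a b (Id K a) (mzero K a b)"
    using assms by (simp add: frac_def)
  then show "\<one>\<^bsub>G a b\<^esub> \<in> carrier (G a b)"
    unfolding G_carrier using G_one [of a b "Id K a" "mzero K a b"] assms by auto
next
  fix X assume "X \<in> carrier (G a b)"
  then obtain s f where X: "frac a b s f" "X = cls s f"
    unfolding G_carrier by blast
  note s' = fracD [OF X(1)]
  have z: "frac a b s (mzero K (Dom K s) b)"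
    using s' frac_mzero [of s b] by simp
  show "\<one>\<^bsub>G a b\<^esub> \<otimes>\<^bsub>G a b\<^esub> X = X"
    using X s' G_one [OF X(1)] G_mult [OF z X(1)] by simp
  have "cls s (mneg K f) \<otimes>\<^bsub>G a b\<^esub> X = \<one>\<^bsub>G a b\<^esub>"
    using X s' G_one [OF X(1)] G_mult [OF frac_mneg [OF X(1)] X(1)] by simp
  then show "\<exists>Y\<in>carrier (G a b). Y \<otimes>\<^bsub>G a b\<^esub> X = \<one>\<^bsub>G a b\<^esub>"
    unfolding G_carrier using frac_mneg [OF X(1)] by blast
next
  fix X Y Z assume "X \<in> carrier (G a b)" "Y \<in> carrier (G a b)" "Z \<in> carrier (G a b)"
  then obtain s f t g u h where X: "frac a b s f" "X = cls s f" and Y: "frac a b t g" "Y = cls t g"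
    and Z: "frac a b u h" "Z = cls u h"
    unfolding G_carrier by blast
  \<comment> \<open>A denominator common to three fractions is found in two rounds: first for
    \<open>X\<close> and \<open>Y\<close>, then for the result and \<open>Z\<close>.\<close>
  obtain r f' g' where r: "frac a b r f'" "frac a b r g'" "X = cls r f'" "Y = cls r g'"
    using common_denominator [OF X(1) Y(1)] X Y by metis
  note r' = fracD [OF r(1)] fracD [OF r(2)] and u' = fracD [OF Z(1)]
  obtain p q where p: "p \<in> Mor K" "q \<in> Mor K" "Dom K p = Dom K q" "Cod K p = Dom K r" "Cod K q = Dom K u"
    "r \<cdot> p = u \<cdot> q" "r \<cdot> p \<in> W"
    using common_multiple [OF r'(1) u'(1)] r'(5) u'(5) by metis
  let ?v = "r \<cdot> p"
  have fr: "frac a b ?v (f' \<cdot> p)" "frac a b ?v (g' \<cdot> p)" "frac a b ?v (h \<cdot> q)"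
    using R_amplify(2) [OF r(1), of p] R_amplify(2) [OF r(2), of p] R_amplify(2) [OF Z(1), of q] p r' by simp_all
  have "X = cls ?v (f' \<cdot> p)" "Y = cls ?v (g' \<cdot> p)" "Z = cls ?v (h \<cdot> q)"
    using cls_amplify [OF r(1), of p] cls_amplify [OF r(2), of p] cls_amplify [OF Z(1), of q] p r r' Z by simp_all
  then show "X \<otimes>\<^bsub>G a b\<^esub> Y \<otimes>\<^bsub>G a b\<^esub> Z = X \<otimes>\<^bsub>G a b\<^esub> (Y \<otimes>\<^bsub>G a b\<^esub> Z)"
    using fr G_mult frac_madd madd_assoc [of "f' \<cdot> p" "g' \<cdot> p" "h \<cdot> q"] r' u' p(1-5) by simp
qed

lemma G_inv:
  assumes "frac a b s f"
  shows "inv\<^bsub>G a b\<^esub> (cls s f) = cls s (mneg K f)"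
proof -
  note s' = fracD [OF assms]
  interpret comm_group "G a b"
    using G_comm_group s' by blast
  have "cls s (mneg K f) \<otimes>\<^bsub>G a b\<^esub> cls s f = \<one>\<^bsub>G a b\<^esub>"
    using s' G_one [OF assms] G_mult [OF frac_mneg [OF assms] assms] by simp
  then show ?thesis
    using assms frac_mneg [OF assms] unfolding G_carrier
    by (intro inv_equality) (auto simp: G_carrier)
qed

lemma cls_eq_one_iff:
  assumes "frac a b s f"
  shows "cls s f = \<one>\<^bsub>G a b\<^esub> \<longleftrightarrow> null f"
proof -
  note s' = fracD [OF assms]
  have "frac a b s (mzero K (Dom K s) b)"
    using s' frac_mzero [of s b] by simp
  then show ?thesis
    using G_one [OF assms] cls_same_denominator [OF assms, of "mzero K (Dom K s) b"] s' by simp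
qed

lemma quotient_functor_cls: "f \<in> Mor K \<Longrightarrow> quotient_functor K J f = cls (Id K (Dom K f)) f"
  by (simp add: quotient_functor_def cls_def)

lemma frac_Id: "f \<in> Mor K \<Longrightarrow> frac (Dom K f) (Cod K f) (Id K (Dom K f)) f"
  by (simp add: frac_def)

lemma quotient_functor_cls_denominator:
  assumes "f \<in> Mor K" "s \<in> W" "Cod K s = Dom K f"
  shows "quotient_functor K J f = cls s (f \<cdot> s)"
  using cls_amplify [OF frac_Id [OF assms(1)], of s] assms by (simp add: quotient_functor_cls)

lemma quotient_functor_eq_one_iff:
  assumes "f \<in> Mor K" "Dom K f = a" "Cod K f = b"
  shows "quotient_functor K J f = \<one>\<^bsub>G a b\<^esub> \<longleftrightarrow> null f"
  using cls_eq_one_iff [OF frac_Id [OF assms(1)]] assms by (simp add: quotient_functor_cls)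

lemma quotient_functor_hom:
  assumes "a \<in> Ob K" "b \<in> Ob K"
  shows "group_hom (hom_group K a b) (G a b) (quotient_functor K J)"
proof -
  have "quotient_functor K J \<in> hom (hom_group K a b) (G a b)"
  proof (rule homI)
    fix f assume "f \<in> carrier (hom_group K a b)"
    then show "quotient_functor K J f \<in> carrier (G a b)"
      using frac_Id [of f] quotient_functor_cls [of f] by (auto simp: hom_group_def Hom_Q)
  next
    fix f g assume "f \<in> carrier (hom_group K a b)" "g \<in> carrier (hom_group K a b)"
    then have fg: "f \<in> Mor K" "g \<in> Mor K" "Dom K f = a" "Dom K g = a" "Cod K f = b" "Cod K g = b"
      by (auto simp: hom_group_def)
    then show "quotient_functor K J (f \<otimes>\<^bsub>hom_group K a b\<^esub> g) =
        quotient_functor K J f \<otimes>\<^bsub>G a b\<^esub> quotient_functor K J g"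
      using G_mult [of a b "Id K a" f g] frac_Id [of f] frac_Id [of g] quotient_functor_cls
      by (simp add: hom_group_def)
  qed
  then show ?thesis
    by (rule comm_group_homI [OF _ hom_comm_group [OF assms] G_comm_group [OF assms]])
qed

text \<open>This carries the kernel of the restrictions across the suspension, as the desuspended
  connecting map requires. The object of \<open>J\<close> through which \<open>TMor K f\<close>
  factors is replaced by an isomorphic suspension before both factors are desuspended.\<close>

lemma null_TMor_iff:
  assumes "f \<in> Mor K"
  shows "null (TMor K f) \<longleftrightarrow> null f"
proof
  assume "null (TMor K f)"
  then obtain g h where gh: "g \<in> Mor K" "h \<in> Mor K" "Cod K g = Dom K h" "Cod K g \<in> J" "TMor K f = h \<cdot> g"
    by (auto simp: null_def)
  then have d: "Dom K g = TOb K (Dom K f)" "Cod K h = TOb K (Cod K f)"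
    using assms by (metis Comp_simps(2) TMor_simps(2), metis Comp_simps(3) TMor_simps(3))
  obtain y e e' where y: "y \<in> J" and e: "e \<in> Mor K" "e' \<in> Mor K" "Dom K e = TOb K y" "Cod K e = Cod K g"
    "Dom K e' = Cod K g" "Cod K e' = TOb K y" "e' \<cdot> e = Id K (TOb K y)" "e \<cdot> e' = Id K (Cod K g)"
    using J_desuspend [OF gh(4)] .
  obtain g' where g': "g' \<in> Mor K" "Dom K g' = Dom K f" "Cod K g' = y" "TMor K g' = e' \<cdot> g"
    using TMor_surj [of "e' \<cdot> g" "Dom K f" y] e gh d J_Ob [OF y] assms by auto
  obtain h' where h': "h' \<in> Mor K" "Dom K h' = y" "Cod K h' = Cod K f" "TMor K h' = h \<cdot> e"
    using TMor_surj [of "h \<cdot> e" y "Cod K f"] e gh d J_Ob [OF y] assms by auto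
  have "TMor K (h' \<cdot> g') = h \<cdot> e \<cdot> e' \<cdot> g"
    using g' h' e gh(1-3) by simp
  also have "\<dots> = TMor K f"
    using Comp_reduce [OF e(8), of g] e(1-6) gh(1-3) by (simp add: gh(5))
  finally have "h' \<cdot> g' = f"
    using g'(1-3) h'(1-3) assms by - (rule TMor_inj; simp)
  then show "null f"
    using null_through [of y g' h'] g' h' y by simp
next
  assume "null f"
  then obtain g h where gh: "g \<in> Mor K" "h \<in> Mor K" "Cod K g = Dom K h" "Cod K g \<in> J" "f = h \<cdot> g"
    by (auto simp: null_def)
  then have "TOb K (Cod K g) \<in> J"
    using J_T [of "Cod K g"] by simp
  then show "null (TMor K f)"
    using gh null_through [of "TOb K (Cod K g)" "TMor K g" "TMor K h"] by simp
qed

text \<open>\<open>thick\<close> speaks of direct summands only. Idempotent completeness turns a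
  retract into a summand: the idempotent \<open>i \<cdot> r\<close> splits off some \<open>d\<close>
  from \<open>c\<close>, and \<open>d\<close> is isomorphic to \<open>a\<close>.\<close>

lemma J_retract:
  assumes ic: "idempotent_complete K" and th: "thick K J" and c: "c \<in> J"
    and i: "i \<in> Mor K" "Dom K i = a" "Cod K i = c" and r: "r \<in> Mor K" "Dom K r = c" "Cod K r = a"
    and id: "r \<cdot> i = Id K a"
  shows "a \<in> J"
proof -
  have ty: "i \<cdot> r \<in> Mor K" "Dom K (i \<cdot> r) = c" "Cod K (i \<cdot> r) = c"
    using i r by simp_all
  have "(i \<cdot> r) \<cdot> i \<cdot> r = i \<cdot> r"
    using i r Comp_reduce [OF id, of r] by simp
  then obtain d d' i1 i2 p1 p2 where bi: "is_biproduct K d d' c i1 i2 p1 p2" "i1 \<cdot> p1 = i \<cdot> r"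
    using idempotent_biproduct [OF ic ty] by blast
  note b = biproductD [OF bi(1)]
  have d: "d \<in> J"
    using th bi(1) c unfolding thick_def by blast
  have "(p1 \<cdot> i) \<cdot> r \<cdot> i1 = p1 \<cdot> (i1 \<cdot> p1) \<cdot> i1"
    unfolding bi(2) using b(1-15) i r by simp
  also have "\<dots> = Id K d"
    using b by simp
  finally have 1: "(p1 \<cdot> i) \<cdot> r \<cdot> i1 = Id K d" .
  have "(r \<cdot> i1) \<cdot> p1 \<cdot> i = r \<cdot> (i1 \<cdot> p1) \<cdot> i"
    using b(1-15) i r by simp
  also have "\<dots> = Id K a"
    unfolding bi(2) using i r id by simp
  finally have "is_iso K (r \<cdot> i1) d a"
    using 1 b(1-15) i r by (intro is_isoI [of _ "p1 \<cdot> i"]) simp_all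
  then show ?thesis
    using J_iso d by blast
qed

end

locale verdier_pair = V: verdier K J + V': verdier K J'
  for K :: "('o, 'm, 'z) triangulated_scheme" (structure) and J J' +
  assumes J_le: "J \<subseteq> J'"
begin

lemma W_mono: "s \<in> cone_in K J \<Longrightarrow> s \<in> cone_in K J'"
  using J_le unfolding cone_in_def by blast

lemma frac_mono: "V.frac a b s f \<Longrightarrow> V'.frac a b s f"
  using W_mono by (simp add: V.frac_def V'.frac_def)

lemma R_mono: "(x, y) \<in> fraction_rel K J \<Longrightarrow> (x, y) \<in> fraction_rel K J'"
  using W_mono unfolding fraction_rel_def fractions_def by blast

lemma restrict_cls:
  assumes "V.frac a b s f"
  shows "fraction_rel K J' `` V.cls s f = V'.cls s f"
proof (intro equalityI subsetI)
  fix x assume "x \<in> fraction_rel K J' `` V.cls s f"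
  then obtain y where "((s, f), y) \<in> fraction_rel K J" "(y, x) \<in> fraction_rel K J'"
    by (auto simp: V.cls_def)
  then show "x \<in> V'.cls s f"
    using R_mono V'.R_trans unfolding V'.cls_def by blast
next
  fix x assume "x \<in> V'.cls s f"
  then show "x \<in> fraction_rel K J' `` V.cls s f"
    using V.cls_self [OF assms] unfolding V'.cls_def by blast
qed

lemma restrict_hom:
  assumes "a \<in> Ob K" "b \<in> Ob K"
  shows "group_hom (V.G a b) (V'.G a b) (\<lambda>X. fraction_rel K J' `` X)"
proof -
  have "(\<lambda>X. fraction_rel K J' `` X) \<in> hom (V.G a b) (V'.G a b)"
  proof (rule homI)
    fix X assume "X \<in> carrier (V.G a b)"
    then show "fraction_rel K J' `` X \<in> carrier (V'.G a b)"
      using restrict_cls frac_mono unfolding V.G_carrier V'.G_carrier by blast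
  next
    fix X Y assume "X \<in> carrier (V.G a b)" "Y \<in> carrier (V.G a b)"
    then obtain s f g where X: "V.frac a b s f" "V.frac a b s g" "X = V.cls s f" "Y = V.cls s g"
      unfolding V.G_carrier by (rule V.frac_pairE)
    then show "fraction_rel K J' `` (X \<otimes>\<^bsub>V.G a b\<^esub> Y) =
        fraction_rel K J' `` X \<otimes>\<^bsub>V'.G a b\<^esub> fraction_rel K J' `` Y"
      using V.G_mult [OF X(1,2)] V'.G_mult [OF frac_mono [OF X(1)] frac_mono [OF X(2)]]
        restrict_cls [OF X(1)] restrict_cls [OF X(2)] restrict_cls [OF V.frac_madd [OF X(1,2)]] by simp
  qed
  then show ?thesis
    by (rule comm_group_homI [OF _ V.G_comm_group [OF assms] V'.G_comm_group [OF assms]])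
qed

end

section \<open>Orthogonal subcategories and the connecting map\<close>

locale orthogonal_pair = triangulated_category K
  for K :: "('o, 'm, 'z) triangulated_scheme" (structure) +
  fixes J1 J2 :: "'o set"
  assumes J1_sub: "triangulated_subcategory K J1"
    and J2_sub: "triangulated_subcategory K J2"
    and orth12: "f \<in> Mor K \<Longrightarrow> Dom K f \<in> J1 \<Longrightarrow> Cod K f \<in> J2 \<Longrightarrow> f = mzero K (Dom K f) (Cod K f)"
    and orth21: "f \<in> Mor K \<Longrightarrow> Dom K f \<in> J2 \<Longrightarrow> Cod K f \<in> J1 \<Longrightarrow> f = mzero K (Dom K f) (Cod K f)"

sublocale orthogonal_pair \<subseteq> V1: verdier K J1
  by unfold_locales (rule J1_sub)

sublocale orthogonal_pair \<subseteq> V2: verdier K J2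
  by unfold_locales (rule J2_sub)

context orthogonal_pair
begin

lemma orthogonal_swap: "orthogonal_pair K J2 J1"
  by unfold_locales (use J1_sub J2_sub orth12 orth21 in blast)+

text \<open>Orthogonality kills the two off-diagonal entries of \<open>z\<close>, so the projections
  onto the \<open>J1\<close>-parts are natural. This single fact drives both the closure of sums
  under cones and the independence of the connecting map from its choices.\<close>

lemma diagonal:
  assumes b: "is_biproduct K c1 c2 c i1 i2 p1 p2" and b': "is_biproduct K c1' c2' c' i1' i2' p1' p2'"
    and J: "c1 \<in> J1" "c2 \<in> J2" "c1' \<in> J1" "c2' \<in> J2"
    and z: "z \<in> Mor K" "Dom K z = c'" "Cod K z = c"
  shows "i1 \<cdot> p1 \<cdot> z = z \<cdot> i1' \<cdot> p1'"
proof -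
  note t = biproductD(1-15) [OF b] and t' = biproductD(1-15) [OF b']
  have 1: "p1 \<cdot> z \<cdot> i2' = mzero K c2' c1" and 2: "p2 \<cdot> z \<cdot> i1' = mzero K c1' c2"
    using orth12 [of "p2 \<cdot> z \<cdot> i1'"] orth21 [of "p1 \<cdot> z \<cdot> i2'"] t t' z J by simp_all
  have "i1 \<cdot> p1 \<cdot> z = madd K (i1 \<cdot> p1 \<cdot> z \<cdot> i1' \<cdot> p1') (i1 \<cdot> p1 \<cdot> z \<cdot> i2' \<cdot> p2')"
    using biproduct_out [OF b', of "i1 \<cdot> p1 \<cdot> z"] t t' z by simp
  also have "i1 \<cdot> p1 \<cdot> z \<cdot> i2' \<cdot> p2' = mzero K c' c"
    using Comp_reduce [of "p1" "z \<cdot> i2'" _ p2'] 1 t t' z by simp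
  finally have "i1 \<cdot> p1 \<cdot> z = i1 \<cdot> p1 \<cdot> z \<cdot> i1' \<cdot> p1'"
    using t t' z by simp
  also have "\<dots> = madd K (i1 \<cdot> p1 \<cdot> z \<cdot> i1' \<cdot> p1') (i2 \<cdot> p2 \<cdot> z \<cdot> i1' \<cdot> p1')"
    using Comp_reduce [of "p2" "z \<cdot> i1'" _ p1'] 2 t t' z by simp
  also have "\<dots> = z \<cdot> i1' \<cdot> p1'"
    using biproduct_into [OF b, of "z \<cdot> i1' \<cdot> p1'"] t t' z by simp
  finally show ?thesis .
qed

section \<open>Sums of objects of the two orthogonal subcategories\<close>

definition dsums :: "'o set" where
  "dsums = {c. \<exists>c1\<in>J1. \<exists>c2\<in>J2. \<exists>i1 i2 p1 p2. is_biproduct K c1 c2 c i1 i2 p1 p2}"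

lemma dsumsI: "is_biproduct K c1 c2 c i1 i2 p1 p2 \<Longrightarrow> c1 \<in> J1 \<Longrightarrow> c2 \<in> J2 \<Longrightarrow> c \<in> dsums"
  unfolding dsums_def by blast

lemma J1_dsums: "J1 \<subseteq> dsums"
proof
  fix c assume c: "c \<in> J1"
  obtain z where z: "is_zero_object K z"
    using zero_object by blast
  then show "c \<in> dsums"
    using dsumsI [OF biproduct_zero_right [OF V1.J_Ob [OF c] z] c] V2.J_zero by blast
qed

lemma J2_dsums: "J2 \<subseteq> dsums"
proof
  fix c assume c: "c \<in> J2"
  obtain z where z: "is_zero_object K z"
    using zero_object by blast
  then show "c \<in> dsums"
    using dsumsI [OF biproduct_swap [OF biproduct_zero_right [OF V2.J_Ob [OF c] z]]] c V1.J_zero by blast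
qed

text \<open>A map between sums is diagonal, so the cones of its two entries are retracts of its cone
  \<open>c\<close>. What they leave over in \<open>c\<close> is shown to vanish, which exhibits
  \<open>c\<close> as their sum.\<close>

lemma dsums_cone:
  assumes tri: "(u, v, w) \<in> Tri K" and "Dom K u \<in> dsums" "Cod K u \<in> dsums"
  shows "Cod K v \<in> dsums"
proof -
  obtain a1 a2 i1 i2 p1 p2 where a: "a1 \<in> J1" "a2 \<in> J2" "is_biproduct K a1 a2 (Dom K u) i1 i2 p1 p2"
    using assms(2) unfolding dsums_def by blast
  obtain b1 b2 j1 j2 q1 q2 where b: "b1 \<in> J1" "b2 \<in> J2" "is_biproduct K b1 b2 (Cod K u) j1 j2 q1 q2"
    using assms(3) unfolding dsums_def by blast
  note t = triD [OF tri] and ba = biproductD [OF a(3)] and bb = biproductD [OF b(3)]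
  have dia1: "j1 \<cdot> q1 \<cdot> u = u \<cdot> i1 \<cdot> p1"
    using diagonal [OF b(3) a(3) b(1,2) a(1,2) t(1)] by simp
  have dia2: "j2 \<cdot> q2 \<cdot> u = u \<cdot> i2 \<cdot> p2"
    using orthogonal_pair.diagonal [OF orthogonal_swap biproduct_swap [OF b(3)] biproduct_swap [OF a(3)]
      b(2,1) a(2,1) t(1)] by simp
  \<comment> \<open>The diagonal entries of \<open>u\<close>; the commutation rules
    \<open>dia1\<close> and \<open>dia2\<close> make each of them a retract of \<open>u\<close> in
    the category of arrows.\<close>
  define u1 u2 where "u1 = q1 \<cdot> u \<cdot> i1" "u2 = q2 \<cdot> u \<cdot> i2"
  have u: "u1 \<in> Mor K" "Dom K u1 = a1" "Cod K u1 = b1" "u2 \<in> Mor K" "Dom K u2 = a2" "Cod K u2 = b2"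
    using ba(1-15) bb(1-15) t u1_u2_def by simp_all
  have "j1 \<cdot> u1 = (j1 \<cdot> q1 \<cdot> u) \<cdot> i1" "j2 \<cdot> u2 = (j2 \<cdot> q2 \<cdot> u) \<cdot> i2"
    using ba(1-15) bb(1-15) t u1_u2_def by simp_all
  then have ui: "u \<cdot> i1 = j1 \<cdot> u1" "u \<cdot> i2 = j2 \<cdot> u2"
    unfolding dia1 dia2 using ba t by simp_all
  have "u1 \<cdot> p1 = q1 \<cdot> u \<cdot> i1 \<cdot> p1" "u2 \<cdot> p2 = q2 \<cdot> u \<cdot> i2 \<cdot> p2"
    using ba(1-15) bb(1-15) t u1_u2_def by simp_all
  then have up: "u1 \<cdot> p1 = q1 \<cdot> u" "u2 \<cdot> p2 = q2 \<cdot> u"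
    unfolding dia1 [symmetric] dia2 [symmetric] using bb(1-15) t
      Comp_reduce [OF bb(16), of "q1 \<cdot> u"] Comp_reduce [OF bb(17), of "q2 \<cdot> u"] by simp_all
  obtain v1 w1 where tri1: "(u1, v1, w1) \<in> Tri K"
    using Tri_cone u by blast
  obtain v2 w2 where tri2: "(u2, v2, w2) \<in> Tri K"
    using Tri_cone u by blast
  note t1 = triD [OF tri1] and t2 = triD [OF tri2]
  define c c1 c2 where "c = Cod K v" "c1 = Cod K v1" "c2 = Cod K v2"
  have dv: "Dom K v1 = b1" "Dom K v2 = b2"
    using t1 t2 u by simp_all
  have c1: "c1 \<in> J1" and c2: "c2 \<in> J2"
    using V1.J_tri(1) [OF tri1] V2.J_tri(1) [OF tri2] u a b c_c1_c2_def by simp_all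
  have ob: "c \<in> Ob K" "c1 \<in> Ob K" "c2 \<in> Ob K"
    using t t1 t2 c_c1_c2_def by simp_all
  have r1: "i1 \<in> Mor K" "Dom K i1 = Dom K u1" "Cod K i1 = Dom K u"
    "p1 \<in> Mor K" "Dom K p1 = Dom K u" "Cod K p1 = Dom K u1"
    "j1 \<in> Mor K" "Dom K j1 = Dom K v1" "Cod K j1 = Dom K v"
    "q1 \<in> Mor K" "Dom K q1 = Dom K v" "Cod K q1 = Dom K v1"
    "p1 \<cdot> i1 = Id K (Dom K u1)" "q1 \<cdot> j1 = Id K (Dom K v1)"
    unfolding u dv t(4) [symmetric] using ba(4-6,10-12,16) bb(4-6,10-12,16) by simp_all
  obtain z1 y1 where z1: "z1 \<in> Mor K" "Dom K z1 = c1" "Cod K z1 = c" "y1 \<in> Mor K" "Dom K y1 = c" "Cod K y1 = c1"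
    "y1 \<cdot> z1 = Id K c1" "z1 \<cdot> v1 = v \<cdot> j1" "w \<cdot> z1 = TMor K i1 \<cdot> w1" "y1 \<cdot> v = v1 \<cdot> q1" "w1 \<cdot> y1 = TMor K p1 \<cdot> w"
    unfolding c_c1_c2_def by (rule tri_retract [OF tri tri1 r1 ui(1) up(1)])
  have r2: "i2 \<in> Mor K" "Dom K i2 = Dom K u2" "Cod K i2 = Dom K u"
    "p2 \<in> Mor K" "Dom K p2 = Dom K u" "Cod K p2 = Dom K u2"
    "j2 \<in> Mor K" "Dom K j2 = Dom K v2" "Cod K j2 = Dom K v"
    "q2 \<in> Mor K" "Dom K q2 = Dom K v" "Cod K q2 = Dom K v2"
    "p2 \<cdot> i2 = Id K (Dom K u2)" "q2 \<cdot> j2 = Id K (Dom K v2)"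
    unfolding u dv t(4) [symmetric] using ba(7-9,13-15,17) bb(7-9,13-15,17) by simp_all
  obtain z2 y2 where z2: "z2 \<in> Mor K" "Dom K z2 = c2" "Cod K z2 = c" "y2 \<in> Mor K" "Dom K y2 = c" "Cod K y2 = c2"
    "y2 \<cdot> z2 = Id K c2" "z2 \<cdot> v2 = v \<cdot> j2" "w \<cdot> z2 = TMor K i2 \<cdot> w2" "y2 \<cdot> v = v2 \<cdot> q2" "w2 \<cdot> y2 = TMor K p2 \<cdot> w"
    unfolding c_c1_c2_def by (rule tri_retract [OF tri tri2 r2 ui(2) up(2)])
  have y21: "y2 \<cdot> z1 = mzero K c1 c2" and y12: "y1 \<cdot> z2 = mzero K c2 c1"
    using orth12 [of "y2 \<cdot> z1"] orth21 [of "y1 \<cdot> z2"] z1(1-6) z2(1-6) c1 c2 by simp_all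
  have tc: "v \<in> Mor K" "Cod K v = c" "w \<in> Mor K" "Dom K w = c" "Cod K w = TOb K (Dom K u)" "Cod K u = Dom K v"
    "v1 \<in> Mor K" "Cod K v1 = c1" "w1 \<in> Mor K" "Dom K w1 = c1" "Cod K w1 = TOb K a1"
    "v2 \<in> Mor K" "Cod K v2 = c2" "w2 \<in> Mor K" "Dom K w2 = c2" "Cod K w2 = TOb K a2"
    using t t1 t2 u c_c1_c2_def by simp_all
  define s where "s = madd K (z1 \<cdot> y1) (z2 \<cdot> y2)"
  \<comment> \<open>The idempotent complementary to the part of \<open>c\<close> already accounted
    for. It satisfies r v = 0 and w r = 0, hence r = g w and r = r r = g w r = 0.\<close>
  define r where "r = madd K (Id K c) (mneg K s)"
  have s: "s \<in> Mor K" "Dom K s = c" "Cod K s = c"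
    using z1(1-6) z2(1-6) s_def by simp_all
  have r: "r \<in> Mor K" "Dom K r = c" "Cod K r = c"
    using s ob r_def by simp_all
  have "s \<cdot> v = madd K (z1 \<cdot> v1 \<cdot> q1) (z2 \<cdot> v2 \<cdot> q2)"
    unfolding s_def using z1(1-6,10) z2(1-6,10) tc by simp
  also have "z1 \<cdot> v1 \<cdot> q1 = v \<cdot> j1 \<cdot> q1"
    using Comp_square [OF z1(8), of q1] z1(1-6) tc dv bb(1-15) by simp
  also have "z2 \<cdot> v2 \<cdot> q2 = v \<cdot> j2 \<cdot> q2"
    using Comp_square [OF z2(8), of q2] z2(1-6) tc dv bb(1-15) by simp
  also have "madd K (v \<cdot> j1 \<cdot> q1) (v \<cdot> j2 \<cdot> q2) = v"
    using biproduct_out [OF b(3), of v] tc by simp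
  finally have "r \<cdot> v = mzero K (Cod K u) c"
    unfolding r_def using s tc ob by simp
  then obtain g where g: "g \<in> Mor K" "Dom K g = TOb K (Dom K u)" "Cod K g = c" "g \<cdot> w = r"
    using tri_factor_w [OF tri r(1)] r tc by auto
  have "w \<cdot> s = madd K ((w \<cdot> z1) \<cdot> y1) ((w \<cdot> z2) \<cdot> y2)"
    unfolding s_def using z1(1-6) z2(1-6) tc by simp
  also have "(w \<cdot> z1) \<cdot> y1 = TMor K i1 \<cdot> TMor K p1 \<cdot> w"
    unfolding z1(9) using z1(1-6,11) tc ba(1-15) by simp
  also have "(w \<cdot> z2) \<cdot> y2 = TMor K i2 \<cdot> TMor K p2 \<cdot> w"
    unfolding z2(9) using z2(1-6,11) tc ba(1-15) by simp
  also have "madd K (TMor K i1 \<cdot> TMor K p1 \<cdot> w) (TMor K i2 \<cdot> TMor K p2 \<cdot> w) = w"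
    using biproduct_into [OF functor_biproduct [OF T_functor T_additive a(3)], of w] tc by simp
  finally have wr: "w \<cdot> r = mzero K c (TOb K (Dom K u))"
    unfolding r_def using s tc ob by simp
  have "s \<cdot> z1 = z1" "s \<cdot> z2 = z2"
    unfolding s_def using z1(1-7) z2(1-7) y21 y12 ob by simp_all
  then have "r \<cdot> z1 = mzero K c1 c" "r \<cdot> z2 = mzero K c2 c"
    unfolding r_def using s z1(1-3) z2(1-3) ob by simp_all
  then have "r \<cdot> s = mzero K c c"
    unfolding s_def using r z1(1-6) z2(1-6) ob Comp_reduce [of r z1 _ y1] Comp_reduce [of r z2 _ y2]
    by simp
  then have "r \<cdot> madd K (Id K c) (mneg K s) = r"
    using r s ob by simp
  then have "r \<cdot> r = r"
    unfolding r_def [symmetric] .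
  moreover have "r \<cdot> r = g \<cdot> w \<cdot> r"
    using Comp_reduce [OF g(4), of r] g(1-3) tc r by simp
  ultimately have "r = mzero K c c"
    using wr g tc ob r by simp
  then have "Id K c = s"
    using madd_eq_zero_iff [of "Id K c" s] s ob r_def by simp
  then have "is_biproduct K c1 c2 c z1 z2 y1 y2"
    using z1(1-7) z2(1-7) y21 y12 ob s_def by (simp add: is_biproduct_def)
  then show ?thesis
    using dsumsI c1 c2 c_c1_c2_def by blast
qed

text \<open>The image of the idempotent \<open>y1 x1\<close> and its complement are retracts of \<open>c1\<close> and \<open>c2\<close>.\<close>

lemma dsums_retract:
  assumes ic: "idempotent_complete K" and th: "thick K J1" "thick K J2"
    and c: "c1 \<in> J1" "c2 \<in> J2"
    and x1: "x1 \<in> Mor K" "Dom K x1 = a" "Cod K x1 = c1" and y1: "y1 \<in> Mor K" "Dom K y1 = c1" "Cod K y1 = a"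
    and x2: "x2 \<in> Mor K" "Dom K x2 = a" "Cod K x2 = c2" and y2: "y2 \<in> Mor K" "Dom K y2 = c2" "Cod K y2 = a"
    and id: "madd K (y1 \<cdot> x1) (y2 \<cdot> x2) = Id K a" and idem: "(y1 \<cdot> x1) \<cdot> (y1 \<cdot> x1) = y1 \<cdot> x1"
  shows "a \<in> dsums"
proof -
  have ty: "y1 \<cdot> x1 \<in> Mor K" "Dom K (y1 \<cdot> x1) = a" "Cod K (y1 \<cdot> x1) = a"
    using x1 y1 by simp_all
  obtain a1 a2 i1 i2 p1 p2 where bi: "is_biproduct K a1 a2 a i1 i2 p1 p2" "i1 \<cdot> p1 = y1 \<cdot> x1"
    using idempotent_biproduct [OF ic ty idem] by blast
  note b = biproductD [OF bi(1)]
  have "madd K (y1 \<cdot> x1) (i2 \<cdot> p2) = madd K (y1 \<cdot> x1) (y2 \<cdot> x2)"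
    using b(20) unfolding bi(2) id .
  then have eq2: "i2 \<cdot> p2 = y2 \<cdot> x2"
    by (rule madd_left_cancel) (use b(1-15) x1 y1 x2 y2 in simp_all)
  have "(p1 \<cdot> y1) \<cdot> x1 \<cdot> i1 = p1 \<cdot> (y1 \<cdot> x1) \<cdot> i1"
    using b(1-15) x1 y1 by simp
  also have "\<dots> = Id K a1"
    unfolding bi(2) [symmetric] using b by simp
  finally have "a1 \<in> J1"
    using V1.J_retract [OF ic th(1) c(1), of "x1 \<cdot> i1" a1 "p1 \<cdot> y1"] b(1-15) x1 y1 by simp
  moreover have "(p2 \<cdot> y2) \<cdot> x2 \<cdot> i2 = p2 \<cdot> (y2 \<cdot> x2) \<cdot> i2"
    using b(1-15) x2 y2 by simp
  then have "(p2 \<cdot> y2) \<cdot> x2 \<cdot> i2 = Id K a2"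
    unfolding eq2 [symmetric] using b by simp
  then have "a2 \<in> J2"
    using V2.J_retract [OF ic th(2) c(2), of "x2 \<cdot> i2" a2 "p2 \<cdot> y2"] b(1-15) x2 y2 by simp
  ultimately show ?thesis
    using dsumsI [OF bi(1)] by blast
qed

text \<open>By \<open>diagonal\<close> the idempotent of the summand \<open>a\<close> commutes with
  that of \<open>c1\<close>. Therefore \<open>p1 \<cdot> j1 \<cdot> q1 \<cdot> i1\<close> is an
  idempotent of \<open>a\<close>, whose image should be the \<open>J1\<close>-part of
  \<open>a\<close>.\<close>

lemma dsums_thick:
  assumes ic: "idempotent_complete K" and th: "thick K J1" "thick K J2"
    and bi: "is_biproduct K a b c i1 i2 p1 p2" and c: "c \<in> dsums"
  shows "a \<in> dsums"
proof -
  obtain c1 c2 j1 j2 q1 q2 where d: "c1 \<in> J1" "c2 \<in> J2" "is_biproduct K c1 c2 c j1 j2 q1 q2"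
    using c unfolding dsums_def by blast
  note b = biproductD [OF bi] and bd = biproductD [OF d(3)]
  have "j1 \<cdot> q1 \<cdot> (i1 \<cdot> p1) = (i1 \<cdot> p1) \<cdot> j1 \<cdot> q1"
    using diagonal [OF d(3) d(3) d(1,2) d(1,2), of "i1 \<cdot> p1"] b(1-15) by simp
  then have dia: "(j1 \<cdot> q1) \<cdot> (i1 \<cdot> p1) = (i1 \<cdot> p1) \<cdot> (j1 \<cdot> q1)"
    using b(1-15) bd(1-15) by simp
  let ?y = "p1 \<cdot> j1" and ?x = "q1 \<cdot> i1" and ?y2 = "p1 \<cdot> j2" and ?x2 = "q2 \<cdot> i1"
  have "(?y \<cdot> ?x) \<cdot> (?y \<cdot> ?x) = p1 \<cdot> ((j1 \<cdot> q1) \<cdot> (i1 \<cdot> p1)) \<cdot> (j1 \<cdot> q1) \<cdot> i1"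
    using b(1-15) bd(1-15) by simp
  also have "\<dots> = (p1 \<cdot> i1) \<cdot> p1 \<cdot> j1 \<cdot> (q1 \<cdot> j1) \<cdot> q1 \<cdot> i1"
    unfolding dia using b(1-15) bd(1-15) by simp
  also have "\<dots> = ?y \<cdot> ?x"
    unfolding b(16) bd(16) using b(1-15) bd(1-15) by simp
  finally have idem: "(?y \<cdot> ?x) \<cdot> (?y \<cdot> ?x) = ?y \<cdot> ?x" .
  have "madd K (?y \<cdot> ?x) (?y2 \<cdot> ?x2) = p1 \<cdot> madd K (j1 \<cdot> q1 \<cdot> i1) (j2 \<cdot> q2 \<cdot> i1)"
    using b(1-15) bd(1-15) by simp
  also have "\<dots> = Id K a"
    using biproduct_into [OF d(3), of i1] b by simp
  finally show ?thesis
    using dsums_retract [OF ic th d(1,2), of ?x a ?y ?x2 ?y2] idem b(1-15) bd(1-15) by simp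
qed

text \<open>For the converse, the summands of \<open>TOb K a\<close> are desuspended up to
  isomorphism and their injections and projections are pulled back along the equivalence T; on
  \<open>a\<close> they satisfy the hypotheses of \<open>dsums_retract\<close>.\<close>

lemma dsums_T:
  assumes ic: "idempotent_complete K" and th: "thick K J1" "thick K J2" and a: "a \<in> Ob K"
  shows "TOb K a \<in> dsums \<longleftrightarrow> a \<in> dsums"
proof
  assume "a \<in> dsums"
  then obtain c1 c2 i1 i2 p1 p2 where c: "c1 \<in> J1" "c2 \<in> J2" "is_biproduct K c1 c2 a i1 i2 p1 p2"
    unfolding dsums_def by blast
  then show "TOb K a \<in> dsums"
    using dsumsI [OF functor_biproduct [OF T_functor T_additive c(3)]] V1.J_T V1.J_Ob V2.J_T V2.J_Ob
    by blast
next
  assume "TOb K a \<in> dsums"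
  then obtain c1 c2 i1 i2 p1 p2 where c: "c1 \<in> J1" "c2 \<in> J2" "is_biproduct K c1 c2 (TOb K a) i1 i2 p1 p2"
    unfolding dsums_def by blast
  note b = biproductD [OF c(3)]
  obtain d1 e1 e1' where d1: "d1 \<in> J1" and e1: "e1 \<in> Mor K" "e1' \<in> Mor K" "Dom K e1 = TOb K d1" "Cod K e1 = c1"
    "Dom K e1' = c1" "Cod K e1' = TOb K d1" "e1' \<cdot> e1 = Id K (TOb K d1)" "e1 \<cdot> e1' = Id K c1"
    using V1.J_desuspend [OF c(1)] .
  obtain d2 e2 e2' where d2: "d2 \<in> J2" and e2: "e2 \<in> Mor K" "e2' \<in> Mor K" "Dom K e2 = TOb K d2" "Cod K e2 = c2"
    "Dom K e2' = c2" "Cod K e2' = TOb K d2" "e2' \<cdot> e2 = Id K (TOb K d2)" "e2 \<cdot> e2' = Id K c2"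
    using V2.J_desuspend [OF c(2)] .
  have d: "d1 \<in> Ob K" "d2 \<in> Ob K"
    using V1.J_Ob [OF d1] V2.J_Ob [OF d2] .
  obtain x1 where x1: "x1 \<in> Mor K" "Dom K x1 = a" "Cod K x1 = d1" "TMor K x1 = e1' \<cdot> p1"
    using TMor_surj [of "e1' \<cdot> p1" a d1] e1 d a b by auto
  obtain x2 where x2: "x2 \<in> Mor K" "Dom K x2 = a" "Cod K x2 = d2" "TMor K x2 = e2' \<cdot> p2"
    using TMor_surj [of "e2' \<cdot> p2" a d2] e2 d a b by auto
  obtain y1 where y1: "y1 \<in> Mor K" "Dom K y1 = d1" "Cod K y1 = a" "TMor K y1 = i1 \<cdot> e1"
    using TMor_surj [of "i1 \<cdot> e1" d1 a] e1 d a b by auto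
  obtain y2 where y2: "y2 \<in> Mor K" "Dom K y2 = d2" "Cod K y2 = a" "TMor K y2 = i2 \<cdot> e2"
    using TMor_surj [of "i2 \<cdot> e2" d2 a] e2 d a b by auto
  have 1: "TMor K y1 \<cdot> TMor K x1 = i1 \<cdot> p1"
    unfolding x1(4) y1(4) using e1(1-6) b(1-15) Comp_reduce [OF e1(8), of p1] by simp
  have 2: "TMor K y2 \<cdot> TMor K x2 = i2 \<cdot> p2"
    unfolding x2(4) y2(4) using e2(1-6) b(1-15) Comp_reduce [OF e2(8), of p2] by simp
  have "TMor K (madd K (y1 \<cdot> x1) (y2 \<cdot> x2)) = madd K (TMor K y1 \<cdot> TMor K x1) (TMor K y2 \<cdot> TMor K x2)"
    using x1(1-3) y1(1-3) x2(1-3) y2(1-3) by simp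
  then have "TMor K (madd K (y1 \<cdot> x1) (y2 \<cdot> x2)) = TMor K (Id K a)"
    unfolding 1 2 using b a by simp
  then have id: "madd K (y1 \<cdot> x1) (y2 \<cdot> x2) = Id K a"
    using x1(1-3) y1(1-3) x2(1-3) y2(1-3) a by - (rule TMor_inj; simp)
  have "TMor K ((y1 \<cdot> x1) \<cdot> (y1 \<cdot> x1)) = (TMor K y1 \<cdot> TMor K x1) \<cdot> (TMor K y1 \<cdot> TMor K x1)"
    using x1(1-3) y1(1-3) by simp
  also have "\<dots> = TMor K (y1 \<cdot> x1)"
    using x1(1-3) y1(1-3) 1 b(1-15) Comp_reduce [OF b(16), of p1] TMor_Comp [of x1 y1]
    by (simp del: TMor_Comp)
  finally have "(y1 \<cdot> x1) \<cdot> (y1 \<cdot> x1) = y1 \<cdot> x1"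
    using x1(1-3) y1(1-3) by - (rule TMor_inj; simp)
  then show "a \<in> dsums"
    using dsums_retract [OF ic th d1 d2 x1(1-3) y1(1-3) x2(1-3) y2(1-3) id] by blast
qed

lemma dsums_triangulated:
  assumes "idempotent_complete K" "thick K J1" "thick K J2"
  shows "triangulated_subcategory K dsums" "thick K dsums"
proof -
  show "triangulated_subcategory K dsums"
  proof (rule triangulated_subcategoryI)
    show "dsums \<subseteq> Ob K"
      unfolding dsums_def using biproductD(3) by blast
    show "z \<in> dsums" if "is_zero_object K z" for z
      using J1_dsums V1.J_zero [OF that] by blast
  qed (use dsums_T [OF assms] dsums_cone in auto)
  show "thick K dsums"
    unfolding thick_def using dsums_thick [OF assms] biproduct_swap by meson
qed

end

section \<open>The abstract Mayer-Vietoris situation and its connecting map\<close>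

locale mayer_vietoris = orthogonal_pair K J1 J2
  for K :: "('o, 'm, 'z) triangulated_scheme" (structure) and J1 J2 +
  fixes J :: "'o set"
  assumes J_sub: "triangulated_subcategory K J"
    and J1_le: "J1 \<subseteq> J"
    and J2_le: "J2 \<subseteq> J"
    and decompose: "c \<in> J \<Longrightarrow> \<exists>c1\<in>J1. \<exists>c2\<in>J2. \<exists>i1 i2 p1 p2. is_biproduct K c1 c2 c i1 i2 p1 p2"

sublocale mayer_vietoris \<subseteq> V: verdier K J
  by unfold_locales (rule J_sub)

sublocale mayer_vietoris \<subseteq> P1: verdier_pair K J1 J
  by unfold_locales (rule J1_le)

sublocale mayer_vietoris \<subseteq> P2: verdier_pair K J2 J
  by unfold_locales (rule J2_le)

context mayer_vietoris
begin

text \<open>In contrast to \<open>connecting_choice\<close>, the biproduct and the triangle stay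
  visible as arguments, so that two choices can be compared by morphisms of triangles.\<close>

definition choice where
  "choice s c1 c2 i1 i2 p1 p2 v w \<longleftrightarrow>
    c1 \<in> J1 \<and> c2 \<in> J2 \<and> is_biproduct K c1 c2 (Cod K v) i1 i2 p1 p2 \<and> (s, v, w) \<in> Tri K"

lemma choiceD:
  assumes "choice s c1 c2 i1 i2 p1 p2 v w"
  shows "c1 \<in> J1" "c2 \<in> J2" "is_biproduct K c1 c2 (Cod K v) i1 i2 p1 p2" "(s, v, w) \<in> Tri K"
  using assms by (auto simp: choice_def)

lemma choice_typing:
  assumes "choice s c1 c2 i1 i2 p1 p2 v w"
  shows "s \<in> Mor K" "v \<in> Mor K" "w \<in> Mor K" "Cod K s = Dom K v" "Dom K w = Cod K v"
    "Cod K w = TOb K (Dom K s)"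
    "i1 \<in> Mor K" "Dom K i1 = c1" "Cod K i1 = Cod K v" "i2 \<in> Mor K" "Dom K i2 = c2" "Cod K i2 = Cod K v"
    "p1 \<in> Mor K" "Dom K p1 = Cod K v" "Cod K p1 = c1" "p2 \<in> Mor K" "Dom K p2 = Cod K v" "Cod K p2 = c2"
    "c1 \<in> Ob K" "c2 \<in> Ob K"
  using triD [OF choiceD(4) [OF assms]] biproductD [OF choiceD(3) [OF assms]] by blast+

lemma choice_exists:
  assumes "s \<in> V.W"
  obtains c1 c2 i1 i2 p1 p2 v w where "choice s c1 c2 i1 i2 p1 p2 v w"
proof -
  obtain v w where vw: "(s, v, w) \<in> Tri K"
    using assms Tri_cone by (metis V.W_Mor)
  then obtain c1 c2 i1 i2 p1 p2 where "c1 \<in> J1" "c2 \<in> J2" "is_biproduct K c1 c2 (Cod K v) i1 i2 p1 p2"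
    using decompose [of "Cod K v"] V.W_tri [OF assms vw] by blast
  then show ?thesis
    using that vw by (simp add: choice_def)
qed

text \<open>The equation s p = s' extends to a morphism of triangles, and \<open>diagonal\<close>
  makes its third component respect the \<open>J1\<close>-parts. For \<open>p\<close> the identity
  this is independence of the triangle and of the decomposition; for general \<open>p\<close> it is
  compatibility with amplification.\<close>

lemma choice_natural:
  assumes c: "choice s c1 c2 i1 i2 p1 p2 v w" and c': "choice s' c1' c2' i1' i2' p1' p2' v' w'"
    and p: "p \<in> Mor K" "Dom K p = Dom K s'" "Cod K p = Dom K s" "s \<cdot> p = s'"
  shows "w \<cdot> i1 \<cdot> p1 \<cdot> v = TMor K p \<cdot> w' \<cdot> i1' \<cdot> p1' \<cdot> v'"
proof -
  note d = choiceD [OF c] and d' = choiceD [OF c']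
  note t = choice_typing [OF c] and t' = choice_typing [OF c']
  have s: "Cod K s' = Cod K s" "Dom K v' = Dom K v"
    using p t t'(4) by (metis Comp_simps(3))+
  obtain z where z: "z \<in> Mor K" "Dom K z = Cod K v'" "Cod K z = Cod K v" "z \<cdot> v' = v \<cdot> Id K (Dom K v)"
    "w \<cdot> z = TMor K p \<cdot> w'"
    using tri_mor_extend [OF d'(4) d(4) p(1) _ p(2,3), of "Id K (Dom K v)"] s t t'(1,4) p by auto
  have z': "z \<cdot> v' = v"
    using z(4) t by simp
  have "w \<cdot> i1 \<cdot> p1 \<cdot> z \<cdot> v' = w \<cdot> z \<cdot> i1' \<cdot> p1' \<cdot> v'"
    using Comp_reduce [of "i1 \<cdot> p1" z "z \<cdot> i1' \<cdot> p1'" v']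
      diagonal [OF d(3) d'(3) d(1,2) d'(1,2) z(1-3)] t t' z(1-3) by simp
  also have "\<dots> = TMor K p \<cdot> w' \<cdot> i1' \<cdot> p1' \<cdot> v'"
    using Comp_square [OF z(5), of "i1' \<cdot> p1' \<cdot> v'"] t t' z(1-3) p(1-3) by simp
  finally show ?thesis
    using z' by simp
qed

text \<open>\<open>k\<close> is the composite \<gamma> \<alpha>, that is, the connecting morphism of
  the fraction with denominator \<open>s\<close> and the identity as numerator. A numerator
  \<open>f\<close> only contributes the factor \<open>TMor K f\<close>.\<close>

definition kappa :: "'m \<Rightarrow> 'm \<Rightarrow> bool" where
  "kappa s k \<longleftrightarrow>
    (\<exists>c1 c2 i1 i2 p1 p2 v w. choice s c1 c2 i1 i2 p1 p2 v w \<and> k = w \<cdot> i1 \<cdot> p1 \<cdot> v)"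

lemma kappaI: "choice s c1 c2 i1 i2 p1 p2 v w \<Longrightarrow> kappa s (w \<cdot> i1 \<cdot> p1 \<cdot> v)"
  unfolding kappa_def by blast

lemma kappa_exists:
  assumes "s \<in> V.W"
  obtains k where "kappa s k"
  using choice_exists [OF assms] kappaI by metis

lemma kappa_typing:
  assumes "kappa s k"
  shows "k \<in> Mor K" "Dom K k = Cod K s" "Cod K k = TOb K (Dom K s)"
  using assms choice_typing unfolding kappa_def by force+

lemma kappa_natural:
  assumes "kappa s k" "kappa s' k'" "p \<in> Mor K" "Dom K p = Dom K s'" "Cod K p = Dom K s" "s \<cdot> p = s'"
  shows "k = TMor K p \<cdot> k'"
  using assms(1,2) choice_natural [OF _ _ assms(3-6)] unfolding kappa_def by blast

text \<open>The \<open>J1\<close>- and \<open>J2\<close>-contributions add up to T(f) w v, which is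
  zero; this is the sign between the two formulas for the connecting map.\<close>

lemma choice_opposite:
  assumes c: "choice s c1 c2 i1 i2 p1 p2 v w" and f: "f \<in> Mor K" "Dom K f = Dom K s"
  shows "mneg K (TMor K f \<cdot> w \<cdot> i2 \<cdot> p2 \<cdot> v) = TMor K f \<cdot> w \<cdot> i1 \<cdot> p1 \<cdot> v"
proof (rule mneg_unique)
  note d = choiceD [OF c] and t = choice_typing [OF c]
  have "madd K (TMor K f \<cdot> w \<cdot> i2 \<cdot> p2 \<cdot> v) (TMor K f \<cdot> w \<cdot> i1 \<cdot> p1 \<cdot> v) =
      TMor K f \<cdot> w \<cdot> madd K (i2 \<cdot> p2 \<cdot> v) (i1 \<cdot> p1 \<cdot> v)"
    using t f by simp
  also have "\<dots> = TMor K f \<cdot> w \<cdot> v"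
    using biproduct_into [OF biproduct_swap [OF d(3)], of v] t by simp
  finally show "madd K (TMor K f \<cdot> w \<cdot> i2 \<cdot> p2 \<cdot> v) (TMor K f \<cdot> w \<cdot> i1 \<cdot> p1 \<cdot> v) =
      mzero K (Dom K (TMor K f \<cdot> w \<cdot> i2 \<cdot> p2 \<cdot> v)) (Cod K (TMor K f \<cdot> w \<cdot> i2 \<cdot> p2 \<cdot> v))"
    using tri_comp_wv [OF d(4)] t f by simp
qed (use choice_typing [OF c] f in simp_all)

definition conn :: "('m \<times> 'm) set \<Rightarrow> 'm" where
  "conn g = (THE h. \<exists>(s, f)\<in>g. \<exists>k. kappa s k \<and> h = TMor K f \<cdot> k)"

text \<open>Both values equal the one computed from the common amplification, because
  \<open>kappa_natural\<close> expresses \<open>k\<close> and \<open>k'\<close> through the same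
  \<open>l\<close>.\<close>

lemma kappa_R:
  assumes R: "((s, f), (s', f')) \<in> V.R" and k: "kappa s k" "kappa s' k'"
  shows "TMor K f \<cdot> k = TMor K f' \<cdot> k'"
proof -
  obtain a b p q where fr: "V.frac a b s f" "V.frac a b s' f'"
    and p: "p \<in> Mor K" "q \<in> Mor K" "Dom K p = Dom K q" "Cod K p = Dom K s" "Cod K q = Dom K s'"
      "s \<cdot> p = s' \<cdot> q" "f \<cdot> p = f' \<cdot> q" "s \<cdot> p \<in> V.W"
    using R unfolding V.R_iff by blast
  note fr' = V.fracD [OF fr(1)] V.fracD [OF fr(2)]
  obtain l where l: "kappa (s \<cdot> p) l"
    using kappa_exists [OF p(8)] .
  have dom: "Dom K (s \<cdot> p) = Dom K p"
    using p(1,4) fr'(2) by simp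
  have kl: "k = TMor K p \<cdot> l" "k' = TMor K q \<cdot> l"
    using kappa_natural [OF k(1) l p(1)] kappa_natural [OF k(2) l p(2) _ p(5) p(6) [symmetric]] dom p(3,4)
    by simp_all
  have "TMor K f \<cdot> TMor K p = TMor K f' \<cdot> TMor K q"
    using p(1-5,7) fr' TMor_Comp [of p f] TMor_Comp [of q f'] by simp
  then show ?thesis
    unfolding kl using kappa_typing [OF l] dom p(1-5) fr' by (intro Comp_square) simp_all
qed

lemma conn_cls:
  assumes fr: "V.frac a b s f" and k: "kappa s k"
  shows "conn (V.cls s f) = TMor K f \<cdot> k"
  unfolding conn_def
proof (rule the_equality)
  show "\<exists>(s', f')\<in>V.cls s f. \<exists>k'. kappa s' k' \<and> TMor K f \<cdot> k = TMor K f' \<cdot> k'"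
    using V.cls_self [OF fr] k by blast
next
  fix h assume "\<exists>(s', f')\<in>V.cls s f. \<exists>k'. kappa s' k' \<and> h = TMor K f' \<cdot> k'"
  then obtain s' f' k' where h: "(s', f') \<in> V.cls s f" "kappa s' k'" "h = TMor K f' \<cdot> k'"
    by blast
  then have "((s, f), (s', f')) \<in> V.R"
    by (simp add: V.cls_def)
  then show "h = TMor K f \<cdot> k"
    using kappa_R [OF _ k h(2)] h(3) by simp
qed

lemma conn_closed:
  assumes "X \<in> carrier (V.G a b)"
  shows "conn X \<in> Mor K" "Dom K (conn X) = a" "Cod K (conn X) = TOb K b"
proof -
  obtain s f where X: "V.frac a b s f" "X = V.cls s f"
    using assms unfolding V.G_carrier by blast
  note fr = V.fracD [OF X(1)]
  obtain k where k: "kappa s k"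
    using kappa_exists [OF fr(1)] .
  show "conn X \<in> Mor K" "Dom K (conn X) = a" "Cod K (conn X) = TOb K b"
    using conn_cls [OF X(1) k] X(2) kappa_typing [OF k] fr by simp_all
qed

lemma conn_madd:
  assumes "X \<in> carrier (V.G a b)" "Y \<in> carrier (V.G a b)"
  shows "conn (X \<otimes>\<^bsub>V.G a b\<^esub> Y) = madd K (conn X) (conn Y)"
proof -
  obtain s f g where X: "V.frac a b s f" "V.frac a b s g" "X = V.cls s f" "Y = V.cls s g"
    using assms unfolding V.G_carrier by (rule V.frac_pairE)
  note fr = V.fracD [OF X(1)] V.fracD [OF X(2)]
  obtain k where k: "kappa s k"
    using kappa_exists [OF fr(1)] .
  show ?thesis
    using V.G_mult [OF X(1,2)] X(3,4) conn_cls [OF X(1) k] conn_cls [OF X(2) k]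
      conn_cls [OF V.frac_madd [OF X(1,2)] k] kappa_typing [OF k] fr by simp
qed

text \<open>The formula with \<gamma> \<alpha> passes through an object of \<open>J1\<close>, the
  one with \<delta> \<beta> through an object of \<open>J2\<close>.\<close>

lemma conn_null:
  assumes "X \<in> carrier (V.G a b)"
  shows "V1.null (conn X)" "V2.null (conn X)"
proof -
  obtain s f where X: "V.frac a b s f" "X = V.cls s f"
    using assms unfolding V.G_carrier by blast
  note fr = V.fracD [OF X(1)]
  obtain c1 c2 i1 i2 p1 p2 v w where c: "choice s c1 c2 i1 i2 p1 p2 v w"
    using choice_exists fr by blast
  note t = choice_typing [OF c] and d = choiceD [OF c]
  have "V1.null ((TMor K f \<cdot> w \<cdot> i1) \<cdot> p1 \<cdot> v)"
    using t fr by (intro V1.null_through [OF d(1)]) simp_all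
  then show "V1.null (conn X)"
    using conn_cls [OF X(1) kappaI [OF c]] X(2) t fr by simp
  have "V2.null (mneg K ((TMor K f \<cdot> w \<cdot> i2) \<cdot> p2 \<cdot> v))"
    using t fr by (intro V2.null_mneg V2.null_through [OF d(2)]) simp_all
  also have "mneg K ((TMor K f \<cdot> w \<cdot> i2) \<cdot> p2 \<cdot> v) = conn X"
    using choice_opposite [OF c, of f] conn_cls [OF X(1) kappaI [OF c]] X(2) t fr by simp
  finally show "V2.null (conn X)" .
qed

text \<open>If the whole cone of \<open>s\<close> lies in \<open>J1\<close>, it may be decomposed as
  itself plus zero, and the value becomes T(f) w v = 0.\<close>

lemma conn_restrict1:
  assumes fr: "V1.frac a b s f"
  shows "conn (V.cls s f) = mzero K a (TOb K b)"
proof -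
  note fr' = V1.fracD [OF fr]
  obtain v w where vw: "(s, v, w) \<in> Tri K"
    using Tri_cone fr' by meson
  note t = triD [OF vw]
  obtain z where z: "is_zero_object K z"
    using zero_object by blast
  have c: "choice s (Cod K v) z (Id K (Cod K v)) (mzero K z (Cod K v)) (Id K (Cod K v)) (mzero K (Cod K v) z) v w"
    using vw V1.W_tri [OF fr'(1) vw] V2.J_zero [OF z] biproduct_zero_right [OF _ z, of "Cod K v"] t
    by (simp add: choice_def)
  show ?thesis
    using conn_cls [OF P1.frac_mono [OF fr] kappaI [OF c]] tri_comp_wv [OF vw] t fr' by simp
qed

text \<open>Here the cone is decomposed as zero plus itself, so that its \<open>J1\<close>-component
  is zero from the start.\<close>

lemma conn_restrict2:
  assumes fr: "V2.frac a b s f"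
  shows "conn (V.cls s f) = mzero K a (TOb K b)"
proof -
  note fr' = V2.fracD [OF fr]
  obtain v w where vw: "(s, v, w) \<in> Tri K"
    using Tri_cone fr' by meson
  note t = triD [OF vw]
  obtain z where z: "is_zero_object K z"
    using zero_object by blast
  then have "z \<in> Ob K"
    by (simp add: zero_object_iff)
  have c: "choice s z (Cod K v) (mzero K z (Cod K v)) (Id K (Cod K v)) (mzero K (Cod K v) z) (Id K (Cod K v)) v w"
    using vw V2.W_tri [OF fr'(1) vw] V1.J_zero [OF z]
      biproduct_swap [OF biproduct_zero_right [OF _ z, of "Cod K v"]] t
    by (simp add: choice_def)
  show ?thesis
    using conn_cls [OF P2.frac_mono [OF fr] kappaI [OF c]] t fr' \<open>z \<in> Ob K\<close> by simp
qed

text \<open>Both fractions are pulled back to the fibre of \<open>a \<rightarrow> cone s1 \<oplus> cone s2\<close>. Their difference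
  factors there through a sum of objects of \<open>J1\<close> and \<open>J2\<close>, and its two components extend over
  \<open>Dom s1\<close> and over \<open>Dom s2\<close> respectively.\<close>

lemma glue:
  assumes fr1: "V1.frac a b s1 f1" and fr2: "V2.frac a b s2 f2" and eq: "V.cls s1 f1 = V.cls s2 f2"
  obtains f where "f \<in> Mor K" "Dom K f = a" "Cod K f = b"
    "quotient_functor K J1 f = V1.cls s1 f1" "quotient_functor K J2 f = V2.cls s2 f2"
proof -
  note F1 = V1.fracD [OF fr1] and F2 = V2.fracD [OF fr2]
  obtain v1 w1 where tri1: "(s1, v1, w1) \<in> Tri K"
    using Tri_cone F1 by meson
  obtain v2 w2 where tri2: "(s2, v2, w2) \<in> Tri K"
    using Tri_cone F2 by meson
  note t1 = triD [OF tri1] and t2 = triD [OF tri2]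
  define d1 d2 where "d1 = Cod K v1" "d2 = Cod K v2"
  have d1: "d1 \<in> J1" "Cod K v1 = d1" "Dom K v1 = a" "Dom K w1 = d1"
    and d2: "d2 \<in> J2" "Cod K v2 = d2" "Dom K v2 = a" "Dom K w2 = d2"
    using V1.W_tri [OF F1(1) tri1] V2.W_tri [OF F2(1) tri2] t1 t2 F1 F2 d1_d2_def by simp_all
  have dOb: "d1 \<in> Ob K" "d2 \<in> Ob K"
    using d1(1) d2(1) V1.J_Ob V2.J_Ob by blast+
  obtain c i1 i2 p1 p2 where bi: "is_biproduct K d1 d2 c i1 i2 p1 p2"
    using biproduct dOb by blast
  note b = biproductD [OF bi]
  obtain v where v: "v \<in> Mor K" "Dom K v = a" "Cod K v = c" and pv: "p1 \<cdot> v = v1" "p2 \<cdot> v = v2"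
    using biproduct_pair [OF bi t1(2) d1(3,2) t2(2) d2(3,2)] .
  obtain t w where tri: "(t, v, w) \<in> Tri K"
    using tri_fiber [OF v(1)] .
  note tt = triD [OF tri]
  define x where "x = Dom K t"
  have bi': "is_biproduct K d1 d2 (Cod K v) i1 i2 p1 p2"
    using bi v by simp
  have x: "Dom K t = x" "Cod K t = a" "Dom K w = c" "Cod K w = TOb K x" "x \<in> Ob K"
    using tt v x_def by simp_all
  \<comment> \<open>The cone of \<open>k1\<close> is \<open>d2\<close> and the cone of
    \<open>k2\<close> is \<open>d1\<close>: passing from \<open>s1\<close> to \<open>t\<close> costs
    only an object of \<open>J2\<close>, and this is why maps to objects of \<open>J1\<close> extend
    back over \<open>k1\<close>.\<close>
  obtain k1 j1 where k1: "k1 \<in> Mor K" "Dom K k1 = x" "Cod K k1 = Dom K s1" "s1 \<cdot> k1 = t"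
    "(k1, j1, w \<cdot> i2) \<in> Tri K" "w1 \<cdot> p1 = TMor K k1 \<cdot> w"
    using tri_component_fiber [OF tri bi', of s1 w1] tri1 pv x by auto
  obtain k2 j2 where k2: "k2 \<in> Mor K" "Dom K k2 = x" "Cod K k2 = Dom K s2" "s2 \<cdot> k2 = t"
    "(k2, j2, w \<cdot> i1) \<in> Tri K" "w2 \<cdot> p2 = TMor K k2 \<cdot> w"
    using tri_component_fiber [OF tri biproduct_swap [OF bi'], of s2 w2] tri2 pv x by auto
  have tW: "t \<in> V.W"
    using V.W_I [OF tri] V.J_biproduct [OF bi] d1(1) d2(1) J1_le J2_le v by auto
  have c1: "V.cls t (f1 \<cdot> k1) = V.cls s1 f1" "V.frac a b t (f1 \<cdot> k1)"
    and c2: "V.cls t (f2 \<cdot> k2) = V.cls s2 f2" "V.frac a b t (f2 \<cdot> k2)"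
    using V.cls_amplify [OF P1.frac_mono [OF fr1] k1(1,3)] V.R_amplify(2) [OF P1.frac_mono [OF fr1] k1(1,3)]
      V.cls_amplify [OF P2.frac_mono [OF fr2] k2(1,3)] V.R_amplify(2) [OF P2.frac_mono [OF fr2] k2(1,3)]
      k1(4) k2(4) tW by simp_all
  have "V.null (madd K (f1 \<cdot> k1) (mneg K (f2 \<cdot> k2)))"
    using V.cls_same_denominator [OF c1(2) c2(2)] c1(1) c2(1) eq by simp
  then obtain \<chi> \<psi> where chi: "\<chi> \<in> Mor K" "\<psi> \<in> Mor K" "Cod K \<chi> = Dom K \<psi>" "Cod K \<chi> \<in> J"
    "madd K (f1 \<cdot> k1) (mneg K (f2 \<cdot> k2)) = \<psi> \<cdot> \<chi>"
    by (auto simp: V.null_def)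
  have fk: "f1 \<cdot> k1 \<in> Mor K" "Dom K (f1 \<cdot> k1) = x" "Cod K (f1 \<cdot> k1) = b"
    "f2 \<cdot> k2 \<in> Mor K" "Dom K (f2 \<cdot> k2) = x" "Cod K (f2 \<cdot> k2) = b"
    using F1 F2 k1(1-3) k2(1-3) by simp_all
  have chi': "Dom K \<chi> = x" "Cod K \<psi> = b"
    using chi(1-3) arg_cong [OF chi(5), of "Dom K"] arg_cong [OF chi(5), of "Cod K"] fk by simp_all
  define e where "e = Cod K \<chi>"
  have chi'': "Cod K \<chi> = e" "Dom K \<psi> = e"
    using chi(3) e_def by simp_all
  obtain e1 e2 I1 I2 Q1 Q2 where e: "e1 \<in> J1" "e2 \<in> J2" "is_biproduct K e1 e2 e I1 I2 Q1 Q2"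
    using decompose chi(4) e_def by blast
  note be = biproductD [OF e(3)]
  have Te: "TOb K e1 \<in> J1" "TOb K e2 \<in> J2" "TOb K d1 \<in> J1"
    using V1.J_T V2.J_T e(1,2) be dOb d1 by simp_all
  note tk1 = triD [OF k1(5)] and tk2 = triD [OF k2(5)]
  have j: "Cod K j1 = d2" "Cod K j2 = d1" "Dom K j2 = Dom K s2"
    using tk1 tk2 k2(3) b x tt(3) by simp_all
  \<comment> \<open>The obstruction to extending the \<open>J1\<close>-component over
    \<open>k1\<close> is a map from \<open>d2\<close> in \<open>J2\<close> to
    \<open>TOb K e1\<close> in \<open>J1\<close>.\<close>
  have "TMor K (Q1 \<cdot> \<chi>) \<cdot> w \<cdot> i2 = mzero K d2 (TOb K e1)"
    using orth21 [of "TMor K (Q1 \<cdot> \<chi>) \<cdot> w \<cdot> i2"] chi(1) chi' chi'' be tt x b d2 Te by simp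
  then obtain h1 where h1: "h1 \<in> Mor K" "Dom K h1 = Dom K s1" "Cod K h1 = e1" "h1 \<cdot> k1 = Q1 \<cdot> \<chi>"
    using tri_extend [OF k1(5), of "Q1 \<cdot> \<chi>"] chi(1) chi' chi'' be k1(1-3) j by auto
  have "TMor K (Q2 \<cdot> \<chi>) \<cdot> w \<cdot> i1 = mzero K d1 (TOb K e2)"
    using orth12 [of "TMor K (Q2 \<cdot> \<chi>) \<cdot> w \<cdot> i1"] chi(1) chi' chi'' be tt x b d1 Te by simp
  then obtain h2 where h2: "h2 \<in> Mor K" "Dom K h2 = Dom K s2" "Cod K h2 = e2" "h2 \<cdot> k2 = Q2 \<cdot> \<chi>"
    using tri_extend [OF k2(5), of "Q2 \<cdot> \<chi>"] chi(1) chi' chi'' be k2(1-3) j by auto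
  define n1 n2 where "n1 = \<psi> \<cdot> I1 \<cdot> h1" "n2 = \<psi> \<cdot> I2 \<cdot> h2"
  have n: "n1 \<in> Mor K" "Dom K n1 = Dom K s1" "Cod K n1 = b" "n2 \<in> Mor K" "Dom K n2 = Dom K s2" "Cod K n2 = b"
    using h1(1-3) h2(1-3) chi(2) chi' chi'' be(1-15) n1_n2_def by simp_all
  have null1: "V1.null n1" and null2: "V2.null n2"
    using V1.null_through [OF e(1), of h1 "\<psi> \<cdot> I1"] V2.null_through [OF e(2), of h2 "\<psi> \<cdot> I2"]
      h1(1-3) h2(1-3) chi(2) chi' chi'' be(1-15) n1_n2_def by simp_all
  have nk: "n1 \<cdot> k1 = \<psi> \<cdot> I1 \<cdot> Q1 \<cdot> \<chi>" "n2 \<cdot> k2 = \<psi> \<cdot> I2 \<cdot> Q2 \<cdot> \<chi>"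
    using h1 h2 chi(1,2) chi' chi'' be(1-15) k1(1-3) k2(1-3) n1_n2_def by simp_all
  have "\<psi> \<cdot> \<chi> = \<psi> \<cdot> madd K (I1 \<cdot> Q1 \<cdot> \<chi>) (I2 \<cdot> Q2 \<cdot> \<chi>)"
    using biproduct_into [OF e(3) chi(1)] chi'' by simp
  then have split: "madd K (f1 \<cdot> k1) (mneg K (f2 \<cdot> k2)) = madd K (n1 \<cdot> k1) (n2 \<cdot> k2)"
    unfolding chi(5) nk using chi(1,2) chi' chi'' be(1-15) by simp
  have nkt: "n1 \<cdot> k1 \<in> Mor K" "Dom K (n1 \<cdot> k1) = x" "Cod K (n1 \<cdot> k1) = b"
    "n2 \<cdot> k2 \<in> Mor K" "Dom K (n2 \<cdot> k2) = x" "Cod K (n2 \<cdot> k2) = b"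
    using n k1(1-3) k2(1-3) by simp_all
  \<comment> \<open>The numerators are changed by null morphisms, which leaves their classes alone,
    so that they agree exactly on \<open>x\<close>.\<close>
  define g1 g2 where "g1 = madd K f1 (mneg K n1)" "g2 = madd K f2 n2"
  have g: "g1 \<in> Mor K" "Dom K g1 = Dom K s1" "Cod K g1 = b" "g2 \<in> Mor K" "Dom K g2 = Dom K s2" "Cod K g2 = b"
    using F1 F2 n g1_g2_def by simp_all
  have "g1 \<cdot> k1 = madd K (f1 \<cdot> k1) (mneg K (n1 \<cdot> k1))" "g2 \<cdot> k2 = madd K (f2 \<cdot> k2) (n2 \<cdot> k2)"
    using F1 F2 n k1(1-3) k2(1-3) g1_g2_def by simp_all
  then have gk: "g1 \<cdot> k1 = g2 \<cdot> k2"
    using madd_exchange [OF fk(1,4) nkt(1,4) fk(2,5) nkt(2,5) fk(3,6) nkt(3,6) split] by simp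
  \<comment> \<open>The obstruction to extending \<open>g1\<close> over \<open>s1\<close> is moved
    to the side of \<open>s2\<close>, where it contains the factor \<open>p2 \<cdot> i1\<close> =
    0.\<close>
  have "TMor K g1 \<cdot> w1 = TMor K g1 \<cdot> (w1 \<cdot> p1) \<cdot> i1"
    using b g t1 d1 by simp
  also have "\<dots> = TMor K (g1 \<cdot> k1) \<cdot> w \<cdot> i1"
    unfolding k1(6) using b(1-15) g k1(1-3) tt x by simp
  also have "\<dots> = TMor K g2 \<cdot> (w2 \<cdot> p2) \<cdot> i1"
    unfolding gk k2(6) using b(1-15) g k2(1-3) tt x by simp
  also have "\<dots> = mzero K d1 (TOb K b)"
    using b g t2 d2 F2 by simp
  finally obtain f where f: "f \<in> Mor K" "Dom K f = a" "Cod K f = b" "f \<cdot> s1 = g1"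
    using tri_extend [OF tri1 g(1,2)] g(3) d1 F1 by auto
  have fs: "f \<cdot> s2 \<in> Mor K" "Dom K (f \<cdot> s2) = Dom K s2" "Cod K (f \<cdot> s2) = b"
    using f(1-3) F2(2,5) by simp_all
  have "f \<cdot> s2 \<cdot> k2 = f \<cdot> s1 \<cdot> k1"
    using k1(4) k2(4) by simp
  also have "\<dots> = g2 \<cdot> k2"
    using Comp_reduce [OF f(4), of k1] f(1,2) F1(2,5) k1(1,3) gk by simp
  finally have "madd K (f \<cdot> s2) (mneg K g2) \<cdot> k2 = mzero K x b"
    using f(1-3) F2(2,5) k2(1-3) g by simp
  \<comment> \<open>\<open>f\<close> restricts to \<open>g1\<close> exactly, but to
    \<open>g2\<close> only after passing to \<open>x\<close>; the error is therefore a map through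
    the cone \<open>d1\<close> of \<open>k2\<close>.\<close>
  then obtain u where u: "u \<in> Mor K" "Dom K u = d1" "Cod K u = b" "u \<cdot> j2 = madd K (f \<cdot> s2) (mneg K g2)"
    using tri_factor_v [OF k2(5), of "madd K (f \<cdot> s2) (mneg K g2)"] fs g k2(1-3) j by auto
  \<comment> \<open>A map from \<open>J2\<close> to \<open>J1\<close> again, so \<open>j2\<close>
    extends to all of \<open>a\<close>, and the error can be subtracted there.\<close>
  have "TMor K j2 \<cdot> w2 = mzero K d2 (TOb K d1)"
    using orth21 [of "TMor K j2 \<cdot> w2"] tk2(2) j t2 d2 Te by simp
  then obtain r where r: "r \<in> Mor K" "Dom K r = a" "Cod K r = d1" "r \<cdot> s2 = j2"
    using tri_extend [OF tri2 tk2(2)] j d2 F2 by auto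
  \<comment> \<open>The correction makes \<open>h \<cdot> s2\<close> equal to \<open>g2\<close>. On
    \<open>s1\<close> it changes \<open>g1\<close> by a map through \<open>d1\<close>, which is
    invisible modulo \<open>J1\<close>.\<close>
  define h where "h = madd K f (mneg K (u \<cdot> r))"
  have h: "h \<in> Mor K" "Dom K h = a" "Cod K h = b"
    using f(1-3) u(1-3) r(1-3) h_def by simp_all
  have "h \<cdot> s2 = madd K (f \<cdot> s2) (mneg K (u \<cdot> j2))"
    unfolding h_def using f(1-3) u(1-3) r F2(2,5) by simp
  also have "\<dots> = g2"
    unfolding u(4) using fs g by simp
  finally have hs2: "h \<cdot> s2 = g2" .
  have hs1: "h \<cdot> s1 = madd K g1 (mneg K (u \<cdot> r \<cdot> s1))"
    unfolding h_def using f u(1-3) r(1-3) F1(2,5) by simp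
  have "V1.null (mneg K (u \<cdot> r \<cdot> s1))"
    using V1.null_mneg V1.null_through [OF d1(1), of "r \<cdot> s1" u] u(1-3) r(1-3) F1(2,5) by simp
  then have "V1.null (madd K (mneg K n1) (mneg K (u \<cdot> r \<cdot> s1)))"
    using V1.null_madd V1.null_mneg [OF null1] n u(1-3) r(1-3) F1(2,5) by simp
  also have "madd K (mneg K n1) (mneg K (u \<cdot> r \<cdot> s1)) = madd K (h \<cdot> s1) (mneg K f1)"
    unfolding hs1 g1_g2_def using n u(1-3) r(1-3) F1(2-6) by (simp add: madd_ac)
  finally have N1: "V1.null (madd K (h \<cdot> s1) (mneg K f1))" .
  have "n2 = madd K (h \<cdot> s2) (mneg K f2)"
    unfolding hs2 g1_g2_def using n F2(2-6) by (simp add: madd_ac)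
  then have N2: "V2.null (madd K (h \<cdot> s2) (mneg K f2))"
    using null2 by simp
  have "V1.frac a b s1 (h \<cdot> s1)" "V2.frac a b s2 (h \<cdot> s2)"
    using h F1(1-5) F2(1-5) by (simp_all add: V1.frac_def V2.frac_def)
  then have "V1.cls s1 (h \<cdot> s1) = V1.cls s1 f1" "V2.cls s2 (h \<cdot> s2) = V2.cls s2 f2"
    using V1.cls_same_denominator [OF _ fr1] V2.cls_same_denominator [OF _ fr2] N1 N2 by blast+
  then show ?thesis
    using that [OF h] V1.quotient_functor_cls_denominator [OF h(1) F1(1)]
      V2.quotient_functor_cls_denominator [OF h(1) F2(1)] h(2) F1(5) F2(5) by simp
qed

text \<open>The fibres \<open>m\<close> and \<open>m'\<close> of the two components of
  \<open>v\<close> have cones \<open>c1\<close> and \<open>c2\<close>, and \<open>s\<close> factors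
  through both as \<open>m \<cdot> k\<close> and \<open>m' \<cdot> k'\<close>. Vanishing of the
  connecting morphism allows \<open>f\<close> to be written as \<open>l \<cdot> k\<close> plus
  \<open>f2 \<cdot> k'\<close>, one summand for each fibre.\<close>

lemma conn_zero_split:
  assumes fr: "V.frac a b s f" and zero: "conn (V.cls s f) = mzero K a (TOb K b)"
  obtains s1 f1 s2 f2 where "V1.frac a b s1 f1" "V2.frac a b s2 f2"
    "V.cls s f = V.cls s1 f1 \<otimes>\<^bsub>V.G a b\<^esub> V.cls s2 f2"
proof -
  note F = V.fracD [OF fr]
  obtain c1 c2 i1 i2 p1 p2 v w where c: "choice s c1 c2 i1 i2 p1 p2 v w"
    using choice_exists [OF F(1)] by blast
  note t = choice_typing [OF c] and d = choiceD [OF c]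
  have dv: "Dom K v = a"
    using t(4) F(5) by simp
  have eq: "TMor K f \<cdot> w \<cdot> i1 \<cdot> p1 \<cdot> v = mzero K a (TOb K b)"
    using conn_cls [OF fr kappaI [OF c]] zero by simp
  have pM: "p1 \<cdot> v \<in> Mor K" "p2 \<cdot> v \<in> Mor K"
    using t by simp_all
  obtain m n where m: "(m, p1 \<cdot> v, n) \<in> Tri K"
    using tri_fiber [OF pM(1)] .
  obtain m' n' where m': "(m', p2 \<cdot> v, n') \<in> Tri K"
    using tri_fiber [OF pM(2)] .
  have tm: "m \<in> Mor K" "n \<in> Mor K" "Cod K m = a" "Dom K n = c1" "Cod K n = TOb K (Dom K m)"
    using triD [OF m] t dv by simp_all
  have tm': "m' \<in> Mor K" "n' \<in> Mor K" "Cod K m' = a" "Dom K n' = c2" "Cod K n' = TOb K (Dom K m')"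
    using triD [OF m'] t dv by simp_all
  obtain k j where k: "k \<in> Mor K" "Dom K k = Dom K s" "Cod K k = Dom K m" "m \<cdot> k = s"
    "(k, j, w \<cdot> i2) \<in> Tri K" "n \<cdot> p1 = TMor K k \<cdot> w"
    using tri_component_fiber [OF d(4,3) m] by blast
  obtain k' j' where k': "k' \<in> Mor K" "Dom K k' = Dom K s" "Cod K k' = Dom K m'" "m' \<cdot> k' = s"
    "(k', j', w \<cdot> i1) \<in> Tri K" "n' \<cdot> p2 = TMor K k' \<cdot> w"
    using tri_component_fiber [OF d(4) biproduct_swap [OF d(3)] m'] by blast
  have "(TMor K f \<cdot> w \<cdot> i1) \<cdot> p1 \<cdot> v = mzero K (Cod K m) (TOb K b)"
    using eq t F tm by simp
  \<comment> \<open>The vanishing hypothesis says that T(f) \<gamma> kills \<alpha>, so it factors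
    through the third map \<open>n\<close> of the triangle on \<alpha>.\<close>
  then obtain g where g: "g \<in> Mor K" "Dom K g = TOb K (Dom K m)" "Cod K g = TOb K b"
    "g \<cdot> n = TMor K f \<cdot> w \<cdot> i1"
    using tri_factor_w [OF m, of "TMor K f \<cdot> w \<cdot> i1"] t F tm by auto
  obtain l where l: "l \<in> Mor K" "Dom K l = Dom K m" "Cod K l = b" "TMor K l = g"
    using TMor_surj [OF g(1-3)] tm F by auto
  have lk: "l \<cdot> k \<in> Mor K" "Dom K (l \<cdot> k) = Dom K f" "Cod K (l \<cdot> k) = b"
    using l k(1-3) F by simp_all
  have "TMor K (l \<cdot> k) \<cdot> w \<cdot> i1 = g \<cdot> (TMor K k \<cdot> w) \<cdot> i1"
    using l k(1-3) g(1-3) t by simp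
  also have "\<dots> = g \<cdot> n"
    unfolding k(6) [symmetric] using g(1-3) tm t biproductD(16) [OF d(3)] by simp
  \<comment> \<open>By the choice of \<open>l\<close>, the remainder of \<open>f\<close> has no
    obstruction on \<open>c1\<close>, the cone of \<open>k'\<close>, and thus extends over
    \<open>k'\<close>.\<close>
  finally have "TMor K (madd K f (mneg K (l \<cdot> k))) \<cdot> w \<cdot> i1 = mzero K c1 (TOb K b)"
    using g(4) lk F t TMor_madd [of f "mneg K (l \<cdot> k)"] TMor_mneg [OF lk(1)]
    by (simp del: TMor_Comp TMor_madd TMor_mneg)
  moreover have "Cod K j' = c1"
    using triD(5) [OF k'(5)] t by simp
  ultimately obtain f2 where f2: "f2 \<in> Mor K" "Dom K f2 = Dom K m'" "Cod K f2 = b"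
    "f2 \<cdot> k' = madd K f (mneg K (l \<cdot> k))"
    using tri_extend [OF k'(5), of "madd K f (mneg K (l \<cdot> k))"] lk F k'(2,3) by auto
  have fr1: "V1.frac a b m l" and fr2: "V2.frac a b m' f2"
    using V1.W_I [OF m] V2.W_I [OF m'] d(1,2) t tm tm' l f2 by (simp_all add: V1.frac_def V2.frac_def)
  have 1: "V.cls s (l \<cdot> k) = V.cls m l" "V.frac a b s (l \<cdot> k)"
    using V.cls_amplify [OF P1.frac_mono [OF fr1] k(1,3)] V.R_amplify(2) [OF P1.frac_mono [OF fr1] k(1,3)]
      k(4) F(1) by simp_all
  have 2: "V.cls s (f2 \<cdot> k') = V.cls m' f2" "V.frac a b s (f2 \<cdot> k')"
    using V.cls_amplify [OF P2.frac_mono [OF fr2] k'(1,3)] V.R_amplify(2) [OF P2.frac_mono [OF fr2] k'(1,3)]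
      k'(4) F(1) by simp_all
  have "madd K (l \<cdot> k) (f2 \<cdot> k') = f"
    unfolding f2(4) using lk F by simp
  then have "V.cls m l \<otimes>\<^bsub>V.G a b\<^esub> V.cls m' f2 = V.cls s f"
    using V.G_mult [OF 1(2) 2(2)] 1(1) 2(1) by simp
  then show ?thesis
    using that [OF fr1 fr2] by simp
qed

text \<open>Factorisations of \<open>h\<close> through \<open>J1\<close> and \<open>J2\<close>
  combine to a map \<open>v\<close> from \<open>a\<close> to a sum. Its fibre is the denominator,
  and the numerator is read off from the second halves of the factorisations.\<close>

lemma conn_surj:
  assumes h: "h \<in> Mor K" "Dom K h = a" "Cod K h = TOb K b" "b \<in> Ob K"
    and null: "V1.null h" "V2.null h"
  obtains s f where "V.frac a b s f" "conn (V.cls s f) = h"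
proof -
  obtain r1 h1 where r1: "r1 \<in> Mor K" "h1 \<in> Mor K" "Cod K r1 = Dom K h1" "Cod K r1 \<in> J1" "h = h1 \<cdot> r1"
    using null(1) by (auto simp: V1.null_def)
  obtain r2 h2 where r2: "r2 \<in> Mor K" "h2 \<in> Mor K" "Cod K r2 = Dom K h2" "Cod K r2 \<in> J2" "h = h2 \<cdot> r2"
    using null(2) by (auto simp: V2.null_def)
  define d1 d2 where "d1 = Cod K r1" "d2 = Cod K r2"
  have d: "Dom K r1 = a" "Dom K r2 = a" "Cod K r1 = d1" "Dom K h1 = d1" "Cod K r2 = d2" "Dom K h2 = d2"
    "Cod K h1 = TOb K b" "Cod K h2 = TOb K b" "d1 \<in> Ob K" "d2 \<in> Ob K"
    using h(2,3) unfolding r1(5) using r1(1-4) arg_cong [OF r2(5), of "Dom K"] arg_cong [OF r2(5), of "Cod K"]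
      r2(1-4) unfolding r1(5) by (simp_all add: d1_d2_def)
  obtain c i1 i2 p1 p2 where bi: "is_biproduct K d1 d2 c i1 i2 p1 p2"
    using biproduct d by blast
  note b = biproductD [OF bi]
  obtain v where v: "v \<in> Mor K" "Dom K v = a" "Cod K v = c" and pv: "p1 \<cdot> v = r1" "p2 \<cdot> v = r2"
    using biproduct_pair [OF bi r1(1) d(1,3) r2(1) d(2,5)] .
  obtain s w where tri: "(s, v, w) \<in> Tri K"
    using tri_fiber [OF v(1)] .
  note t = triD [OF tri]
  have choice: "choice s d1 d2 i1 i2 p1 p2 v w"
    using tri bi v r1(4) r2(4) d by (simp add: choice_def)
  \<comment> \<open>The sign makes \<open>m\<close> kill \<open>v\<close>, since both factorisations
    compose to \<open>h\<close>. On the first summand \<open>m\<close> is still \<open>h1\<close>,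
    which is all that the formula with \<gamma> \<alpha> sees.\<close>
  define m where "m = madd K (h1 \<cdot> p1) (mneg K (h2 \<cdot> p2))"
  have m: "m \<in> Mor K" "Dom K m = c" "Cod K m = TOb K b"
    using b(1-15) r1(2) r2(2) d m_def by simp_all
  have "m \<cdot> v = madd K (h1 \<cdot> r1) (mneg K (h2 \<cdot> r2))"
    unfolding m_def using b(1-15) r1(2) r2(2) d pv v by simp
  then have "m \<cdot> v = mzero K a (TOb K b)"
    using r1(5) r2(5) h by simp
  then obtain g where g: "g \<in> Mor K" "Dom K g = TOb K (Dom K s)" "Cod K g = TOb K b" "g \<cdot> w = m"
    using tri_factor_w [OF tri m(1)] t v m by auto
  obtain f where f: "f \<in> Mor K" "Dom K f = Dom K s" "Cod K f = b" "TMor K f = g"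
    using TMor_surj [OF g(1-3)] t h(4) by auto
  have "s \<in> V.W"
    using V.W_I [OF tri] V.J_biproduct [OF bi] r1(4) r2(4) d J1_le J2_le v by auto
  then have fr: "V.frac a b s f"
    using f t v by (simp add: V.frac_def)
  have "m \<cdot> i1 = h1"
    unfolding m_def using b r1(2) r2(2) d h(4) by simp
  then have "g \<cdot> w \<cdot> i1 = h1"
    using Comp_reduce [OF g(4), of i1] g(1-3) t b v by simp
  then have "g \<cdot> w \<cdot> i1 \<cdot> r1 = h1 \<cdot> r1"
    using Comp_reduce [of g "w \<cdot> i1" h1 r1] g(1-3) t b(1-15) v d r1 by simp
  then have "TMor K f \<cdot> w \<cdot> i1 \<cdot> p1 \<cdot> v = h"
    using f(4) pv r1(5) by simp
  then show ?thesis
    using that [OF fr] conn_cls [OF fr kappaI [OF choice]] by simp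
qed

section \<open>Exactness at the three kinds of terms\<close>

abbreviation pair_group where
  "pair_group a b \<equiv> V1.G a b \<times>\<times> V2.G a b"

definition res where
  "res f = (quotient_functor K J1 f, quotient_functor K J2 f)"

definition diff where
  "diff a b = (\<lambda>(X, Y). (V.R `` X) \<otimes>\<^bsub>V.G a b\<^esub> inv\<^bsub>V.G a b\<^esub> (V.R `` Y))"

lemma pair_comm_group:
  assumes "a \<in> Ob K" "b \<in> Ob K"
  shows "comm_group (pair_group a b)"
proof -
  interpret A: comm_group "V1.G a b"
    using V1.G_comm_group [OF assms] .
  interpret B: comm_group "V2.G a b"
    using V2.G_comm_group [OF assms] .
  show ?thesis
    by (rule group.group_comm_groupI [OF DirProd_group [OF A.is_group B.is_group]])
      (auto simp: A.m_comm B.m_comm)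
qed

lemma res_hom:
  assumes "a \<in> Ob K" "b \<in> Ob K"
  shows "group_hom (hom_group K a b) (pair_group a b) res"
proof -
  interpret h1: group_hom "hom_group K a b" "V1.G a b" "quotient_functor K J1"
    using V1.quotient_functor_hom [OF assms] .
  interpret h2: group_hom "hom_group K a b" "V2.G a b" "quotient_functor K J2"
    using V2.quotient_functor_hom [OF assms] .
  have "res \<in> hom (hom_group K a b) (pair_group a b)"
    by (rule homI) (simp_all add: res_def)
  then show ?thesis
    by (rule comm_group_homI [OF _ hom_comm_group [OF assms] pair_comm_group [OF assms]])
qed

lemma diff_hom:
  assumes "a \<in> Ob K" "b \<in> Ob K"
  shows "group_hom (pair_group a b) (V.G a b) (diff a b)"
proof -
  interpret h1: group_hom "V1.G a b" "V.G a b" "\<lambda>X. V.R `` X"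
    using P1.restrict_hom [OF assms] .
  interpret h2: group_hom "V2.G a b" "V.G a b" "\<lambda>X. V.R `` X"
    using P2.restrict_hom [OF assms] .
  interpret G: comm_group "V.G a b"
    using V.G_comm_group [OF assms] .
  have "diff a b \<in> hom (pair_group a b) (V.G a b)"
    by (rule homI) (auto simp: diff_def G.inv_mult G.m_ac)
  then show ?thesis
    by (rule comm_group_homI [OF _ pair_comm_group [OF assms] V.G_comm_group [OF assms]])
qed

lemma conn_hom:
  assumes "a \<in> Ob K" "b \<in> Ob K"
  shows "group_hom (V.G a b) (hom_group K a (TOb K b)) conn"
proof -
  have "conn \<in> hom (V.G a b) (hom_group K a (TOb K b))"
    using conn_closed conn_madd by (intro homI) (auto simp: hom_group_def)
  then show ?thesis
    by (rule comm_group_homI [OF _ V.G_comm_group [OF assms] hom_comm_group [OF assms(1) TOb_Ob [OF assms(2)]]])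
qed

lemma res_eq_one_iff:
  assumes "f \<in> Mor K" "Dom K f = a" "Cod K f = b"
  shows "res f = \<one>\<^bsub>pair_group a b\<^esub> \<longleftrightarrow> V1.null f \<and> V2.null f"
  using V1.quotient_functor_eq_one_iff [OF assms] V2.quotient_functor_eq_one_iff [OF assms]
  by (simp add: res_def)

lemma diff_cls:
  assumes "V1.frac a b s f" "V2.frac a b t g"
  shows "diff a b (V1.cls s f, V2.cls t g) = V.cls s f \<otimes>\<^bsub>V.G a b\<^esub> inv\<^bsub>V.G a b\<^esub> (V.cls t g)"
  using P1.restrict_cls [OF assms(1)] P2.restrict_cls [OF assms(2)] by (simp add: diff_def)

lemma exact_res_diff:
  assumes ob: "a \<in> Ob K" "b \<in> Ob K"
  shows "exact_at (hom_group K a b) res (pair_group a b) (diff a b) (V.G a b)"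
proof -
  interpret G: comm_group "V.G a b"
    using V.G_comm_group [OF ob] .
  have "kernel (pair_group a b) (V.G a b) (diff a b) = res ` carrier (hom_group K a b)"
  proof (intro equalityI subsetI)
    fix Z assume "Z \<in> kernel (pair_group a b) (V.G a b) (diff a b)"
    then obtain s f t g where st: "V1.frac a b s f" "V2.frac a b t g" "Z = (V1.cls s f, V2.cls t g)"
      "diff a b Z = \<one>\<^bsub>V.G a b\<^esub>"
      by (auto simp: kernel_def V1.G_carrier V2.G_carrier)
    have carr: "V.cls s f \<in> carrier (V.G a b)" "V.cls t g \<in> carrier (V.G a b)"
      using P1.frac_mono [OF st(1)] P2.frac_mono [OF st(2)] unfolding V.G_carrier by blast+
    have one: "V.cls s f \<otimes>\<^bsub>V.G a b\<^esub> inv\<^bsub>V.G a b\<^esub> (V.cls t g) = \<one>\<^bsub>V.G a b\<^esub>"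
      using st diff_cls [OF st(1,2)] by simp
    then have "V.cls s f = V.cls t g"
      using carr G.inv_equality [OF one] G.inv_closed by (metis G.inv_inv)
    then obtain h where h: "h \<in> Mor K" "Dom K h = a" "Cod K h = b"
      "quotient_functor K J1 h = V1.cls s f" "quotient_functor K J2 h = V2.cls t g"
      using glue [OF st(1,2)] by blast
    then have "Z = res h" "h \<in> carrier (hom_group K a b)"
      using st(3) by (simp_all add: res_def hom_group_def)
    then show "Z \<in> res ` carrier (hom_group K a b)"
      by blast
  next
    fix Z assume "Z \<in> res ` carrier (hom_group K a b)"
    then obtain h where h: "h \<in> Mor K" "Dom K h = a" "Cod K h = b" "Z = res h"
      by (auto simp: hom_group_def)
    have fr: "V1.frac a b (Id K a) h" "V2.frac a b (Id K a) h"
      using V1.frac_Id [OF h(1)] V2.frac_Id [OF h(1)] h by simp_all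
    have Z: "Z = (V1.cls (Id K a) h, V2.cls (Id K a) h)"
      using h V1.quotient_functor_cls V2.quotient_functor_cls by (simp add: res_def)
    have "V.cls (Id K a) h \<in> carrier (V.G a b)"
      using P1.frac_mono [OF fr(1)] unfolding V.G_carrier by blast
    then have "diff a b Z = \<one>\<^bsub>V.G a b\<^esub>"
      using diff_cls [OF fr] Z by simp
    moreover have "Z \<in> carrier (pair_group a b)"
      using Z fr by (auto simp: V1.G_carrier V2.G_carrier)
    ultimately show "Z \<in> kernel (pair_group a b) (V.G a b) (diff a b)"
      by (simp add: kernel_def)
  qed
  then show ?thesis
    unfolding exact_at_def
    using hom_comm_group [OF ob] pair_comm_group [OF ob] V.G_comm_group [OF ob] res_hom [OF ob]
      diff_hom [OF ob] by blast
qed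

lemma kernel_conn:
  assumes ob: "a \<in> Ob K" "b \<in> Ob K"
  shows "kernel (V.G a b) (hom_group K a (TOb K b)) conn = diff a b ` carrier (pair_group a b)"
proof (intro equalityI subsetI)
  fix X assume "X \<in> kernel (V.G a b) (hom_group K a (TOb K b)) conn"
  then obtain s f where X: "V.frac a b s f" "X = V.cls s f" "conn X = mzero K a (TOb K b)"
    by (auto simp: kernel_def V.G_carrier hom_group_def [of K])
  obtain s1 f1 s2 f2 where fr: "V1.frac a b s1 f1" "V2.frac a b s2 f2"
    "X = V.cls s1 f1 \<otimes>\<^bsub>V.G a b\<^esub> V.cls s2 f2"
    using conn_zero_split [OF X(1)] X by blast
  \<comment> \<open>\<open>conn_zero_split\<close> yields a sum whereas \<open>diff\<close> is a
    difference, so the second numerator enters negated.\<close>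
  have "inv\<^bsub>V.G a b\<^esub> (V.cls s2 (mneg K f2)) = V.cls s2 f2"
    using V.G_inv [OF V.frac_mneg [OF P2.frac_mono [OF fr(2)]]] V2.fracD(3) [OF fr(2)] by simp
  then have "X = diff a b (V1.cls s1 f1, V2.cls s2 (mneg K f2))"
    using diff_cls [OF fr(1) V2.frac_mneg [OF fr(2)]] fr(3) by simp
  moreover have "(V1.cls s1 f1, V2.cls s2 (mneg K f2)) \<in> carrier (pair_group a b)"
    using fr V2.frac_mneg [OF fr(2)] unfolding carrier_DirProd V1.G_carrier V2.G_carrier by blast
  ultimately show "X \<in> diff a b ` carrier (pair_group a b)"
    by blast
next
  interpret c: group_hom "V.G a b" "hom_group K a (TOb K b)" conn
    using conn_hom [OF ob] .
  fix X assume "X \<in> diff a b ` carrier (pair_group a b)"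
  then obtain s f t g where st: "V1.frac a b s f" "V2.frac a b t g"
    "X = diff a b (V1.cls s f, V2.cls t g)"
    by (auto simp: V1.G_carrier V2.G_carrier)
  have carr: "V.cls s f \<in> carrier (V.G a b)" "V.cls t g \<in> carrier (V.G a b)"
    using P1.frac_mono [OF st(1)] P2.frac_mono [OF st(2)] unfolding V.G_carrier by blast+
  have "conn (V.cls s f) = \<one>\<^bsub>hom_group K a (TOb K b)\<^esub>" "conn (V.cls t g) = \<one>\<^bsub>hom_group K a (TOb K b)\<^esub>"
    using conn_restrict1 [OF st(1)] conn_restrict2 [OF st(2)] by (simp_all add: hom_group_def)
  then have "conn X = \<one>\<^bsub>hom_group K a (TOb K b)\<^esub>"
    using st(3) diff_cls [OF st(1,2)] carr by simp
  then show "X \<in> kernel (V.G a b) (hom_group K a (TOb K b)) conn"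
    using st(3) diff_cls [OF st(1,2)] carr by (simp add: kernel_def)
qed

lemma exact_diff_conn:
  assumes ob: "a \<in> Ob K" "b \<in> Ob K"
  shows "exact_at (pair_group a b) (diff a b) (V.G a b) conn (hom_group K a (TOb K b))"
  unfolding exact_at_def
  using hom_comm_group [OF ob(1) TOb_Ob [OF ob(2)]] pair_comm_group [OF ob] V.G_comm_group [OF ob]
    diff_hom [OF ob] conn_hom [OF ob] kernel_conn [OF ob] by blast

lemma conn_image:
  assumes ob: "a \<in> Ob K" "b \<in> Ob K" and h: "h \<in> Mor K" "Dom K h = a" "Cod K h = TOb K b"
  shows "h \<in> conn ` carrier (V.G a b) \<longleftrightarrow> V1.null h \<and> V2.null h"
proof
  assume "V1.null h \<and> V2.null h"
  then obtain s f where "V.frac a b s f" "conn (V.cls s f) = h"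
    using conn_surj [OF h ob(2)] by blast
  then show "h \<in> conn ` carrier (V.G a b)"
    unfolding V.G_carrier by blast
qed (use conn_null in blast)

lemma exact_conn_res:
  assumes ob: "a \<in> Ob K" "b \<in> Ob K"
  shows "exact_at (V.G a b) conn (hom_group K a (TOb K b)) res (pair_group a (TOb K b))"
proof -
  have "h \<in> kernel (hom_group K a (TOb K b)) (pair_group a (TOb K b)) res \<longleftrightarrow> h \<in> conn ` carrier (V.G a b)" for h
    using res_eq_one_iff [of h a "TOb K b"] conn_image [OF ob, of h] conn_closed [of _ a b]
    by (auto simp: kernel_def hom_group_def [of K])
  then have "kernel (hom_group K a (TOb K b)) (pair_group a (TOb K b)) res = conn ` carrier (V.G a b)"
    by blast
  then show ?thesis
    unfolding exact_at_def
    using hom_comm_group [OF ob(1) TOb_Ob [OF ob(2)]] pair_comm_group [OF ob(1) TOb_Ob [OF ob(2)]]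
      V.G_comm_group [OF ob] res_hom [OF ob(1) TOb_Ob [OF ob(2)]] conn_hom [OF ob] by blast
qed

section \<open>The desuspended connecting map\<close>

definition desusp where
  "desusp a b g = inv_into (Hom K a b) (TMor K) (conn g)"

lemma desusp:
  assumes ob: "a \<in> Ob K" "b \<in> Ob K" and X: "X \<in> carrier (V.G (TOb K a) b)"
  shows "desusp a b X \<in> Mor K" "Dom K (desusp a b X) = a" "Cod K (desusp a b X) = b"
    "TMor K (desusp a b X) = conn X"
proof -
  have bij: "TMor K ` Hom K a b = Hom K (TOb K a) (TOb K b)"
    using T_fully_faithful [OF ob] by (rule bij_betw_imp_surj_on)
  have "conn X \<in> TMor K ` Hom K a b"
    unfolding bij using conn_closed [OF X] by simp
  then have "desusp a b X \<in> Hom K a b" "TMor K (desusp a b X) = conn X"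
    unfolding desusp_def by (rule inv_into_into, rule f_inv_into_f)
  then show "desusp a b X \<in> Mor K" "Dom K (desusp a b X) = a" "Cod K (desusp a b X) = b"
    "TMor K (desusp a b X) = conn X"
    by simp_all
qed

lemma desusp_eq_zero_iff:
  assumes ob: "a \<in> Ob K" "b \<in> Ob K" and X: "X \<in> carrier (V.G (TOb K a) b)"
  shows "desusp a b X = mzero K a b \<longleftrightarrow> conn X = mzero K (TOb K a) (TOb K b)"
  using desusp [OF assms] TMor_inj [of "desusp a b X" "mzero K a b"] ob by auto

lemma desusp_hom:
  assumes ob: "a \<in> Ob K" "b \<in> Ob K"
  shows "group_hom (V.G (TOb K a) b) (hom_group K a b) (desusp a b)"
proof -
  interpret G: comm_group "V.G (TOb K a) b"
    using V.G_comm_group ob by simp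
  have "desusp a b (X \<otimes>\<^bsub>V.G (TOb K a) b\<^esub> Y) = madd K (desusp a b X) (desusp a b Y)"
    if XY: "X \<in> carrier (V.G (TOb K a) b)" "Y \<in> carrier (V.G (TOb K a) b)" for X Y
  proof (rule TMor_inj)
    note X = desusp [OF ob XY(1)] and Y = desusp [OF ob XY(2)] and Z = desusp [OF ob G.m_closed [OF XY]]
    show "TMor K (desusp a b (X \<otimes>\<^bsub>V.G (TOb K a) b\<^esub> Y)) = TMor K (madd K (desusp a b X) (desusp a b Y))"
      using conn_madd [OF XY] X Y Z by simp
  qed (use desusp [OF ob XY(1)] desusp [OF ob XY(2)] desusp [OF ob G.m_closed [OF XY]] in simp_all)
  then have "desusp a b \<in> hom (V.G (TOb K a) b) (hom_group K a b)"
    using desusp [OF ob] by (intro homI) (auto simp: hom_group_def [of K])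
  then show ?thesis
    by (rule comm_group_homI [OF _ V.G_comm_group [OF TOb_Ob [OF ob(1)] ob(2)] hom_comm_group [OF ob]])
qed

lemma exact_diff_desusp:
  assumes ob: "a \<in> Ob K" "b \<in> Ob K"
  shows "exact_at (pair_group (TOb K a) b) (diff (TOb K a) b) (V.G (TOb K a) b) (desusp a b) (hom_group K a b)"
proof -
  have "X \<in> kernel (V.G (TOb K a) b) (hom_group K a b) (desusp a b) \<longleftrightarrow>
      X \<in> kernel (V.G (TOb K a) b) (hom_group K (TOb K a) (TOb K b)) conn" for X
    using desusp_eq_zero_iff [OF ob, of X] by (auto simp: kernel_def hom_group_def [of K])
  then have "kernel (V.G (TOb K a) b) (hom_group K a b) (desusp a b) =
      diff (TOb K a) b ` carrier (pair_group (TOb K a) b)"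
    using kernel_conn [of "TOb K a" b] ob by auto
  then show ?thesis
    unfolding exact_at_def
    using hom_comm_group [OF ob] pair_comm_group [OF TOb_Ob [OF ob(1)] ob(2)]
      V.G_comm_group [OF TOb_Ob [OF ob(1)] ob(2)] diff_hom [OF TOb_Ob [OF ob(1)] ob(2)] desusp_hom [OF ob]
    by blast
qed

lemma exact_desusp_res:
  assumes ob: "a \<in> Ob K" "b \<in> Ob K"
  shows "exact_at (V.G (TOb K a) b) (desusp a b) (hom_group K a b) res (pair_group a b)"
proof -
  have "h \<in> kernel (hom_group K a b) (pair_group a b) res \<longleftrightarrow> h \<in> desusp a b ` carrier (V.G (TOb K a) b)" for h
  proof
    assume "h \<in> kernel (hom_group K a b) (pair_group a b) res"
    then have h: "h \<in> Mor K" "Dom K h = a" "Cod K h = b" "V1.null h" "V2.null h"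
      using res_eq_one_iff [of h a b] by (auto simp: kernel_def hom_group_def [of K])
    \<comment> \<open>Nullity passes to the suspension, where the image of the connecting map is
      already known.\<close>
    then have "TMor K h \<in> conn ` carrier (V.G (TOb K a) b)"
      using conn_image [of "TOb K a" b "TMor K h"] V1.null_TMor_iff V2.null_TMor_iff ob by simp
    then obtain X where X: "X \<in> carrier (V.G (TOb K a) b)" "conn X = TMor K h"
      by auto
    then have "desusp a b X = h"
      using desusp [OF ob X(1)] h(1-3) by - (rule TMor_inj; simp)
    then show "h \<in> desusp a b ` carrier (V.G (TOb K a) b)"
      using X by blast
  next
    assume "h \<in> desusp a b ` carrier (V.G (TOb K a) b)"
    then obtain X where X: "X \<in> carrier (V.G (TOb K a) b)" "h = desusp a b X"
      by blast
    note d = desusp [OF ob X(1)]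
    have "V1.null h" "V2.null h"
      using V1.null_TMor_iff [OF d(1)] V2.null_TMor_iff [OF d(1)] conn_null [OF X(1)] d(4) X(2) by simp_all
    then show "h \<in> kernel (hom_group K a b) (pair_group a b) res"
      using res_eq_one_iff [of h a b] d X(2) by (auto simp: kernel_def hom_group_def [of K])
  qed
  then have "kernel (hom_group K a b) (pair_group a b) res = desusp a b ` carrier (V.G (TOb K a) b)"
    by blast
  then show ?thesis
    unfolding exact_at_def
    using hom_comm_group [OF ob] pair_comm_group [OF ob] V.G_comm_group [OF TOb_Ob [OF ob(1)] ob(2)]
      res_hom [OF ob] desusp_hom [OF ob] by blast
qed

end

section \<open>Prime ideals and supports\<close>

context triangulated_category
begin

text \<open>Applied to tensoring with a fixed object, this yields the transporters. The functor
  commutes with T only up to \<phi>, so closure of \<open>P\<close> under isomorphism is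
  needed.\<close>

lemma exact_functor_preimage:
  assumes ex: "exact_functor K F0 F1 \<phi>" and P: "triangulated_subcategory K P"
  shows "triangulated_subcategory K {a \<in> Ob K. F0 a \<in> P}"
proof -
  interpret V: verdier K P
    by unfold_locales (rule P)
  have F: "is_functor K K F0 F1" "additive_on_homs K K F1"
    and iso: "\<And>a. a \<in> Ob K \<Longrightarrow> is_iso K (\<phi> a) (F0 (TOb K a)) (TOb K (F0 a))"
    and tri: "\<And>u v w. (u, v, w) \<in> Tri K \<Longrightarrow> (F1 u, F1 v, \<phi> (Dom K u) \<cdot> F1 w) \<in> Tri K"
    using ex unfolding exact_functor_def by blast+
  show ?thesis
  proof (rule triangulated_subcategoryI)
    show "z \<in> {a \<in> Ob K. F0 a \<in> P}" if "is_zero_object K z" for z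
      using that V.J_zero [OF functor_zero_object [OF F that]] by (simp add: zero_object_iff)
    show "TOb K a \<in> {a \<in> Ob K. F0 a \<in> P} \<longleftrightarrow> a \<in> {a \<in> Ob K. F0 a \<in> P}" if a: "a \<in> Ob K" for a
    proof -
      obtain g where g: "is_iso K g (TOb K (F0 a)) (F0 (TOb K a))"
        using is_iso_sym [OF iso [OF a]] by blast
      have "F0 (TOb K a) \<in> P \<longleftrightarrow> TOb K (F0 a) \<in> P"
        using V.J_iso [OF g] V.J_iso [OF iso [OF a]] by blast
      then show ?thesis
        using V.J_T [OF functor_Ob [OF F(1) a]] a by simp
    qed
    show "Cod K v \<in> {a \<in> Ob K. F0 a \<in> P}"
      if t: "(u, v, w) \<in> Tri K" and d: "Dom K u \<in> {a \<in> Ob K. F0 a \<in> P}"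
        and c: "Cod K u \<in> {a \<in> Ob K. F0 a \<in> P}" for u v w
      using V.J_tri(1) [OF tri [OF t]] d c triD [OF t] functor_simps [OF F(1)] by simp
  qed auto
qed

lemma exact_functor_preimage_thick:
  assumes ex: "exact_functor K F0 F1 \<phi>" and P: "thick K P"
  shows "thick K {a \<in> Ob K. F0 a \<in> P}"
proof -
  have F: "is_functor K K F0 F1" "additive_on_homs K K F1"
    using ex unfolding exact_functor_def by blast+
  show ?thesis
    unfolding thick_def
  proof (intro allI impI)
    fix a b c i1 i2 p1 p2
    assume bi: "is_biproduct K a b c i1 i2 p1 p2" and c: "c \<in> {a \<in> Ob K. F0 a \<in> P}"
    have "F0 a \<in> P \<and> F0 b \<in> P"
      using P functor_biproduct [OF F bi] c unfolding thick_def by blast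
    then show "a \<in> {a \<in> Ob K. F0 a \<in> P} \<and> b \<in> {a \<in> Ob K. F0 a \<in> P}"
      using biproductD [OF bi] by simp
  qed
qed

end

section \<open>Tensor ideals\<close>

context tensor_triangulated_category
begin

lemma tensor_right_exact:
  assumes "b \<in> Ob K"
  obtains \<phi> where "exact_functor K (\<lambda>a. a \<otimes>\<^sub>o b) (\<lambda>f. f \<otimes>\<^sub>m Id K b) \<phi>"
  using tensor_exact assms by blast

lemma tensor_left_exact:
  assumes "a \<in> Ob K"
  obtains \<phi> where "exact_functor K (\<lambda>b. a \<otimes>\<^sub>o b) (\<lambda>f. Id K a \<otimes>\<^sub>m f) \<phi>"
  using tensor_exact assms by blast

lemma tensor_zero:
  assumes "is_zero_object K z" "a \<in> Ob K"
  shows "is_zero_object K (a \<otimes>\<^sub>o z)" "is_zero_object K (z \<otimes>\<^sub>o a)"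
proof -
  obtain \<phi> \<psi> where "exact_functor K (\<lambda>b. a \<otimes>\<^sub>o b) (\<lambda>f. Id K a \<otimes>\<^sub>m f) \<phi>"
    "exact_functor K (\<lambda>b. b \<otimes>\<^sub>o a) (\<lambda>f. f \<otimes>\<^sub>m Id K a) \<psi>"
    using tensor_left_exact tensor_right_exact assms(2) by meson
  then have F: "is_functor K K (\<lambda>b. a \<otimes>\<^sub>o b) (\<lambda>f. Id K a \<otimes>\<^sub>m f)" "additive_on_homs K K (\<lambda>f. Id K a \<otimes>\<^sub>m f)"
    "is_functor K K (\<lambda>b. b \<otimes>\<^sub>o a) (\<lambda>f. f \<otimes>\<^sub>m Id K a)" "additive_on_homs K K (\<lambda>f. f \<otimes>\<^sub>m Id K a)"
    unfolding exact_functor_def by blast+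
  show "is_zero_object K (a \<otimes>\<^sub>o z)" "is_zero_object K (z \<otimes>\<^sub>o a)"
    using functor_zero_object [OF F(1,2) assms(1)] functor_zero_object [OF F(3,4) assms(1)] .
qed

lemma tensor_right_biproduct:
  assumes "is_biproduct K a b c i1 i2 p1 p2" "d \<in> Ob K"
  obtains j1 j2 q1 q2 where "is_biproduct K (a \<otimes>\<^sub>o d) (b \<otimes>\<^sub>o d) (c \<otimes>\<^sub>o d) j1 j2 q1 q2"
proof -
  obtain \<phi> where "exact_functor K (\<lambda>b. b \<otimes>\<^sub>o d) (\<lambda>f. f \<otimes>\<^sub>m Id K d) \<phi>"
    using tensor_right_exact [OF assms(2)] .
  then show ?thesis
    using functor_biproduct [OF _ _ assms(1)] that unfolding exact_functor_def by blast
qed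

definition tt_ideal :: "'o set \<Rightarrow> bool" where
  "tt_ideal P \<longleftrightarrow> triangulated_subcategory K P \<and> thick K P \<and> (\<forall>a\<in>P. \<forall>b\<in>Ob K. a \<otimes>\<^sub>o b \<in> P)"

lemma tt_idealD:
  assumes "tt_ideal P"
  shows "verdier K P" "thick K P" "a \<in> P \<Longrightarrow> b \<in> Ob K \<Longrightarrow> a \<otimes>\<^sub>o b \<in> P" "P \<subseteq> Ob K"
proof -
  show "verdier K P"
    using assms triangulated_category_axioms unfolding tt_ideal_def verdier_def verdier_axioms_def by blast
  show "P \<subseteq> Ob K"
    using assms unfolding tt_ideal_def triangulated_subcategory_def by (elim conjE)
qed (use assms in \<open>unfold tt_ideal_def, blast+\<close>)

lemma tt_ideal_iso: "tt_ideal P \<Longrightarrow> is_iso K f a b \<Longrightarrow> a \<in> P \<Longrightarrow> b \<in> P"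
  by (rule verdier.J_iso [OF tt_idealD(1)])

lemma tt_ideal_biproduct:
  assumes "tt_ideal P" "is_biproduct K a b c i1 i2 p1 p2" "c \<in> P"
  shows "a \<in> P \<and> b \<in> P"
  using tt_idealD(2) [OF assms(1), unfolded thick_def, rule_format, OF assms(2,3)] .

lemma tt_ideal_comm:
  assumes "tt_ideal P" "a \<in> Ob K" "b \<in> Ob K"
  shows "a \<otimes>\<^sub>o b \<in> P \<longleftrightarrow> b \<otimes>\<^sub>o a \<in> P"
  using tt_ideal_iso [OF assms(1) Braid_iso] assms(2,3) by blast

lemma tt_ideal_left: "tt_ideal P \<Longrightarrow> a \<in> Ob K \<Longrightarrow> b \<in> P \<Longrightarrow> a \<otimes>\<^sub>o b \<in> P"
  using tt_ideal_comm tt_idealD(3,4) by blast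

lemma tt_ideal_assoc:
  assumes "tt_ideal P" "a \<in> Ob K" "b \<in> Ob K" "c \<in> Ob K"
  shows "(a \<otimes>\<^sub>o b) \<otimes>\<^sub>o c \<in> P \<longleftrightarrow> a \<otimes>\<^sub>o (b \<otimes>\<^sub>o c) \<in> P"
proof -
  obtain g where "is_iso K g (a \<otimes>\<^sub>o (b \<otimes>\<^sub>o c)) ((a \<otimes>\<^sub>o b) \<otimes>\<^sub>o c)"
    using is_iso_sym [OF Assoc_iso [OF assms(2-4)]] by blast
  then show ?thesis
    using tt_ideal_iso [OF assms(1)] Assoc_iso [OF assms(2-4)] by blast
qed

lemma tt_ideal_transporter:
  assumes P: "tt_ideal P" and b: "b \<in> Ob K"
  shows "tt_ideal {a \<in> Ob K. a \<otimes>\<^sub>o b \<in> P}"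
proof -
  obtain \<phi> where ex: "exact_functor K (\<lambda>a. a \<otimes>\<^sub>o b) (\<lambda>f. f \<otimes>\<^sub>m Id K b) \<phi>"
    using tensor_right_exact [OF b] .
  \<comment> \<open>Only \<otimes>-closure is not formal. The factors are permuted along c (a b), (c
    a) b, b (c a), b (a c), (a c) b.\<close>
  have "(a \<otimes>\<^sub>o c) \<otimes>\<^sub>o b \<in> P" if a: "a \<in> Ob K" "a \<otimes>\<^sub>o b \<in> P" and c: "c \<in> Ob K" for a c
  proof -
    have "c \<otimes>\<^sub>o (a \<otimes>\<^sub>o b) \<in> P"
      using tt_ideal_left [OF P c a(2)] .
    then have "b \<otimes>\<^sub>o (c \<otimes>\<^sub>o a) \<in> P"
      using tt_ideal_assoc [OF P c a(1) b] tt_ideal_comm [OF P _ b, of "c \<otimes>\<^sub>o a"] TensOb_closed a c by simp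
    moreover obtain \<psi> where "is_functor K K (\<lambda>x. b \<otimes>\<^sub>o x) (\<lambda>f. Id K b \<otimes>\<^sub>m f)"
      using tensor_left_exact [OF b] unfolding exact_functor_def by metis
    then have "is_iso K (Id K b \<otimes>\<^sub>m Braid K c a) (b \<otimes>\<^sub>o (c \<otimes>\<^sub>o a)) (b \<otimes>\<^sub>o (a \<otimes>\<^sub>o c))"
      by (rule functor_iso [OF _ Braid_iso [OF c a(1)]])
    ultimately have "b \<otimes>\<^sub>o (a \<otimes>\<^sub>o c) \<in> P"
      using tt_ideal_iso [OF P] by blast
    then show ?thesis
      using tt_ideal_comm [OF P _ b, of "a \<otimes>\<^sub>o c"] TensOb_closed a c by simp
  qed
  then show ?thesis
    using exact_functor_preimage [OF ex] exact_functor_preimage_thick [OF ex] P TensOb_closed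
    unfolding tt_ideal_def by auto
qed

lemma prime_tt_ideal_iff:
  "prime_tt_ideal K P \<longleftrightarrow> tt_ideal P \<and> P \<noteq> Ob K \<and>
    (\<forall>a\<in>Ob K. \<forall>b\<in>Ob K. a \<otimes>\<^sub>o b \<in> P \<longrightarrow> a \<in> P \<or> b \<in> P)"
  by (auto simp: prime_tt_ideal_def tt_ideal_def)

lemma Spc_tt_ideal: "P \<in> Spc K \<Longrightarrow> tt_ideal P"
  by (simp add: Spc_def prime_tt_ideal_iff)

text \<open>Relative to \<open>Ob K\<close>, the empty intersection is the whole category, so that
  the empty open set needs no separate treatment in \<open>tt_ideal_outside\<close>.\<close>

lemma tt_ideal_Inter:
  assumes "\<And>P. P \<in> U \<Longrightarrow> tt_ideal P"
  shows "tt_ideal {a \<in> Ob K. \<forall>P\<in>U. a \<in> P}"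
proof -
  let ?I = "{a \<in> Ob K. \<forall>P\<in>U. a \<in> P}"
  have V: "verdier K P" if "P \<in> U" for P
    using assms that tt_idealD(1) by blast
  have "triangulated_subcategory K ?I"
  proof (rule triangulated_subcategoryI)
    show "z \<in> ?I" if "is_zero_object K z" for z
      using verdier.J_zero [OF V] that by (simp add: zero_object_iff)
    show "TOb K a \<in> ?I \<longleftrightarrow> a \<in> ?I" if "a \<in> Ob K" for a
      using verdier.J_T [OF V] that by auto
    show "Cod K v \<in> ?I" if "(u, v, w) \<in> Tri K" "Dom K u \<in> ?I" "Cod K u \<in> ?I" for u v w
      using verdier.J_tri(1) [OF V that(1)] that triD [OF that(1)] by auto
  qed auto
  moreover have "thick K ?I"
    unfolding thick_def
  proof (intro allI impI)
    fix a b c i1 i2 p1 p2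
    assume bi: "is_biproduct K a b c i1 i2 p1 p2" and c: "c \<in> ?I"
    have "a \<in> P \<and> b \<in> P" if "P \<in> U" for P
      by (rule tt_ideal_biproduct [OF assms [OF that] bi]) (use c that in simp)
    then show "a \<in> ?I \<and> b \<in> ?I"
      using biproductD(1,2) [OF bi] by blast
  qed
  moreover have "\<forall>a\<in>?I. \<forall>b\<in>Ob K. a \<otimes>\<^sub>o b \<in> ?I"
    using tt_idealD(3) [OF assms] TensOb_closed by simp
  ultimately show ?thesis
    unfolding tt_ideal_def by blast
qed

text \<open>With this ideal, \<open>prime_avoiding\<close> says that an object contained in every
  prime is zero.\<close>

lemma tt_ideal_zero: "tt_ideal {z. is_zero_object K z}"
proof -
  let ?Z = "{z. is_zero_object K z}"
  have "triangulated_subcategory K ?Z"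
  proof (rule triangulated_subcategoryI)
    show "?Z \<subseteq> Ob K"
      by (auto simp: zero_object_iff)
    show "TOb K a \<in> ?Z \<longleftrightarrow> a \<in> ?Z" if a: "a \<in> Ob K" for a
    proof
      assume "TOb K a \<in> ?Z"
      then have "TMor K (Id K a) = TMor K (mzero K a a)"
        using a by (simp add: zero_object_iff)
      then have "Id K a = mzero K a a"
        using a by - (rule TMor_inj; simp)
      then show "a \<in> ?Z"
        using a by (simp add: zero_object_iff)
    qed (use T_zero_object in simp)
    show "Cod K v \<in> ?Z" if t: "(u, v, w) \<in> Tri K" and z: "Dom K u \<in> ?Z" "Cod K u \<in> ?Z" for u v w
    proof -
      note t' = triD [OF t]
      have "v = mzero K (Cod K u) (Cod K v)"
        by (rule zero_object_Mor(2)) (use z(2) t' in simp_all)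
      then have "Id K (Cod K v) \<cdot> v = mzero K (Cod K u) (Cod K (Id K (Cod K v)))"
        using t' by simp
      then obtain g where g: "g \<in> Mor K" "Dom K g = TOb K (Dom K u)" "Cod K g = Cod K v"
        "g \<cdot> w = Id K (Cod K v)"
        using tri_factor_w [OF t, of "Id K (Cod K v)"] t' by auto
      have "w = mzero K (Cod K v) (TOb K (Dom K u))"
        unfolding t'(5) [symmetric] by (rule zero_object_Mor(1)) (use z(1) T_zero_object t' in simp_all)
      then have "g \<cdot> w = mzero K (Cod K v) (Cod K v)"
        using g(1-3) t' by simp
      then show ?thesis
        using g(4) t' by (simp add: zero_object_iff)
    qed
  qed auto
  moreover have "thick K ?Z"
    unfolding thick_def
  proof (intro allI impI)
    fix a b c i1 i2 p1 p2
    assume bi: "is_biproduct K a b c i1 i2 p1 p2" and "c \<in> ?Z"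
    note b = biproductD [OF bi]
    have "i1 = mzero K a c" "i2 = mzero K b c"
      using zero_object_Mor(1) [of c i1] zero_object_Mor(1) [of c i2] \<open>c \<in> ?Z\<close> b(4-9) by blast+
    then have "p1 \<cdot> i1 = mzero K a a" "p2 \<cdot> i2 = mzero K b b"
      using b(1-15) by simp_all
    then show "a \<in> ?Z \<and> b \<in> ?Z"
      using b by (simp add: zero_object_iff)
  qed
  moreover have "\<forall>a\<in>?Z. \<forall>b\<in>Ob K. a \<otimes>\<^sub>o b \<in> ?Z"
    using tensor_zero by simp
  ultimately show ?thesis
    unfolding tt_ideal_def by blast
qed

text \<open>Adjunction turns \<open>f\<close> into a morphism \<open>1 \<rightarrow> hom(a, b) \<cong> D(a) \<otimes> b\<close>, so that \<open>f\<close> factors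
  through \<open>(D(a) \<otimes> b) \<otimes> a\<close>.\<close>

lemma dual_factorization:
  assumes sc: "strongly_closed K" and f: "f \<in> Mor K" "Dom K f = a" "Cod K f = b"
  obtains d g h where "d \<in> Ob K" "g \<in> Mor K" "h \<in> Mor K" "Dom K g = a" "Cod K g = (d \<otimes>\<^sub>o b) \<otimes>\<^sub>o a"
    "Dom K h = (d \<otimes>\<^sub>o b) \<otimes>\<^sub>o a" "Cod K h = b" "h \<cdot> g = f"
proof -
  obtain H0 H1 \<theta> where H: "biexact_hom K H0 H1" "closed_adjunction K H0 H1 \<theta>"
    "\<And>a b. a \<in> Ob K \<Longrightarrow> b \<in> Ob K \<Longrightarrow> is_iso K (dual_tensor_to_hom K H0 \<theta> a b) (H0 a (UnitOb K) \<otimes>\<^sub>o b) (H0 a b)"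
    using sc unfolding strongly_closed_def by blast
  let ?I = "UnitOb K"
  have ob: "a \<in> Ob K" "b \<in> Ob K" "?I \<in> Ob K"
    using f UnitOb_closed by auto
  define d where "d = H0 a ?I"
  have hom: "H0 a b \<in> Ob K" "H1 (Id K a) (Id K b) = Id K (H0 a b)" and d: "d \<in> Ob K"
    using H(1) ob unfolding biexact_hom_def d_def by blast+
  have db: "d \<otimes>\<^sub>o b \<in> Ob K" "(d \<otimes>\<^sub>o b) \<otimes>\<^sub>o a \<in> Ob K" "?I \<otimes>\<^sub>o a \<in> Ob K"
    using TensOb_closed d ob by simp_all
  obtain \<psi> \<psi>' where psi: "\<psi> \<in> Mor K" "\<psi>' \<in> Mor K" "Dom K \<psi> = d \<otimes>\<^sub>o b" "Cod K \<psi> = H0 a b"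
    "Dom K \<psi>' = H0 a b" "Cod K \<psi>' = d \<otimes>\<^sub>o b" "\<psi> \<cdot> \<psi>' = Id K (H0 a b)"
    using H(3) [OF ob(1,2)] unfolding d_def by (auto elim: is_isoE)
  have bij: "bij_betw (\<theta> x a b) (Hom K (x \<otimes>\<^sub>o a) b) (Hom K x (H0 a b))" if "x \<in> Ob K" for x
    using H(2) that ob unfolding closed_adjunction_def by blast
  \<comment> \<open>The isomorphism from D(a) \<otimes> b to hom(a,b) is itself the transpose of
    some \<open>e\<close>, which will be the second half of the factorisation.\<close>
  have "\<psi> \<in> \<theta> (d \<otimes>\<^sub>o b) a b ` Hom K ((d \<otimes>\<^sub>o b) \<otimes>\<^sub>o a) b"
    using bij_betw_imp_surj_on [OF bij [OF db(1)]] psi by simp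
  then obtain e where e: "e \<in> Hom K ((d \<otimes>\<^sub>o b) \<otimes>\<^sub>o a) b" "\<theta> (d \<otimes>\<^sub>o b) a b e = \<psi>"
    by blast
  obtain l where l: "LUnit K a \<in> Mor K" "l \<in> Mor K" "Dom K (LUnit K a) = ?I \<otimes>\<^sub>o a" "Cod K (LUnit K a) = a"
    "Dom K l = a" "Cod K l = ?I \<otimes>\<^sub>o a" "LUnit K a \<cdot> l = Id K a"
    using LUnit_iso [OF ob(1)] by (auto elim: is_isoE)
  define t where "t = \<theta> ?I a b (f \<cdot> LUnit K a)"
  have fl: "f \<cdot> LUnit K a \<in> Hom K (?I \<otimes>\<^sub>o a) b"
    using f l by simp
  have t: "t \<in> Hom K ?I (H0 a b)"
    unfolding t_def using bij_betwE [OF bij [OF ob(3)]] fl by blast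
  define g where "g = \<psi>' \<cdot> t"
  have g: "g \<in> Hom K ?I (d \<otimes>\<^sub>o b)" "\<psi> \<cdot> g = t"
    unfolding g_def using psi t Comp_reduce [OF psi(7), of t] by simp_all
  define g' where "g' = g \<otimes>\<^sub>m Id K a"
  have g': "g' \<in> Hom K (?I \<otimes>\<^sub>o a) ((d \<otimes>\<^sub>o b) \<otimes>\<^sub>o a)"
    unfolding g'_def using TensMor_closed [OF g(1) Id_closed [OF ob(1)]] .
  \<comment> \<open>Naturality of \<theta> along \<open>g\<close>: the transpose of
    \<open>e \<cdot> g'\<close> is \<open>\<psi> \<cdot> g\<close> = \<open>t\<close>, the transpose
    of \<open>f\<close> composed with the unit isomorphism.\<close>
  have "\<theta> ?I a b (Id K b \<cdot> (e \<cdot> g')) = H1 (Id K a) (Id K b) \<cdot> (\<theta> (d \<otimes>\<^sub>o b) a b e \<cdot> g)"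
    unfolding g'_def using H(2) g(1) e(1) Id_closed [OF ob(1)] Id_closed [OF ob(2)]
    unfolding closed_adjunction_def by blast
  moreover have "Id K b \<cdot> (e \<cdot> g') = e \<cdot> g'"
    using e(1) g' by simp
  ultimately have "\<theta> ?I a b (e \<cdot> g') = \<theta> ?I a b (f \<cdot> LUnit K a)"
    using hom(2) e(2) g t t_def by simp
  then have "e \<cdot> g' = f \<cdot> LUnit K a"
    using inj_onD [OF bij_betw_imp_inj_on [OF bij [OF ob(3)]]] fl e(1) g' by simp
  then have "e \<cdot> g' \<cdot> l = f \<cdot> LUnit K a \<cdot> l"
    using Comp_square [of e g' f "LUnit K a" l] e(1) g' f l(1-6) by simp
  then have "e \<cdot> g' \<cdot> l = f"
    using l f by simp
  then show ?thesis
    using that [of d "g' \<cdot> l" e] d g' e(1) l by simp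
qed

text \<open>Factoring the identity of \<open>a\<close> by \<open>dual_factorization\<close> makes
  \<open>a\<close> a retract, and \<open>J_retract\<close> admits retracts although
  \<open>thick\<close> only mentions summands.\<close>

lemma tt_ideal_radical:
  assumes "strongly_closed K" "idempotent_complete K" "tt_ideal P" "a \<in> Ob K" "a \<otimes>\<^sub>o a \<in> P"
  shows "a \<in> P"
proof -
  obtain d g h where d: "d \<in> Ob K" "g \<in> Mor K" "h \<in> Mor K" "Dom K g = a" "Cod K g = (d \<otimes>\<^sub>o a) \<otimes>\<^sub>o a"
    "Dom K h = (d \<otimes>\<^sub>o a) \<otimes>\<^sub>o a" "Cod K h = a" "h \<cdot> g = Id K a"
    using dual_factorization [OF assms(1), of "Id K a" a a] assms(4) by auto
  have "(d \<otimes>\<^sub>o a) \<otimes>\<^sub>o a \<in> P"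
    using tt_ideal_left [OF assms(3) d(1) assms(5)] tt_ideal_assoc [OF assms(3) d(1) assms(4,4)] by blast
  then show ?thesis
    using verdier.J_retract [OF tt_idealD(1) [OF assms(3)] assms(2) tt_idealD(2) [OF assms(3)] _ d(2,4,5,3,6,7,8)]
    by blast
qed

text \<open>A tt-ideal that is maximal among those avoiding \<open>c\<close> is prime: if \<open>a \<otimes> b\<close> belongs to it but
  \<open>a\<close> and \<open>b\<close> do not, then the transporters show first \<open>c \<otimes> b\<close> and then \<open>c \<otimes> c\<close> to belong to it.\<close>

lemma prime_avoiding:
  assumes sc: "strongly_closed K" and ic: "idempotent_complete K"
    and I: "tt_ideal I" and c: "c \<in> Ob K" "c \<notin> I"
  obtains P where "P \<in> Spc K" "I \<subseteq> P" "c \<notin> P"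
proof -
  let ?A = "{P. tt_ideal P \<and> I \<subseteq> P \<and> c \<notin> P}"
  have "\<exists>M\<in>?A. \<forall>X\<in>?A. M \<subseteq> X \<longrightarrow> X = M"
  proof (rule subset_Zorn_nonempty)
    show "?A \<noteq> {}"
      using I c by blast
  next
    fix C assume C: "C \<noteq> {}" "subset.chain ?A C"
    then have tt: "\<And>P. P \<in> C \<Longrightarrow> tt_ideal P \<and> I \<subseteq> P \<and> c \<notin> P"
      and lin: "\<And>P Q. P \<in> C \<Longrightarrow> Q \<in> C \<Longrightarrow> P \<subseteq> Q \<or> Q \<subseteq> P"
      by (auto simp: subset.chain_def)
    have V: "verdier K P" if "P \<in> C" for P
      using tt that tt_idealD(1) by blast
    have "triangulated_subcategory K (\<Union>C)"
    proof (rule triangulated_subcategoryI)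
      show "\<Union>C \<subseteq> Ob K"
        using tt tt_idealD(4) by blast
      show "z \<in> \<Union>C" if "is_zero_object K z" for z
        using verdier.J_zero [OF V that] C(1) by blast
      show "TOb K a \<in> \<Union>C \<longleftrightarrow> a \<in> \<Union>C" if "a \<in> Ob K" for a
        using verdier.J_T [OF V that] by blast
      show "Cod K v \<in> \<Union>C" if t: "(u, v, w) \<in> Tri K" "Dom K u \<in> \<Union>C" "Cod K u \<in> \<Union>C" for u v w
      proof -
        \<comment> \<open>A triangle involves two given objects, which linearity of the chain places
          in one common member.\<close>
        obtain P Q where "P \<in> C" "Dom K u \<in> P" "Q \<in> C" "Cod K u \<in> Q"
          using t by blast
        then obtain R where "R \<in> C" "Dom K u \<in> R" "Cod K u \<in> R"
          using lin by blast
        then show ?thesis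
          using verdier.J_tri(1) [OF V t(1)] by blast
      qed
    qed
    moreover have "thick K (\<Union>C)"
      using tt tt_idealD(2) unfolding thick_def by blast
    moreover have "\<forall>a\<in>\<Union>C. \<forall>b\<in>Ob K. a \<otimes>\<^sub>o b \<in> \<Union>C"
      using tt tt_idealD(3) by blast
    ultimately show "\<Union>C \<in> ?A"
      using tt C(1) unfolding tt_ideal_def by blast
  qed
  then obtain P where "P \<in> ?A" and A: "\<forall>X\<in>?A. P \<subseteq> X \<longrightarrow> X = P"
    by (elim bexE)
  then have P: "tt_ideal P" "I \<subseteq> P" "c \<notin> P"
    by simp_all
  have max: "X = P" if "tt_ideal X" "P \<subseteq> X" "c \<notin> X" for X
    using A that P(2) by simp
  have transp: "c \<otimes>\<^sub>o y \<in> P" if "x \<in> Ob K" "y \<in> Ob K" "x \<otimes>\<^sub>o y \<in> P" "x \<notin> P" for x y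
  proof (rule ccontr)
    assume *: "c \<otimes>\<^sub>o y \<notin> P"
    \<comment> \<open>This transporter contains both \<open>P\<close> and \<open>x\<close>. If it
      avoided \<open>c\<close>, maximality would make it equal to \<open>P\<close>, which does not
      contain \<open>x\<close>.\<close>
    let ?X = "{a \<in> Ob K. a \<otimes>\<^sub>o y \<in> P}"
    have "?X = P"
      using max [OF tt_ideal_transporter [OF P(1) that(2)]] tt_idealD(3,4) [OF P(1)] that(2) * by blast
    then show False
      using that by blast
  qed
  have "a \<in> P \<or> b \<in> P" if ab: "a \<in> Ob K" "b \<in> Ob K" "a \<otimes>\<^sub>o b \<in> P" for a b
  proof (rule ccontr)
    assume n: "\<not> (a \<in> P \<or> b \<in> P)"
    then have "b \<otimes>\<^sub>o c \<in> P"
      using transp ab tt_ideal_comm [OF P(1) ab(2) c(1)] by blast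
    then have "c \<otimes>\<^sub>o c \<in> P"
      using transp n ab c by blast
    then show False
      using tt_ideal_radical [OF sc ic P(1) c(1)] P(3) by blast
  qed
  then have "P \<in> Spc K"
    using P c unfolding Spc_def prime_tt_ideal_iff by blast
  then show ?thesis
    using that P by blast
qed

section \<open>Supports and the topology of the spectrum\<close>

lemma Spc_tensor_iff:
  "P \<in> Spc K \<Longrightarrow> a \<in> Ob K \<Longrightarrow> b \<in> Ob K \<Longrightarrow> a \<otimes>\<^sub>o b \<in> P \<longleftrightarrow> a \<in> P \<or> b \<in> P"
  using tt_ideal_left tt_idealD(3) unfolding Spc_def prime_tt_ideal_iff by blast

lemma Spc_biproduct_iff:
  assumes "P \<in> Spc K" "is_biproduct K a b c i1 i2 p1 p2"
  shows "c \<in> P \<longleftrightarrow> a \<in> P \<and> b \<in> P"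
  using verdier.J_biproduct [OF tt_idealD(1) [OF Spc_tt_ideal [OF assms(1)]] assms(2)]
    tt_idealD(2) [OF Spc_tt_ideal [OF assms(1)]] assms(2) unfolding thick_def by blast

lemma Spc_unit: "P \<in> Spc K \<Longrightarrow> UnitOb K \<notin> P"
proof
  assume P: "P \<in> Spc K" and "UnitOb K \<in> P"
  then have "a \<in> P" if "a \<in> Ob K" for a
    using tt_ideal_iso [OF Spc_tt_ideal [OF P] LUnit_iso [OF that]] tt_idealD(3) [OF Spc_tt_ideal [OF P]] that
    by blast
  then show False
    using P tt_idealD(4) [OF Spc_tt_ideal [OF P]] unfolding Spc_def prime_tt_ideal_def by blast
qed

text \<open>The support of a direct sum is the union of the supports, so the complements of supports
  are stable under intersection and do form a base.\<close>

lemma openin_Spc: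
  "openin (Spc_topology K) = arbitrary union_of (\<lambda>V. \<exists>a\<in>Ob K. V = Spc K - supp K a)"
  unfolding Spc_topology_def
proof (rule topology_inverse', rule istopology_base)
  fix S T assume "\<exists>a\<in>Ob K. S = Spc K - supp K a" "\<exists>a\<in>Ob K. T = Spc K - supp K a"
  then obtain a b where a: "a \<in> Ob K" "S = Spc K - supp K a" and b: "b \<in> Ob K" "T = Spc K - supp K b"
    by blast
  obtain c i1 i2 p1 p2 where bi: "is_biproduct K a b c i1 i2 p1 p2"
    using biproduct a b by blast
  have "S \<inter> T = Spc K - supp K c"
    using Spc_biproduct_iff [OF _ bi] a b by (auto simp: supp_def)
  then show "\<exists>a\<in>Ob K. S \<inter> T = Spc K - supp K a"
    using biproductD(3) [OF bi] by blast
qed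

text \<open>A finite subcover writes the complement as a finite intersection of supports, and such
  an intersection is the support of a tensor product.\<close>

lemma quasi_compact_open_complement:
  assumes "quasi_compact_open K U"
  obtains k where "k \<in> Ob K" "supp K k = Spc K - U"
proof -
  let ?B = "\<lambda>V. \<exists>a\<in>Ob K. V = Spc K - supp K a"
  have "(arbitrary union_of ?B) U"
    using assms unfolding quasi_compact_open_def openin_Spc by blast
  then obtain C where C: "C \<subseteq> Collect ?B" "\<Union>C = U"
    by (auto simp: union_of_def)
  have "openin (Spc_topology K) V" if "V \<in> C" for V
    unfolding openin_Spc using that C(1) arbitrary_union_of_inc [of ?B V] by blast
  then obtain F where F: "finite F" "F \<subseteq> C" "U \<subseteq> \<Union>F"
    using compactinD [of "Spc_topology K" U C] assms C(2) unfolding quasi_compact_open_def by blast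
  have "\<exists>k\<in>Ob K. supp K k = Spc K - \<Union>F"
    using F(1,2)
  proof (induction F)
    \<comment> \<open>The empty tensor product is the unit, which lies in no prime and so has full
      support.\<close>
    case empty
    then show ?case
      using UnitOb_closed Spc_unit by (intro bexI [of _ "UnitOb K"]) (auto simp: supp_def)
  next
    case (insert V F)
    then obtain k where k: "k \<in> Ob K" "supp K k = Spc K - \<Union>F"
      by blast
    obtain a where a: "a \<in> Ob K" "V = Spc K - supp K a"
      using insert C(1) by blast
    have "supp K (a \<otimes>\<^sub>o k) = supp K a \<inter> supp K k"
      using Spc_tensor_iff a k by (auto simp: supp_def)
    also have "\<dots> = Spc K - \<Union>(insert V F)"
      using k(2) a(2) by (auto simp: supp_def)
    finally show ?case
      using TensOb_closed [OF a(1) k(1)] by blast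
  qed
  moreover have "\<Union>F = U"
    using F C by blast
  ultimately show ?thesis
    using that by blast
qed

lemma outside_eq: "U \<subseteq> Spc K \<Longrightarrow> outside K U = {a \<in> Ob K. \<forall>P\<in>U. a \<in> P}"
  by (auto simp: outside_def supported_on_def supp_def)

lemma tt_ideal_outside: "U \<subseteq> Spc K \<Longrightarrow> tt_ideal (outside K U)"
  using tt_ideal_Inter [of U] Spc_tt_ideal by (auto simp: outside_eq)

text \<open>Every prime lies in U1 or in U2, so it contains the domain or the codomain of
  \<open>f\<close>. Their tensor product is then in all primes, hence zero, and \<open>f\<close>
  factors through a multiple of it.\<close>

lemma orthogonal:
  assumes sc: "strongly_closed K" and ic: "idempotent_complete K" and U: "Spc K = U1 \<union> U2"
    and f: "f \<in> Mor K" "Dom K f \<in> outside K U1" "Cod K f \<in> outside K U2"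
  shows "f = mzero K (Dom K f) (Cod K f)"
proof -
  let ?a = "Dom K f" and ?b = "Cod K f"
  have ab: "?a \<in> Ob K" "?b \<in> Ob K" "?b \<otimes>\<^sub>o ?a \<in> Ob K"
    using f TensOb_closed by auto
  have zero: "is_zero_object K (?b \<otimes>\<^sub>o ?a)"
  proof (rule ccontr)
    assume "\<not> is_zero_object K (?b \<otimes>\<^sub>o ?a)"
    then obtain P where P: "P \<in> Spc K" "?b \<otimes>\<^sub>o ?a \<notin> P"
      using prime_avoiding [OF sc ic tt_ideal_zero ab(3)] by blast
    then have "P \<notin> U1" "P \<notin> U2"
      using f outside_eq [of U1] outside_eq [of U2] U Spc_tensor_iff [OF P(1) ab(2,1)] by auto
    then show False
      using P U by blast
  qed
  obtain d g h where d: "d \<in> Ob K" "g \<in> Mor K" "h \<in> Mor K" "Dom K g = ?a" "Cod K g = (d \<otimes>\<^sub>o ?b) \<otimes>\<^sub>o ?a"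
    "Dom K h = (d \<otimes>\<^sub>o ?b) \<otimes>\<^sub>o ?a" "Cod K h = ?b" "h \<cdot> g = f"
    using dual_factorization [OF sc f(1) refl refl] by blast
  have "d \<otimes>\<^sub>o (?b \<otimes>\<^sub>o ?a) \<in> {z. is_zero_object K z}"
    using tensor_zero(1) [OF zero d(1)] by simp
  then have "is_zero_object K ((d \<otimes>\<^sub>o ?b) \<otimes>\<^sub>o ?a)"
    using tt_ideal_assoc [OF tt_ideal_zero d(1) ab(2,1)] by simp
  then have "g = mzero K ?a ((d \<otimes>\<^sub>o ?b) \<otimes>\<^sub>o ?a)"
    using zero_object_Mor(1) [OF _ d(2)] d(4,5) by simp
  then have "h \<cdot> g = mzero K ?a ?b"
    using d(3,6,7) ab(1) by simp
  then show ?thesis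
    using d(8) by simp
qed

lemma mayer_vietoris_outside:
  assumes sc: "strongly_closed K" and ic: "idempotent_complete K"
    and qc: "quasi_compact_open K U1" "quasi_compact_open K U2" and U: "Spc K = U1 \<union> U2"
  shows "mayer_vietoris K (outside K U1) (outside K U2) (outside K (U1 \<inter> U2))"
proof -
  have sub: "U1 \<subseteq> Spc K" "U2 \<subseteq> Spc K" "U1 \<inter> U2 \<subseteq> Spc K"
    using U by auto
  note tt = tt_ideal_outside [OF sub(1)] tt_ideal_outside [OF sub(2)] tt_ideal_outside [OF sub(3)]
  have U': "Spc K = U2 \<union> U1"
    using U by auto
  interpret O: orthogonal_pair K "outside K U1" "outside K U2"
  proof unfold_locales
    show "triangulated_subcategory K (outside K U1)" "triangulated_subcategory K (outside K U2)"
      using tt unfolding tt_ideal_def by blast+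
  qed (use orthogonal [OF sc ic U] orthogonal [OF sc ic U'] in blast)+
  have "tt_ideal O.dsums"
    unfolding tt_ideal_def
  proof (intro conjI ballI)
    show "triangulated_subcategory K O.dsums" "thick K O.dsums"
      using O.dsums_triangulated [OF ic] tt tt_idealD(2) by blast+
    fix c d assume "c \<in> O.dsums" "d \<in> Ob K"
    then obtain c1 c2 i1 i2 p1 p2 where c: "c1 \<in> outside K U1" "c2 \<in> outside K U2"
      "is_biproduct K c1 c2 c i1 i2 p1 p2"
      unfolding O.dsums_def by blast
    obtain j1 j2 q1 q2 where "is_biproduct K (c1 \<otimes>\<^sub>o d) (c2 \<otimes>\<^sub>o d) (c \<otimes>\<^sub>o d) j1 j2 q1 q2"
      using tensor_right_biproduct [OF c(3) \<open>d \<in> Ob K\<close>] .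
    then show "c \<otimes>\<^sub>o d \<in> O.dsums"
      using O.dsumsI tt_idealD(3) [OF tt(1) c(1)] tt_idealD(3) [OF tt(2) c(2)] \<open>d \<in> Ob K\<close> by blast
  qed
  have "outside K (U1 \<inter> U2) \<subseteq> O.dsums"
  proof
    fix c assume c: "c \<in> outside K (U1 \<inter> U2)"
    show "c \<in> O.dsums"
    proof (rule ccontr)
      assume "c \<notin> O.dsums"
      then obtain P where P: "P \<in> Spc K" "O.dsums \<subseteq> P" "c \<notin> P"
        using prime_avoiding [OF sc ic \<open>tt_ideal O.dsums\<close>] tt_idealD(4) [OF tt(3)] c by blast
      obtain k1 where k1: "k1 \<in> Ob K" "supp K k1 = Spc K - U1"
        using quasi_compact_open_complement [OF qc(1)] .
      obtain k2 where k2: "k2 \<in> Ob K" "supp K k2 = Spc K - U2"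
        using quasi_compact_open_complement [OF qc(2)] .
      \<comment> \<open>Objects supported on one complement are sums with a zero summand, so
        \<open>P\<close> contains them. A prime containing \<open>k1\<close> avoids its support,
        which means that it lies in U1; likewise for \<open>k2\<close>.\<close>
      have "k1 \<in> P" "k2 \<in> P"
        using P(2) O.J1_dsums O.J2_dsums k1 k2 by (auto simp: outside_def supported_on_def)
      then have "P \<in> U1 \<inter> U2"
        using k1 k2 P(1) by (auto simp: supp_def)
      then show False
        using c P(3) outside_eq [OF sub(3)] by blast
    qed
  qed
  show ?thesis
  proof unfold_locales
    show "triangulated_subcategory K (outside K (U1 \<inter> U2))"
      using tt unfolding tt_ideal_def by blast
    show "outside K U1 \<subseteq> outside K (U1 \<inter> U2)" "outside K U2 \<subseteq> outside K (U1 \<inter> U2)"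
      by (auto simp: outside_def supported_on_def)
    show "\<exists>c1\<in>outside K U1. \<exists>c2\<in>outside K U2. \<exists>i1 i2 p1 p2. is_biproduct K c1 c2 c i1 i2 p1 p2"
      if "c \<in> outside K (U1 \<inter> U2)" for c
      using that \<open>outside K (U1 \<inter> U2) \<subseteq> O.dsums\<close> unfolding O.dsums_def by blast
  qed
qed

end

theorem theorem2p11:
  fixes K :: "('o, 'm) tensor_triangulated"
    and U1 U2 :: "'o set set"
    and a b :: 'o
  assumes "tensor_triangulated_category K"
    and "strongly_closed K"
    and "idempotent_complete K"
    and "quasi_compact_open K U1"
    and "quasi_compact_open K U2"
    and "Spc K = U1 \<union> U2"
    and "a \<in> Ob K"
    and "b \<in> Ob K"
  shows
    (* Every representing fraction admits the choices defining the connecting map, and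
       all choices give the same value. The sequence is split at Mor_K(a,b) into its part to
       the right, running through the suspensions T^n b, and its part to the left, running
       through the suspensions T^n a. *)
    "(\<forall>g \<in> carrier (Mor_on K (U1 \<inter> U2) a b). \<forall>(s, f) \<in> g.
       (\<exists>\<alpha> \<beta> \<gamma> \<delta>. connecting_choice K U1 U2 s \<alpha> \<beta> \<gamma> \<delta>) \<and>
       (\<forall>\<alpha> \<beta> \<gamma> \<delta>. connecting_choice K U1 U2 s \<alpha> \<beta> \<gamma> \<delta> \<longrightarrow>
          TMor K f \<cdot>\<^bsub>K\<^esub> \<gamma> \<cdot>\<^bsub>K\<^esub> \<alpha> = connecting K U1 U2 g \<and>
          mneg K (TMor K f \<cdot>\<^bsub>K\<^esub> \<delta> \<cdot>\<^bsub>K\<^esub> \<beta>) = connecting K U1 U2 g)) \<and>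
     group_hom (Mor_on K (U1 \<inter> U2) a b) (hom_group K a (TOb K b)) (connecting K U1 U2) \<and>
     (\<forall>n. let b' = (TOb K ^^ n) b; Tb' = (TOb K ^^ Suc n) b in
       exact_at (hom_group K a b') (res_pair K U1 U2)
                (Mor_pair K U1 U2 a b') (res_diff K U1 U2 a b')
                (Mor_on K (U1 \<inter> U2) a b') \<and>
       exact_at (Mor_pair K U1 U2 a b') (res_diff K U1 U2 a b')
                (Mor_on K (U1 \<inter> U2) a b') (connecting K U1 U2)
                (hom_group K a Tb') \<and>
       exact_at (Mor_on K (U1 \<inter> U2) a b') (connecting K U1 U2)
                (hom_group K a Tb') (res_pair K U1 U2)
                (Mor_pair K U1 U2 a Tb')) \<and>
     (\<forall>n. let a' = (TOb K ^^ n) a; Ta' = (TOb K ^^ Suc n) a in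
       exact_at (hom_group K Ta' b) (res_pair K U1 U2)
                (Mor_pair K U1 U2 Ta' b) (res_diff K U1 U2 Ta' b)
                (Mor_on K (U1 \<inter> U2) Ta' b) \<and>
       exact_at (Mor_pair K U1 U2 Ta' b) (res_diff K U1 U2 Ta' b)
                (Mor_on K (U1 \<inter> U2) Ta' b) (connecting_desusp K U1 U2 a' b)
                (hom_group K a' b) \<and>
       exact_at (Mor_on K (U1 \<inter> U2) Ta' b) (connecting_desusp K U1 U2 a' b)
                (hom_group K a' b) (res_pair K U1 U2)
                (Mor_pair K U1 U2 a' b))"
proof -
  interpret tensor_triangulated_category K
    by (rule assms(1))
  interpret M: mayer_vietoris K "outside K U1" "outside K U2" "outside K (U1 \<inter> U2)"
    using mayer_vietoris_outside assms(2-6) .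
  have choice: "connecting_choice K U1 U2 s \<alpha> \<beta> \<gamma> \<delta> \<longleftrightarrow>
      (\<exists>c1 c2 i1 i2 p1 p2 v w. M.choice s c1 c2 i1 i2 p1 p2 v w \<and>
        \<alpha> = p1 \<cdot>\<^bsub>K\<^esub> v \<and> \<beta> = p2 \<cdot>\<^bsub>K\<^esub> v \<and> \<gamma> = w \<cdot>\<^bsub>K\<^esub> i1 \<and> \<delta> = w \<cdot>\<^bsub>K\<^esub> i2)" for s \<alpha> \<beta> \<gamma> \<delta>
    unfolding connecting_choice_def M.choice_def by blast
  have comp: "(w \<cdot>\<^bsub>K\<^esub> i1) \<cdot>\<^bsub>K\<^esub> p1 \<cdot>\<^bsub>K\<^esub> v = w \<cdot>\<^bsub>K\<^esub> i1 \<cdot>\<^bsub>K\<^esub> p1 \<cdot>\<^bsub>K\<^esub> v"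
    if "M.choice s c1 c2 i1 i2 p1 p2 v w" for s c1 c2 i1 i2 p1 p2 v w
    using M.choice_typing [OF that] by simp
  \<comment> \<open>The two definite descriptions range over the same values: the four components
    come from a \<open>choice\<close>, and the composites differ by bracketing only.\<close>
  have "(\<exists>\<alpha> \<beta> \<gamma> \<delta>. connecting_choice K U1 U2 s \<alpha> \<beta> \<gamma> \<delta> \<and> h = TMor K f \<cdot>\<^bsub>K\<^esub> \<gamma> \<cdot>\<^bsub>K\<^esub> \<alpha>) \<longleftrightarrow>
      (\<exists>k. M.kappa s k \<and> h = TMor K f \<cdot>\<^bsub>K\<^esub> k)" (is "?l \<longleftrightarrow> ?r") for h s f
  proof
    assume ?l
    then obtain c1 c2 i1 i2 p1 p2 v w where c: "M.choice s c1 c2 i1 i2 p1 p2 v w"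
      "h = TMor K f \<cdot>\<^bsub>K\<^esub> (w \<cdot>\<^bsub>K\<^esub> i1) \<cdot>\<^bsub>K\<^esub> p1 \<cdot>\<^bsub>K\<^esub> v"
      unfolding choice by blast
    show ?r
      unfolding c(2) comp [OF c(1)] using M.kappaI [OF c(1)] by blast
  next
    assume ?r
    then obtain c1 c2 i1 i2 p1 p2 v w where c: "M.choice s c1 c2 i1 i2 p1 p2 v w"
      "h = TMor K f \<cdot>\<^bsub>K\<^esub> w \<cdot>\<^bsub>K\<^esub> i1 \<cdot>\<^bsub>K\<^esub> p1 \<cdot>\<^bsub>K\<^esub> v"
      unfolding M.kappa_def by blast
    show ?l
      unfolding choice c(2) comp [OF c(1), symmetric] using c(1) by blast
  qed
  then have conn: "connecting K U1 U2 = M.conn"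
    by (intro ext) (simp only: connecting_def M.conn_def)
  have desusp: "connecting_desusp K U1 U2 = M.desusp"
    by (intro ext) (simp add: connecting_desusp_def M.desusp_def conn)
  have on: "Mor_on K U1 = M.V1.G" "Mor_on K U2 = M.V2.G" "Mor_on K (U1 \<inter> U2) = M.V.G"
    by (intro ext, simp add: Mor_on_def LU_def)+
  have maps: "Mor_pair K U1 U2 = M.pair_group" "res_pair K U1 U2 = M.res" "res_diff K U1 U2 = M.diff"
    by (intro ext, simp add: Mor_pair_def on res_pair_def rho_on_def M.res_def res_diff_def M.diff_def
        restrict_to_def)+
  have Tn: "(TOb K ^^ n) x \<in> Ob K" if "x \<in> Ob K" for n x
    using that by (induction n) auto
  have well_defined: "(\<exists>\<alpha> \<beta> \<gamma> \<delta>. connecting_choice K U1 U2 s \<alpha> \<beta> \<gamma> \<delta>) \<and>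
       (\<forall>\<alpha> \<beta> \<gamma> \<delta>. connecting_choice K U1 U2 s \<alpha> \<beta> \<gamma> \<delta> \<longrightarrow>
          TMor K f \<cdot>\<^bsub>K\<^esub> \<gamma> \<cdot>\<^bsub>K\<^esub> \<alpha> = connecting K U1 U2 g \<and>
          mneg K (TMor K f \<cdot>\<^bsub>K\<^esub> \<delta> \<cdot>\<^bsub>K\<^esub> \<beta>) = connecting K U1 U2 g)"
    if g: "g \<in> carrier (M.V.G a b)" "(s, f) \<in> g" for g s f
  proof -
    obtain t h where t: "M.V.frac a b t h" "g = M.V.cls t h"
      using g(1) unfolding M.V.G_carrier by blast
    then have fr: "M.V.frac a b s f" "g = M.V.cls s f"
      using M.V.mem_cls_iff [OF t(1)] g(2) by auto
    have "\<exists>\<alpha> \<beta> \<gamma> \<delta>. connecting_choice K U1 U2 s \<alpha> \<beta> \<gamma> \<delta>"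
      unfolding choice using M.choice_exists [OF M.V.fracD(1) [OF fr(1)]] by metis
    moreover have "TMor K f \<cdot>\<^bsub>K\<^esub> \<gamma> \<cdot>\<^bsub>K\<^esub> \<alpha> = connecting K U1 U2 g \<and>
        mneg K (TMor K f \<cdot>\<^bsub>K\<^esub> \<delta> \<cdot>\<^bsub>K\<^esub> \<beta>) = connecting K U1 U2 g"
      if ch: "connecting_choice K U1 U2 s \<alpha> \<beta> \<gamma> \<delta>" for \<alpha> \<beta> \<gamma> \<delta>
    proof -
      obtain c1 c2 i1 i2 p1 p2 v w where c: "M.choice s c1 c2 i1 i2 p1 p2 v w"
        and eqs: "\<alpha> = p1 \<cdot>\<^bsub>K\<^esub> v" "\<beta> = p2 \<cdot>\<^bsub>K\<^esub> v" "\<gamma> = w \<cdot>\<^bsub>K\<^esub> i1" "\<delta> = w \<cdot>\<^bsub>K\<^esub> i2"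
        using ch unfolding choice by blast
      show ?thesis
        unfolding eqs conn fr(2)
        using M.conn_cls [OF fr(1) M.kappaI [OF c]] M.choice_opposite [OF c, of f] M.V.fracD [OF fr(1)]
          M.choice_typing [OF c] by simp
    qed
    ultimately show ?thesis
      by blast
  qed
  show ?thesis
    unfolding conn [symmetric] maps on desusp Let_def funpow.simps o_apply
  proof (intro conjI allI ballI)
    fix g x assume "g \<in> carrier (M.V.G a b)" "x \<in> g"
    then show "case x of (s, f) \<Rightarrow> (\<exists>\<alpha> \<beta> \<gamma> \<delta>. connecting_choice K U1 U2 s \<alpha> \<beta> \<gamma> \<delta>) \<and>
       (\<forall>\<alpha> \<beta> \<gamma> \<delta>. connecting_choice K U1 U2 s \<alpha> \<beta> \<gamma> \<delta> \<longrightarrow>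
          TMor K f \<cdot>\<^bsub>K\<^esub> \<gamma> \<cdot>\<^bsub>K\<^esub> \<alpha> = connecting K U1 U2 g \<and>
          mneg K (TMor K f \<cdot>\<^bsub>K\<^esub> \<delta> \<cdot>\<^bsub>K\<^esub> \<beta>) = connecting K U1 U2 g)"
      using well_defined by (cases x) simp
  \<comment> \<open>Each remaining claim is an exactness result of the locale, at a and an iterated
    suspension of b or the other way round.\<close>
  qed (simp_all add: conn M.conn_hom M.exact_res_diff M.exact_diff_conn M.exact_conn_res
      M.exact_diff_desusp M.exact_desusp_res Tn assms(7,8))
qed

end
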